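(* For every $s\in(0,\infty)$, $\mathrm J_s(\mathrm{bmo})\subsetneqq\overline{\mathrm J_s(\mathrm{bmo})}^{\Lambda_s}\subsetneqq\Lambda_s$, where the closure is taken in the norm of $\Lambda_s$.
   Context: $\Lambda_s$: bounded continuous $f$ on $\mathbb R^n$ with $\|f\|_{\Lambda_s}:=\|f\|_{L^\infty}+\sup_{x\in\mathbb R^n,y\in(0,1]}\sup_{|h|=y}|\Delta^{\lfloor s\rfloor+1}_hf(x)|/y^s<\infty$, where $\Delta_hf(x)=f(x+h/2)-f(x-h/2)$ and $\Delta^{k+1}_h=\Delta^k_h\Delta_h$. $\mathrm{bmo}$ is the space of $f\in L^1_{\rm loc}(\mathbb R^n)$ with $\|f\|_{\rm bmo}:=\sup_B\frac1{|B|}\int_B|f-f_B|+\sup_{k\in\mathbb Z^n}(\int_{k+[0,1)^n}|f|^2)^{1/2}<\infty$; $\mathrm J_s(\mathrm{bmo}):=(I-\Delta)^{-s/2}(\mathrm{bmo})$ with norm $\|(I-\Delta)^{s/2}f\|_{\rm bmo}$ (equal to $F^s_{\infty,2}$ with equivalent norms), a subspace of $\Lambda_s$. *)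

theory Defs
  imports "HOL-Analysis.Analysis"
begin

definition sdiff :: "'a::euclidean_space \<Rightarrow> ('a \<Rightarrow> real) \<Rightarrow> ('a \<Rightarrow> real)" where
  "sdiff h f = (\<lambda>x. f (x + h /\<^sub>R 2) - f (x - h /\<^sub>R 2))"

definition sdiff_pow :: "nat \<Rightarrow> 'a::euclidean_space \<Rightarrow> ('a \<Rightarrow> real) \<Rightarrow> ('a \<Rightarrow> real)" where
  "sdiff_pow k h f = ((sdiff h) ^^ k) f"

definition zyg_quot :: "real \<Rightarrow> ('a::euclidean_space \<Rightarrow> real) \<Rightarrow> real set" where
  "zyg_quot s f = {\<bar>sdiff_pow (nat \<lfloor>s\<rfloor> + 1) h f x\<bar> / (norm h powr s) | x h. 0 < norm h \<and> norm h \<le> 1}"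

definition Lambda :: "real \<Rightarrow> ('a::euclidean_space \<Rightarrow> real) set" where
  "Lambda s = {f. continuous_on UNIV f \<and> bounded (range f) \<and> bdd_above (zyg_quot s f)}"

definition Lambda_norm :: "real \<Rightarrow> ('a::euclidean_space \<Rightarrow> real) \<Rightarrow> real" where
  "Lambda_norm s f = (SUP x. \<bar>f x\<bar>) + Sup (zyg_quot s f)"

definition ball_avg :: "('a::euclidean_space \<Rightarrow> real) \<Rightarrow> 'a set \<Rightarrow> real" where
  "ball_avg f B = (LINT y:B|lborel. f y) / measure lborel B"

definition mean_osc :: "('a::euclidean_space \<Rightarrow> real) \<Rightarrow> 'a set \<Rightarrow> real" where
  "mean_osc f B = (LINT y:B|lborel. \<bar>f y - ball_avg f B\<bar>) / measure lborel B"

definition int_lattice :: "'a::euclidean_space set" where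
  "int_lattice = {k. \<forall>i\<in>Basis. k \<bullet> i \<in> \<int>}"

definition unit_cube :: "'a::euclidean_space \<Rightarrow> 'a set" where
  "unit_cube k = {x. \<forall>i\<in>Basis. k \<bullet> i \<le> x \<bullet> i \<and> x \<bullet> i < k \<bullet> i + 1}"

definition bmo :: "('a::euclidean_space \<Rightarrow> real) set" where
  "bmo = {f. f \<in> borel_measurable borel
           \<and> (\<forall>K. compact K \<longrightarrow> set_integrable lborel K f)
           \<and> bdd_above {mean_osc f (ball x r) | x r. r > 0}
           \<and> (\<forall>k\<in>int_lattice. set_integrable lborel (unit_cube k) (\<lambda>x. (f x)\<^sup>2))
           \<and> bdd_above {sqrt (LINT x:unit_cube k|lborel. (f x)\<^sup>2) | k. k \<in> int_lattice}}"

text \<open>Bessel kernel G_s (kernel of (I - Laplacian)^(-s/2)), via heat-kernel subordination: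
  G_s(x) = 1/Gamma(s/2) * int_0^infty t^(s/2-1) e^(-t) (4 pi t)^(-n/2) e^(-|x|^2/(4t)) dt.\<close>
definition bessel_kernel :: "real \<Rightarrow> 'a::euclidean_space \<Rightarrow> real" where
  "bessel_kernel s x = (1 / Gamma (s / 2)) *
     (LINT t:{0<..}|lborel. t powr (s / 2 - 1) * exp (- t) * (4 * pi * t) powr (- real DIM('a) / 2)
                             * exp (- (norm x)\<^sup>2 / (4 * t)))"

definition bessel_pot :: "real \<Rightarrow> ('a::euclidean_space \<Rightarrow> real) \<Rightarrow> ('a \<Rightarrow> real)" where
  "bessel_pot s g = (\<lambda>x. LINT y|lborel. bessel_kernel s (x - y) * g y)"

definition J_bmo :: "real \<Rightarrow> ('a::euclidean_space \<Rightarrow> real) set" where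
  "J_bmo s = bessel_pot s ` bmo"

definition Lambda_closure :: "real \<Rightarrow> ('a::euclidean_space \<Rightarrow> real) set \<Rightarrow> ('a \<Rightarrow> real) set" where
  "Lambda_closure s A = {f \<in> Lambda s. \<forall>\<epsilon>>0. \<exists>g\<in>A. Lambda_norm s (\<lambda>x. f x - g x) < \<epsilon>}"

end

theory Submission
  imports Defs "HOL-Probability.Characteristic_Functions"
begin

text \<open>
  Let \<open>P\<^sub>t\<close> be the heat kernel, so that \<open>bessel_pot s g\<close> is the average of \<open>P\<^sub>t * g\<close> over \<open>t\<close> with weight
  \<open>t powr (s/2 - 1) * exp (- t) / Gamma (s/2)\<close>. For \<open>g \<in> bmo\<close> one has \<open>\<bar>P\<^sub>t * g - P\<^bsub>4t\<^esub> * g\<bar> \<le> C\<close>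
  and, writing \<open>P\<^sub>t\<close> as an \<open>m\<close>-fold convolution, \<open>\<bar>\<Delta>\<^sub>h\<^sup>m (P\<^sub>t * g)\<bar> \<le> C (\<bar>h\<bar> / \<surd>t)\<^sup>m\<close>.
  Integrating in \<open>t\<close> puts \<open>bessel_pot s g\<close> into the Zygmund space of order \<open>s\<close>.

  For strictness take \<open>f = \<Sum>k. a\<^sub>k \<lambda>\<^sub>k\<^bsup>-s\<^esup> cos (\<lambda>\<^sub>k x\<^sub>1)\<close> with \<open>\<lambda>\<^sub>k = 2\<^bsup>k+2\<^esup>\<close>. It lies in the Zygmund space if
  \<open>a\<close> is bounded, and in the closure if \<open>a\<^sub>k \<rightarrow> 0\<close>. Let \<open>\<langle>F\<rangle>\<close> denote the limit of \<open>\<integral> P\<^sub>t F\<close> as \<open>t \<rightarrow> \<infinity>\<close>.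
  Under this mean the cosines are orthogonal, convolution with the Bessel kernel acts on them as a multiplier,
  and \<open>\<langle>g\<^sup>2\<rangle>\<close> is bounded for \<open>g \<in> bmo\<close>; so the coefficients of \<open>g\<close> at the frequencies \<open>\<lambda>\<^sub>k\<close> are square
  summable. A function of Zygmund norm \<open>\<epsilon>\<close> has coefficients \<open>O(\<epsilon> \<lambda>\<^sub>k\<^bsup>-s\<^esup>)\<close>, by summation by parts with
  \<open>\<Delta>\<^sub>h\<^sup>m\<close> for \<open>h = \<pi> / \<lambda>\<^sub>k\<close>. Hence \<open>a\<^sub>k = 1 / \<surd>(k+1)\<close> separates the first pair of spaces and \<open>a\<^sub>k = 1\<close> the second.
\<close>

section \<open>The heat kernel\<close>

text \<open>The Zygmund estimate has to survive \<open>g\<close> being unbounded. Differences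
  annihilate constants, so a constant \<open>c\<close> depending on the point and the time is
  subtracted first; the difference of two heat kernels at time \<open>t\<close> is then dominated by
  the kernel at time \<open>4 * t\<close>, whose wider profile absorbs the linear factor coming from
  the exponent. Hence oscillation is measured at time \<open>4 * t\<close> and times change by
  factors of 4. Towards small times the heat extension may grow logarithmically; the logarithm is
  traded for \<open>t powr (- \<delta>)\<close> with \<open>\<delta> < s / 2\<close>, which the
  weight \<open>t powr (s / 2 - 1)\<close> tolerates.

  The Gaussian means of an arbitrary \<open>g\<close> against a cosine need not converge as time
  grows. The lemmas on \<open>g\<close> therefore assert only that differences of means tend to 0,
  the comparison with the square bound is made at each finite time, and limits are taken only of
  quantities known to converge. The coefficients \<open>1 / sqrt (k + 1)\<close> work because they
  tend to 0 without being square summable.\<close>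

lemma lborel_shift_eq:
  fixes a :: "'a::euclidean_space" and c :: real
  assumes "\<bar>c\<bar> = 1"
  shows "distr lborel borel (\<lambda>x. a + c *\<^sub>R x) = (lborel :: 'a measure)"
  using lborel_affine[of c a] assms by (simp add: density_1)

lemma lborel_integral_shift:
  fixes f :: "'a::euclidean_space \<Rightarrow> real"
  assumes [measurable]: "f \<in> borel_measurable borel"
  shows lborel_integrable_minus: "integrable lborel (\<lambda>y. f (a - y)) \<longleftrightarrow> integrable lborel f"
    and lborel_integral_minus: "(LINT y|lborel. f (a - y)) = integral\<^sup>L lborel f"
    and lborel_integrable_plus: "integrable lborel (\<lambda>y. f (a + y)) \<longleftrightarrow> integrable lborel f"
    and lborel_integral_plus: "(LINT y|lborel. f (a + y)) = integral\<^sup>L lborel f"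
proof -
  have m: "distr lborel borel (\<lambda>x. a - x) = (lborel :: 'a measure)" "distr lborel borel (\<lambda>x. a + x) = (lborel :: 'a measure)"
    using lborel_shift_eq[of "-1" a] lborel_shift_eq[of 1 a] by simp_all
  have "integrable (distr lborel borel (\<lambda>x. a - x)) f \<longleftrightarrow> integrable lborel (\<lambda>y. f (a - y))"
       "integrable (distr lborel borel (\<lambda>x. a + x)) f \<longleftrightarrow> integrable lborel (\<lambda>y. f (a + y))"
    by (intro integrable_distr_eq; simp)+
  then show "integrable lborel (\<lambda>y. f (a - y)) \<longleftrightarrow> integrable lborel f"
    "integrable lborel (\<lambda>y. f (a + y)) \<longleftrightarrow> integrable lborel f"
    by (simp_all add: m)
  have "integral\<^sup>L (distr lborel borel (\<lambda>x. a - x)) f = (LINT y|lborel. f (a - y))"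
       "integral\<^sup>L (distr lborel borel (\<lambda>x. a + x)) f = (LINT y|lborel. f (a + y))"
    by (intro integral_distr; simp)+
  then show "(LINT y|lborel. f (a - y)) = integral\<^sup>L lborel f" "(LINT y|lborel. f (a + y)) = integral\<^sup>L lborel f"
    by (simp_all add: m)
qed

lemma lborel_prod_basis:
  fixes f :: "'a::euclidean_space \<Rightarrow> real \<Rightarrow> real"
  assumes "\<And>b. b \<in> Basis \<Longrightarrow> integrable lborel (f b)"
  shows "has_bochner_integral lborel (\<lambda>x::'a. \<Prod>b\<in>Basis. f b (x \<bullet> b)) (\<Prod>b\<in>Basis. integral\<^sup>L lborel (f b))"
proof -
  interpret product_sigma_finite "\<lambda>b::'a. lborel :: real measure" ..
  have [measurable]: "f b \<in> borel_measurable borel" if "b \<in> Basis" for b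
    using borel_measurable_integrable[OF assms[OF that]] by simp
  have eq: "(lborel :: 'a measure) = distr (\<Pi>\<^sub>M b\<in>Basis. lborel) borel (\<lambda>x. \<Sum>b\<in>Basis. x b *\<^sub>R b)"
    by (simp add: lborel_def[where 'a='a] lborel_eq_real)
  have *: "(\<lambda>x. \<Prod>b\<in>Basis. f b ((\<Sum>i\<in>Basis. x i *\<^sub>R i) \<bullet> b)) = (\<lambda>x. \<Prod>b\<in>Basis. f b (x b))"
    by (intro ext prod.cong) auto
  show ?thesis
    unfolding eq
  proof (rule has_bochner_integral_distr)
    show "has_bochner_integral (\<Pi>\<^sub>M b\<in>Basis. lborel) (\<lambda>x. \<Prod>b\<in>Basis. f b ((\<Sum>i\<in>Basis. x i *\<^sub>R i) \<bullet> b))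
        (\<Prod>b\<in>Basis. integral\<^sup>L lborel (f b))"
      unfolding * has_bochner_integral_iff
      using product_integrable_prod[OF finite_Basis assms] product_integral_prod[OF finite_Basis assms] by simp
    show "(\<lambda>x::'a. \<Prod>b\<in>Basis. f b (x \<bullet> b)) \<in> borel_measurable borel"
      by (rule borel_measurable_prod) (rule measurable_compose[of _ _ borel], auto)
    show "(\<lambda>x. \<Sum>b\<in>Basis. x b *\<^sub>R b) \<in> measurable (\<Pi>\<^sub>M b\<in>Basis. lborel) (borel :: 'a measure)"
      by (intro borel_measurable_sum borel_measurable_scaleR) auto
  qed
qed

text \<open>Multiply the characteristic function of the standard normal law by the unit complex
  number of argument \<open>th\<close> and take real parts. The free phase covers sines as well and
  is what translations produce.\<close>

lemma gauss_cos_std: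
  "has_bochner_integral lborel (\<lambda>v. std_normal_density v * cos (l * v + th)) (exp (- l\<^sup>2 / 2) * cos th)"
proof -
  have "char std_normal_distribution l = (LINT v|lborel. std_normal_density v *\<^sub>R iexp (l * v))"
    unfolding char_def by (subst integral_density) (auto simp: normal_density_nonneg)
  then have E: "(LINT v|lborel. std_normal_density v *\<^sub>R iexp (l * v)) = exp (- l\<^sup>2 / 2)"
    by (simp add: char_std_normal_distribution)
  have I: "integrable lborel (\<lambda>v. std_normal_density v *\<^sub>R iexp (l * v))"
    by (rule Bochner_Integration.integrable_bound[OF integrable_normal_density[of 1 0]]) auto
  have "has_bochner_integral lborel (\<lambda>v. std_normal_density v *\<^sub>R iexp (l * v)) (complex_of_real (exp (- l\<^sup>2 / 2)))"
    using I E by (simp add: has_bochner_integral_iff)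
  then have "has_bochner_integral lborel (\<lambda>v. Re (exp (\<i> * th) * (std_normal_density v *\<^sub>R iexp (l * v))))
     (Re (exp (\<i> * th) * complex_of_real (exp (- l\<^sup>2 / 2))))"
    by (intro has_bochner_integral_Re has_bochner_integral_mult_right) auto
  moreover have "Re (exp (\<i> * th) * (std_normal_density v *\<^sub>R iexp (l * v))) = std_normal_density v * cos (l * v + th)" for v
    by (simp add: Re_exp Im_exp cos_add)
  moreover have "Re (exp (\<i> * th) * complex_of_real (exp (- l\<^sup>2 / 2))) = exp (- l\<^sup>2 / 2) * cos th"
    by (simp add: Re_exp Im_exp)
  ultimately show ?thesis by (simp only:)
qed

lemma gauss_cos:
  assumes "t > 0"
  shows "has_bochner_integral lborel (\<lambda>v. (4 * pi * t) powr (-1/2) * exp (- v\<^sup>2 / (4 * t)) * cos (l * v + th))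
           (exp (- t * l\<^sup>2) * cos th)"
proof -
  \<comment> \<open>The one-dimensional heat kernel at time \<open>t\<close> is the normal density
    of variance \<open>2 * t\<close>.\<close>
  define c where "c = sqrt (2 * t)"
  have c: "c > 0" "c\<^sup>2 = 2 * t" using assms by (auto simp: c_def)
  have "has_bochner_integral lborel (\<lambda>v. (4 * pi * t) powr (-1/2) * exp (- v\<^sup>2 / (4 * t)) * cos (l * v + th))
           (exp (- t * l\<^sup>2) * cos th) \<longleftrightarrow>
        has_bochner_integral lborel (\<lambda>v. (4 * pi * t) powr (-1/2) * exp (- (0 + c * v)\<^sup>2 / (4 * t)) * cos (l * (0 + c * v) + th))
           ((exp (- t * l\<^sup>2) * cos th) /\<^sub>R \<bar>c\<bar>)"
    using c by (intro lborel_has_bochner_integral_real_affine_iff) auto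
  also have "(\<lambda>v. (4 * pi * t) powr (-1/2) * exp (- (0 + c * v)\<^sup>2 / (4 * t)) * cos (l * (0 + c * v) + th))
       = (\<lambda>v. (std_normal_density v * cos (l * c * v + th)) /\<^sub>R \<bar>c\<bar>)"
  proof
    fix v
    have "(4 * pi * t) powr (-1/2) = 1 / sqrt (2 * pi) / c"
      using assms by (simp add: powr_minus_divide powr_half_sqrt c_def real_sqrt_mult)
    moreover have "- (0 + c * v)\<^sup>2 / (4 * t) = - v\<^sup>2 / 2"
      using assms by (simp add: power_mult_distrib c)
    ultimately show "(4 * pi * t) powr (-1/2) * exp (- (0 + c * v)\<^sup>2 / (4 * t)) * cos (l * (0 + c * v) + th)
       = (std_normal_density v * cos (l * c * v + th)) /\<^sub>R \<bar>c\<bar>"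
      unfolding std_normal_density_def using c by (simp only: mult_ac) (simp add: divide_simps mult_ac)
  qed
  finally show ?thesis
    using has_bochner_integral_scaleR_right[OF gauss_cos_std[of "l * c" th], of "inverse \<bar>c\<bar>"] c
    by (simp add: power_mult_distrib mult.commute)
qed

definition heat :: "real \<Rightarrow> 'a::euclidean_space \<Rightarrow> real" where
  "heat t x = (4 * pi * t) powr (- real DIM('a) / 2) * exp (- (norm x)\<^sup>2 / (4 * t))"

lemma heat_nonneg [simp]: "0 \<le> heat t x"
  by (simp add: heat_def)

lemma heat_minus [simp]: "heat t (- x) = heat t x"
  by (simp add: heat_def)

lemma borel_measurable_heat [measurable]:
  assumes [measurable]: "f \<in> borel_measurable M" "h \<in> borel_measurable M"
  shows "(\<lambda>x. heat (f x) (h x)) \<in> borel_measurable M"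
  unfolding heat_def by simp

lemma heat_cos_integral:
  fixes b :: "'a::euclidean_space"
  assumes t: "t > 0" and b: "b \<in> Basis"
  shows "has_bochner_integral lborel (\<lambda>x::'a. heat t x * cos (l * (x \<bullet> b) + th)) (exp (- t * l\<^sup>2) * cos th)"
proof -
  \<comment> \<open>The kernel factors over the coordinates. Only coordinate \<open>b\<close>
    carries the cosine; the others get frequency and phase 0, hence integral 1.\<close>
  define f where "f i v = (4 * pi * t) powr (-1/2) * exp (- v\<^sup>2 / (4 * t)) * cos ((if i = b then l else 0) * v + (if i = b then th else 0))"
    for i :: 'a and v
  have f: "has_bochner_integral lborel (f i) (if i = b then exp (- t * l\<^sup>2) * cos th else 1)" for i
    unfolding f_def using gauss_cos[OF t, of l th] gauss_cos[OF t, of 0 0] by simp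
  have "has_bochner_integral lborel (\<lambda>x::'a. \<Prod>i\<in>Basis. f i (x \<bullet> i)) (\<Prod>i\<in>Basis. integral\<^sup>L lborel (f i))"
    using f by (intro lborel_prod_basis) (auto simp: has_bochner_integral_iff)
  also have "(\<Prod>i\<in>Basis. integral\<^sup>L lborel (f i)) = (\<Prod>i\<in>Basis. if i = b then exp (- t * l\<^sup>2) * cos th else 1)"
    using f by (intro prod.cong) (auto simp: has_bochner_integral_iff)
  also have "\<dots> = exp (- t * l\<^sup>2) * cos th"
    using b by simp
  also have "(\<lambda>x::'a. \<Prod>i\<in>Basis. f i (x \<bullet> i)) = (\<lambda>x. heat t x * cos (l * (x \<bullet> b) + th))"
  proof
    fix x :: 'a
    have "(\<Prod>i\<in>Basis. f i (x \<bullet> i)) = (\<Prod>i\<in>(Basis::'a set). (4 * pi * t) powr (-1/2)) *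
        (\<Prod>i\<in>Basis. exp (- (x \<bullet> i)\<^sup>2 / (4 * t))) * (\<Prod>i\<in>Basis. if i = b then cos (l * (x \<bullet> b) + th) else 1)"
      unfolding f_def prod.distrib by (intro arg_cong2[where f="(*)"] refl prod.cong) auto
    also have "(\<Prod>i\<in>(Basis::'a set). (4 * pi * t) powr (-1/2)) = (4 * pi * t) powr (- real DIM('a) / 2)"
      using t by (simp add: powr_realpow[symmetric] powr_powr)
    also have "(\<Prod>i\<in>Basis. exp (- (x \<bullet> i)\<^sup>2 / (4 * t))) = exp (- (norm x)\<^sup>2 / (4 * t))"
    proof -
      have "(norm x)\<^sup>2 = (\<Sum>i\<in>Basis. (x \<bullet> i)\<^sup>2)"
        unfolding power2_norm_eq_inner by (subst euclidean_inner) (simp add: power2_eq_square)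
      then show ?thesis
        by (simp add: exp_sum[symmetric] sum_negf sum_divide_distrib[symmetric])
    qed
    finally show "(\<Prod>i\<in>Basis. f i (x \<bullet> i)) = heat t x * cos (l * (x \<bullet> b) + th)"
      using b by (simp add: heat_def)
  qed
  finally show ?thesis .
qed

lemma heat_has_integral:
  assumes "t > 0"
  shows "has_bochner_integral lborel (heat t :: 'a::euclidean_space \<Rightarrow> real) 1"
  using heat_cos_integral[OF assms SOME_Basis, where l=0 and th=0 and 'a='a] by simp

lemma heat_semigroup:
  fixes x z :: "'a::euclidean_space"
  assumes a: "a > 0" and b: "b > 0"
  shows "has_bochner_integral lborel (\<lambda>y. heat a (x - y) * heat b (y - z)) (heat (a + b) (x - z))"
proof -
  \<comment> \<open>Completing the square in \<open>y\<close>: the product is a Gaussian centred at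
    \<open>(b * x + a * z) / (a + b)\<close>, of time \<open>a * b / (a + b)\<close>, times a factor
    free of \<open>y\<close>.\<close>
  define w where "w = (b / (a + b)) *\<^sub>R (x - z) + z"
  have "heat a (x - y) * heat b (y - z) = heat (a + b) (x - z) * heat (a * b / (a + b)) (w - y)" for y
  proof -
    have "(norm (x - y))\<^sup>2 / (4 * a) + (norm (y - z))\<^sup>2 / (4 * b)
        = (norm (x - z))\<^sup>2 / (4 * (a + b)) + (norm (w - y))\<^sup>2 / (4 * (a * b / (a + b)))"
    proof -
      define p q where "p = x - z" and "q = y - z"
      have *: "x - y = p - q" "y - z = q" "x - z = p" "w - y = (b / (a + b)) *\<^sub>R p - q"
        by (auto simp: p_def q_def w_def)
      have "a + b \<noteq> 0" using a b by auto
      then show ?thesis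
        unfolding * power2_norm_eq_inner inner_diff_left inner_diff_right inner_scaleR_left inner_scaleR_right
        inner_commute[of q p]
        using a b by (simp add: divide_simps) algebra
    qed
    then have e: "exp (- (norm (x - y))\<^sup>2 / (4 * a)) * exp (- (norm (y - z))\<^sup>2 / (4 * b)) =
      exp (- (norm (x - z))\<^sup>2 / (4 * (a + b))) * exp (- (norm (w - y))\<^sup>2 / (4 * (a * b / (a + b))))"
      unfolding exp_add[symmetric] minus_divide_left[symmetric] by (simp add: minus_add_distrib[symmetric] del: minus_add_distrib)
    have c: "(4 * pi * a) powr p * (4 * pi * b) powr p = (4 * pi * (a + b)) powr p * (4 * pi * (a * b / (a + b))) powr p" for p
    proof -
      have "(4 * pi * a) * (4 * pi * b) = (4 * pi * (a + b)) * (4 * pi * (a * b / (a + b)))"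
        using a b by (simp add: divide_simps add_eq_0_iff)
      then have "((4 * pi * a) * (4 * pi * b)) powr p = ((4 * pi * (a + b)) * (4 * pi * (a * b / (a + b)))) powr p"
        by (rule arg_cong)
      then show ?thesis using a b unfolding powr_mult by simp
    qed
    have "heat a (x - y) * heat b (y - z) = ((4 * pi * a) powr (- real DIM('a) / 2) * (4 * pi * b) powr (- real DIM('a) / 2)) *
       (exp (- (norm (x - y))\<^sup>2 / (4 * a)) * exp (- (norm (y - z))\<^sup>2 / (4 * b)))"
      by (simp add: heat_def mult_ac)
    then show ?thesis
      unfolding e c by (simp add: heat_def mult_ac)
  qed
  moreover have "has_bochner_integral lborel (\<lambda>y. heat (a * b / (a + b)) (w - y)) 1"
    using heat_has_integral[of "a * b / (a + b)", where 'a='a] a b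
    by (simp add: has_bochner_integral_iff lborel_integrable_minus lborel_integral_minus)
  ultimately show ?thesis
    using has_bochner_integral_mult_right[of "heat (a + b) (x - z)" lborel "\<lambda>y. heat (a * b / (a + b)) (w - y)" 1]
    by simp
qed

section \<open>Comparison of heat kernels at times \<open>t\<close> and \<open>4 * t\<close>\<close>

lemma heat_4:
  fixes x :: "'a::euclidean_space"
  assumes "t > 0"
  shows "2 ^ DIM('a) * heat (4 * t) x = (4 * pi * t) powr (- real DIM('a) / 2) * exp (- (norm x)\<^sup>2 / (16 * t))"
proof -
  have "(4 * pi * (4 * t)) powr (- real DIM('a) / 2) = 4 powr (- real DIM('a) / 2) * (4 * pi * t) powr (- real DIM('a) / 2)"
    using assms by (subst powr_mult[symmetric]) (auto simp: mult_ac)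
  also have "4 powr (- real DIM('a) / 2) = (2 powr 2) powr (- real DIM('a) / 2)"
    by simp
  also have "\<dots> = 1 / 2 ^ DIM('a)"
    unfolding powr_powr by (simp add: powr_minus_divide powr_realpow)
  finally show ?thesis by (simp add: heat_def)
qed

lemma heat_le_heat_4:
  fixes x :: "'a::euclidean_space"
  assumes "t > 0"
  shows "heat t x \<le> 2 ^ DIM('a) * heat (4 * t) x"
  unfolding heat_4[OF assms] unfolding heat_def
  using assms by (intro mult_left_mono) (auto simp: divide_simps)

text \<open>Mean value bound for the exponential; the sum of both values replaces the larger one,
  which makes the bound symmetric.\<close>

lemma abs_exp_diff_le: "\<bar>exp (- a) - exp (- b)\<bar> \<le> \<bar>a - b\<bar> * (exp (- a) + exp (- b))" for a b :: real
proof -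
  have *: "\<bar>exp (- a) - exp (- b)\<bar> \<le> \<bar>a - b\<bar> * exp (- a)" if "a \<le> b" for a b :: real
  proof -
    have "1 + (a - b) \<le> exp (a - b)" by (rule exp_ge_add_one_self)
    then have "exp (- a) * (1 - exp (a - b)) \<le> exp (- a) * (b - a)"
      by (intro mult_left_mono) (linarith, simp)
    then show ?thesis
      using that by (simp add: right_diff_distrib exp_add[symmetric] mult.commute)
  qed
  show ?thesis
  proof (cases "a \<le> b")
    case True
    have "\<bar>a - b\<bar> * exp (- a) \<le> \<bar>a - b\<bar> * (exp (- a) + exp (- b))" by (intro mult_left_mono) auto
    then show ?thesis using *[OF True] by linarith
  next
    case False
    have "\<bar>a - b\<bar> * exp (- b) \<le> \<bar>a - b\<bar> * (exp (- a) + exp (- b))" by (intro mult_left_mono) auto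
    then show ?thesis using *[of b a] False unfolding abs_minus_commute[of "exp (- b)"] abs_minus_commute[of b] by linarith
  qed
qed

text \<open>In the scaled variables \<open>v\<close> and \<open>e\<close> the two exponents differ
  by at most \<open>e * (2 * v + 1) / 4\<close>, and both exponentials are of size
  \<open>exp (- v^2 / 8)\<close>. Half of that decay absorbs the linear factor in \<open>v\<close>;
  the other half is the profile of the kernel at time \<open>4 * t\<close>.\<close>

lemma heat_diff_le:
  fixes x h :: "'a::euclidean_space"
  assumes t: "t > 0" and h: "norm h \<le> sqrt t"
  shows "\<bar>heat t (x + h) - heat t x\<bar> \<le> 2 ^ (DIM('a) + 2) * (norm h / sqrt t) * heat (4 * t) x"
proof -
  define v e where "v = norm x / sqrt t" and "e = norm h / sqrt t"
  have st: "sqrt t > 0" "sqrt t * sqrt t = t" using t by auto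
  have v: "v \<ge> 0" "e \<ge> 0" "e \<le> 1" using h st by (auto simp: v_def e_def)
  have nx: "norm x = v * sqrt t" and nh: "norm h = e * sqrt t" using st by (auto simp: v_def e_def)
  have nv: "(norm x)\<^sup>2 = v\<^sup>2 * t" "(norm h)\<^sup>2 = e\<^sup>2 * t" using t by (simp_all add: nx nh power_mult_distrib)
  define a b where "a = (norm (x + h))\<^sup>2 / (4 * t)" and "b = (norm x)\<^sup>2 / (4 * t)"
  have "\<bar>norm (x + h) - norm x\<bar> \<le> norm h" by norm
  moreover have "norm (x + h) + norm x \<le> 2 * norm x + norm h" by norm
  ultimately have "\<bar>norm (x + h) - norm x\<bar> * (norm (x + h) + norm x) \<le> norm h * (2 * norm x + norm h)"
    by (intro mult_mono) auto
  moreover have "\<bar>(norm (x + h))\<^sup>2 - (norm x)\<^sup>2\<bar> = \<bar>norm (x + h) - norm x\<bar> * (norm (x + h) + norm x)"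
    by (simp add: power2_eq_square square_diff_square_factored abs_mult)
  moreover have "norm h * (2 * norm x + norm h) = e * (2 * v + e) * t"
    unfolding nx nh using st(2) by (simp add: algebra_simps)
  ultimately have "\<bar>(norm (x + h))\<^sup>2 - (norm x)\<^sup>2\<bar> \<le> e * (2 * v + e) * t" by simp
  then have ab: "\<bar>a - b\<bar> \<le> e * (2 * v + e) / 4"
    unfolding a_def b_def using t by (simp add: diff_divide_distrib[symmetric] abs_mult divide_simps)
  also have "\<dots> \<le> e * (2 * v + 1) / 4" using v by (intro divide_right_mono mult_left_mono) auto
  finally have ab: "\<bar>a - b\<bar> \<le> e * (2 * v + 1) / 4" .
  \<comment> \<open>After the shift by \<open>h\<close>, half of the quadratic decay in
    \<open>x\<close> survives; \<open>norm h \<le> sqrt t\<close> keeps the loss bounded.\<close>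
  have par: "(norm x)\<^sup>2 \<le> 2 * (norm (x + h))\<^sup>2 + 2 * (norm h)\<^sup>2"
  proof -
    have "norm x \<le> norm (x + h) + norm h" by norm
    then have "(norm x)\<^sup>2 \<le> (norm (x + h) + norm h)\<^sup>2" by (intro power_mono) auto
    also have "\<dots> \<le> 2 * (norm (x + h))\<^sup>2 + 2 * (norm h)\<^sup>2"
      using zero_le_power2[of "norm (x + h) - norm h"] by (simp add: power2_eq_square algebra_simps)
    finally show ?thesis .
  qed
  have "v\<^sup>2 * t \<le> 2 * (norm (x + h))\<^sup>2 + 2 * (1 * t)"
  proof -
    have "e\<^sup>2 * t \<le> 1 * t" using v t by (intro mult_right_mono power_le_one) auto
    then show ?thesis using par unfolding nv by linarith
  qed
  then have "v\<^sup>2 / 8 - 1/4 \<le> a" unfolding a_def using t by (simp add: field_simps)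
  then have "exp (- a) \<le> exp (1/4 - v\<^sup>2 / 8)" by simp
  also have "\<dots> = exp (1/4) * exp (- v\<^sup>2 / 8)" by (simp add: exp_add[symmetric])
  also have "\<dots> \<le> 2 * exp (- v\<^sup>2 / 8)"
    using exp_bound_half[of "1/4::real"] by (intro mult_right_mono) auto
  finally have ea: "exp (- a) \<le> 2 * exp (- v\<^sup>2 / 8)" .
  have "b = v\<^sup>2 / 4" unfolding b_def nv using t by simp
  then have "v\<^sup>2 / 8 \<le> b" using zero_le_power2[of v] by linarith
  then have eb: "exp (- b) \<le> exp (- v\<^sup>2 / 8)" by simp
  have "\<bar>exp (- a) - exp (- b)\<bar> \<le> \<bar>a - b\<bar> * (exp (- a) + exp (- b))" by (rule abs_exp_diff_le)
  also have "\<dots> \<le> (e * (2 * v + 1) / 4) * (3 * exp (- v\<^sup>2 / 8))"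
    using v by (intro mult_mono ab) (use ea eb in linarith, auto)
  also have "\<dots> = e * exp (- v\<^sup>2 / 16) * ((3 * (2 * v + 1) / 4) * exp (- v\<^sup>2 / 16))"
    by (simp add: exp_add[symmetric] mult_ac)
  also have "\<dots> \<le> e * exp (- v\<^sup>2 / 16) * 4"
  proof -
    \<comment> \<open>The quadratic \<open>4 * (1 + v^2 / 16) - 3 * (2 * v + 1) / 4\<close> equals
      \<open>((v - 3)^2 + 4) / 4\<close>.\<close>
    have "0 \<le> (v - 3)\<^sup>2" by simp
    then have "3 * (2 * v + 1) / 4 \<le> 4 * (1 + v\<^sup>2 / 16)" by (simp add: power2_eq_square algebra_simps)
    also have "\<dots> \<le> 4 * exp (v\<^sup>2 / 16)" by (intro mult_left_mono exp_ge_add_one_self) auto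
    finally have "3 * (2 * v + 1) / 4 * exp (- v\<^sup>2 / 16) \<le> 4 * exp (v\<^sup>2 / 16) * exp (- v\<^sup>2 / 16)"
      by (intro mult_right_mono) auto
    also have "\<dots> = 4" by (simp add: exp_add[symmetric])
    finally show ?thesis using v by (intro mult_left_mono) auto
  qed
  finally have main: "\<bar>exp (- a) - exp (- b)\<bar> \<le> 4 * e * exp (- v\<^sup>2 / 16)" by (simp add: mult_ac)
  have "\<bar>heat t (x + h) - heat t x\<bar> = (4 * pi * t) powr (- real DIM('a) / 2) * \<bar>exp (- a) - exp (- b)\<bar>"
    by (simp add: heat_def a_def b_def right_diff_distrib[symmetric] abs_mult)
  also have "\<dots> \<le> (4 * pi * t) powr (- real DIM('a) / 2) * (4 * e * exp (- v\<^sup>2 / 16))"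
    using main by (intro mult_left_mono) auto
  also have "\<dots> = 4 * e * (2 ^ DIM('a) * heat (4 * t) x)"
    unfolding heat_4[OF t] nv using t by simp
  finally show ?thesis by (simp add: e_def mult_ac)
qed

section \<open>Gaussian means of bmo functions\<close>

lemma borel_unit_cube [measurable]: "unit_cube k \<in> sets borel"
proof -
  have "unit_cube k = (\<Inter>i\<in>Basis. {x. k \<bullet> i \<le> x \<bullet> i \<and> x \<bullet> i < k \<bullet> i + 1})"
    by (auto simp: unit_cube_def)
  also have "\<dots> \<in> sets borel"
    by (intro sets.countable_INT'') (auto simp: countable_finite)
  finally show ?thesis .
qed

lemma emeasure_unit_cube: "emeasure lborel (unit_cube k) = 1"
proof (rule antisym)
  have 1: "emeasure lborel (box k (k + One)) = 1" "emeasure lborel (cbox k (k + One)) = 1"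
    by (auto simp: inner_add_left)
  have "unit_cube k \<subseteq> cbox k (k + One)"
    by (auto simp: unit_cube_def mem_box inner_add_left) (meson less_imp_le)
  moreover have "box k (k + One) \<subseteq> unit_cube k"
    by (auto simp: unit_cube_def mem_box inner_add_left less_imp_le)
  ultimately show "emeasure lborel (unit_cube k) \<le> 1" "1 \<le> emeasure lborel (unit_cube k)"
    using emeasure_mono[of "unit_cube k" "cbox k (k + One)" lborel]
      emeasure_mono[of "box k (k + One)" "unit_cube k" lborel] by (simp_all add: 1)
qed

text \<open>Existence and uniqueness of the cell containing \<open>x\<close> in one equivalence: the
  cubes are half open, so they tile the space without overlaps.\<close>

lemma unit_cube_ex1:
  fixes x :: "'a::euclidean_space"
  shows "k \<in> int_lattice \<and> x \<in> unit_cube k \<longleftrightarrow> k = (\<Sum>i\<in>Basis. of_int \<lfloor>x \<bullet> i\<rfloor> *\<^sub>R i)"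
proof
  assume *: "k \<in> int_lattice \<and> x \<in> unit_cube k"
  show "k = (\<Sum>i\<in>Basis. of_int \<lfloor>x \<bullet> i\<rfloor> *\<^sub>R i)"
  proof (rule euclidean_eqI)
    fix i :: 'a assume i: "i \<in> Basis"
    obtain m where m: "k \<bullet> i = of_int m" using * i by (auto simp: int_lattice_def elim: Ints_cases)
    then have "\<lfloor>x \<bullet> i\<rfloor> = m" using * i by (intro floor_unique) (auto simp: unit_cube_def)
    then show "k \<bullet> i = (\<Sum>i\<in>Basis. of_int \<lfloor>x \<bullet> i\<rfloor> *\<^sub>R i) \<bullet> i" using m i by simp
  qed
qed (auto simp: int_lattice_def unit_cube_def)

lemma countable_int_lattice: "countable (int_lattice :: 'a::euclidean_space set)"
proof -
  have "int_lattice \<subseteq> (\<lambda>f. \<Sum>i\<in>(Basis::'a set). f i *\<^sub>R i) ` (Basis \<rightarrow>\<^sub>E (\<int> :: real set))"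
  proof
    fix k :: 'a assume k: "k \<in> int_lattice"
    have "k = (\<Sum>i\<in>Basis. restrict (\<lambda>i. k \<bullet> i) Basis i *\<^sub>R i)"
      by (simp add: euclidean_representation)
    moreover have "restrict (\<lambda>i. k \<bullet> i) Basis \<in> Basis \<rightarrow>\<^sub>E \<int>" using k by (auto simp: int_lattice_def)
    ultimately show "k \<in> (\<lambda>f. \<Sum>i\<in>Basis. f i *\<^sub>R i) ` (Basis \<rightarrow>\<^sub>E (\<int> :: real set))" by (rule image_eqI)
  qed
  moreover have "countable (Basis \<rightarrow>\<^sub>E (\<int> :: real set) :: ('a \<Rightarrow> real) set)"
    by (intro countable_PiE) (auto simp: Ints_def)
  ultimately show ?thesis by (meson countable_image countable_subset)
qed

lemma nn_integral_unit_cubes: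
  fixes f :: "'a::euclidean_space \<Rightarrow> ennreal"
  assumes [measurable]: "f \<in> borel_measurable borel"
  shows "(\<integral>\<^sup>+y. f y \<partial>lborel) = (\<integral>\<^sup>+k. (\<integral>\<^sup>+y. f y * indicator (unit_cube k) y \<partial>lborel) \<partial>count_space int_lattice)"
proof -
  have "(\<integral>\<^sup>+y. f y \<partial>lborel) = (\<integral>\<^sup>+y. (\<integral>\<^sup>+k. f y * indicator (unit_cube k) y \<partial>count_space int_lattice) \<partial>lborel)"
  proof (intro nn_integral_cong)
    fix y :: 'a
    define k0 where "k0 = (\<Sum>i\<in>Basis. of_int \<lfloor>y \<bullet> i\<rfloor> *\<^sub>R i)"
    have k0: "k0 \<in> int_lattice \<and> y \<in> unit_cube k0" unfolding k0_def unit_cube_ex1 by simp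
    have "(\<integral>\<^sup>+k. f y * indicator (unit_cube k) y \<partial>count_space int_lattice) = (\<Sum>k\<in>{k0}. f y * indicator (unit_cube k) y)"
    proof (rule nn_integral_count_space')
      show "f y * indicator (unit_cube k) y = 0" if "k \<in> int_lattice" "k \<notin> {k0}" for k
        using that unit_cube_ex1[of k y] by (auto simp: k0_def indicator_def)
    qed (use k0 in auto)
    then show "f y = (\<integral>\<^sup>+k. f y * indicator (unit_cube k) y \<partial>count_space int_lattice)" using k0 by simp
  qed
  also have "\<dots> = (\<integral>\<^sup>+k. (\<integral>\<^sup>+y. f y * indicator (unit_cube k) y \<partial>lborel) \<partial>count_space int_lattice)"
    by (intro nn_integral_count_space_nn_integral countable_int_lattice) auto
  finally show ?thesis .
qed

text \<open>A Harnack-type comparison: two points of a unit cube are at distance at most the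
  dimension, and \<open>(p + q)^2 \<le> 2 * p^2 + 2 * q^2\<close> halves the decay, that is, doubles
  the time. For \<open>t \<ge> 1\<close> the displacement costs only a constant factor.\<close>

lemma heat_unit_cube_le:
  fixes x y y' k :: "'a::euclidean_space"
  assumes t: "t \<ge> 1" and y: "y \<in> unit_cube k" "y' \<in> unit_cube k"
  shows "heat t (x - y) \<le> (2 powr (real DIM('a) / 2) * exp ((real DIM('a))\<^sup>2 / 4)) * heat (2 * t) (x - y')"
proof -
  let ?n = "real DIM('a)"
  have "norm (y - y') \<le> (\<Sum>i\<in>Basis. \<bar>(y - y') \<bullet> i\<bar>)" by (rule norm_le_l1)
  also have "\<dots> \<le> (\<Sum>i\<in>(Basis :: 'a set). 1)"
    using y by (intro sum_mono) (force simp: unit_cube_def inner_diff_left)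
  finally have n: "norm (y - y') \<le> ?n" by simp
  have "norm (x - y') \<le> norm (x - y) + norm (y - y')" by norm
  then have "(norm (x - y'))\<^sup>2 \<le> (norm (x - y) + norm (y - y'))\<^sup>2" by (intro power_mono) auto
  also have "\<dots> \<le> 2 * (norm (x - y))\<^sup>2 + 2 * (norm (y - y'))\<^sup>2"
    using zero_le_power2[of "norm (x - y) - norm (y - y')"] by (simp add: power2_eq_square algebra_simps)
  also have "(norm (y - y'))\<^sup>2 \<le> ?n\<^sup>2" using n by (intro power_mono) auto
  finally have "(norm (x - y'))\<^sup>2 \<le> 2 * (norm (x - y))\<^sup>2 + 2 * ?n\<^sup>2" by simp
  then have "(norm (x - y'))\<^sup>2 / (8 * t) \<le> (2 * (norm (x - y))\<^sup>2 + 2 * ?n\<^sup>2) / (8 * t)"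
    using t by (intro divide_right_mono) auto
  also have "\<dots> = (norm (x - y))\<^sup>2 / (4 * t) + ?n\<^sup>2 / (4 * t)" using t by (simp add: field_simps)
  also have "?n\<^sup>2 / (4 * t) \<le> ?n\<^sup>2 / 4" using t by (intro divide_left_mono) auto
  finally have "exp (- (norm (x - y))\<^sup>2 / (4 * t)) \<le> exp (?n\<^sup>2 / 4 + - (norm (x - y'))\<^sup>2 / (4 * (2 * t)))"
    by simp
  then have e: "exp (- (norm (x - y))\<^sup>2 / (4 * t)) \<le> exp (?n\<^sup>2 / 4) * exp (- (norm (x - y'))\<^sup>2 / (4 * (2 * t)))"
    unfolding exp_add .
  have "(4 * pi * (2 * t)) powr (- ?n / 2) = 2 powr (- ?n / 2) * (4 * pi * t) powr (- ?n / 2)"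
    using t by (subst powr_mult[symmetric]) (auto simp: mult_ac)
  then have c: "2 powr (?n / 2) * (4 * pi * (2 * t)) powr (- ?n / 2) = (4 * pi * t) powr (- ?n / 2)"
    by (simp add: powr_minus field_simps)
  have "(4 * pi * t) powr (- ?n / 2) * exp (- (norm (x - y))\<^sup>2 / (4 * t)) \<le>
     (4 * pi * t) powr (- ?n / 2) * (exp (?n\<^sup>2 / 4) * exp (- (norm (x - y'))\<^sup>2 / (4 * (2 * t))))"
    by (intro mult_left_mono e) auto
  also have "\<dots> = (2 powr (?n / 2) * exp (?n\<^sup>2 / 4)) * heat (2 * t) (x - y')"
    unfolding c[symmetric] heat_def by (simp add: mult_ac)
  finally show ?thesis unfolding heat_def[of t] .
qed

text \<open>On each cube the kernel is at most \<open>C\<close> times the integral over that cube of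
  the kernel at time \<open>2 * t\<close>. The square mass of a cube is at most \<open>K^2\<close>,
  and the integrals over all cubes add up to 1. Extended nonnegative integrals are used so that
  integrability is a consequence.\<close>

lemma bmo_heat_sq_bound:
  fixes g :: "'a::euclidean_space \<Rightarrow> real"
  assumes g: "g \<in> bmo"
  obtains N where "N \<ge> 0"
    "\<And>x t. t \<ge> 1 \<Longrightarrow> integrable lborel (\<lambda>y. heat t (x - y) * (g y)\<^sup>2)"
    "\<And>x t. t \<ge> 1 \<Longrightarrow> (LINT y|lborel. heat t (x - y) * (g y)\<^sup>2) \<le> N"
proof -
  have [measurable]: "g \<in> borel_measurable borel" using g by (simp add: bmo_def)
  have "bdd_above {sqrt (LINT x:unit_cube k|lborel. (g x)\<^sup>2) | k. k \<in> int_lattice}"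
    using g by (simp add: bmo_def)
  then obtain K where "\<forall>v\<in>{sqrt (LINT x:unit_cube k|lborel. (g x)\<^sup>2) | k. k \<in> int_lattice}. v \<le> K"
    unfolding bdd_above_def by auto
  then have K: "\<And>k. k \<in> int_lattice \<Longrightarrow> sqrt (LINT x:unit_cube k|lborel. (g x)\<^sup>2) \<le> K"
    by auto
  have cube: "(\<integral>\<^sup>+y. ennreal ((g y)\<^sup>2) * indicator (unit_cube k) y \<partial>lborel) \<le> ennreal (K\<^sup>2)" if k: "k \<in> int_lattice" for k
  proof -
    have i: "set_integrable lborel (unit_cube k) (\<lambda>x. (g x)\<^sup>2)" using g k by (auto simp: bmo_def)
    have nn: "0 \<le> (LINT x:unit_cube k|lborel. (g x)\<^sup>2)"
      unfolding set_lebesgue_integral_def by (intro integral_nonneg_AE) auto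
    have "(\<integral>\<^sup>+y. ennreal ((g y)\<^sup>2) * indicator (unit_cube k) y \<partial>lborel) = (\<integral>\<^sup>+y. ennreal (indicator (unit_cube k) y *\<^sub>R (g y)\<^sup>2) \<partial>lborel)"
      by (intro nn_integral_cong) (auto simp: indicator_def)
    also have "\<dots> = ennreal (LINT x:unit_cube k|lborel. (g x)\<^sup>2)"
      using i unfolding set_integrable_def set_lebesgue_integral_def by (intro nn_integral_eq_integral) auto
    also have "\<dots> \<le> ennreal (K\<^sup>2)"
    proof (rule ennreal_leI)
      have "(sqrt (LINT x:unit_cube k|lborel. (g x)\<^sup>2))\<^sup>2 \<le> K\<^sup>2"
        using K[OF k] nn by (intro power_mono) auto
      then show "(LINT x:unit_cube k|lborel. (g x)\<^sup>2) \<le> K\<^sup>2" using nn by simp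
    qed
    finally show ?thesis .
  qed
  define C where "C = 2 powr (real DIM('a) / 2) * exp ((real DIM('a))\<^sup>2 / 4)"
  have C: "C \<ge> 0" by (simp add: C_def)
  have main: "(\<integral>\<^sup>+y. ennreal (heat t (x - y) * (g y)\<^sup>2) \<partial>lborel) \<le> ennreal (C * K\<^sup>2)" if t: "t \<ge> 1" for x t
  proof -
    let ?I = "\<lambda>k. \<integral>\<^sup>+y. ennreal (heat (2 * t) (x - y)) * indicator (unit_cube k) y \<partial>lborel"
    have one: "(\<integral>\<^sup>+k. ?I k \<partial>count_space int_lattice) = 1"
    proof -
      have "(\<integral>\<^sup>+k. ?I k \<partial>count_space int_lattice) = (\<integral>\<^sup>+y. ennreal (heat (2 * t) (x - y)) \<partial>lborel)"
        by (rule nn_integral_unit_cubes[symmetric]) measurable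
      also have "\<dots> = ennreal (LINT y|lborel. heat (2 * t) (x - y))"
        using heat_has_integral[of "2 * t", where 'a='a] t
        by (intro nn_integral_eq_integral) (auto simp: lborel_integrable_minus has_bochner_integral_iff)
      also have "\<dots> = 1"
        using heat_has_integral[of "2 * t", where 'a='a] t
        by (auto simp: lborel_integral_minus has_bochner_integral_iff)
      finally show ?thesis .
    qed
    \<comment> \<open>The cube has measure 1, so a pointwise bound valid for every \<open>y'\<close>
      in it may be integrated over \<open>y'\<close> without loss.\<close>
    have pt: "ennreal (heat t (x - y)) \<le> ennreal C * ?I k" if y: "y \<in> unit_cube k" for y k
    proof -
      have "ennreal (heat t (x - y)) = (\<integral>\<^sup>+y'. ennreal (heat t (x - y)) * indicator (unit_cube k) y' \<partial>lborel)"
        by (subst nn_integral_cmult_indicator) (auto simp: emeasure_unit_cube)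
      also have "\<dots> \<le> (\<integral>\<^sup>+y'. ennreal C * (ennreal (heat (2 * t) (x - y')) * indicator (unit_cube k) y') \<partial>lborel)"
      proof (intro nn_integral_mono)
        fix y'
        show "ennreal (heat t (x - y)) * indicator (unit_cube k) y' \<le> ennreal C * (ennreal (heat (2 * t) (x - y')) * indicator (unit_cube k) y')"
          using heat_unit_cube_le[OF t y, of y' x] C
          by (auto simp: indicator_def C_def[symmetric] ennreal_mult[symmetric] intro: ennreal_leI)
      qed
      also have "\<dots> = ennreal C * ?I k" by (intro nn_integral_cmult) measurable
      finally show ?thesis .
    qed
    have "(\<integral>\<^sup>+y. ennreal (heat t (x - y) * (g y)\<^sup>2) \<partial>lborel) =
        (\<integral>\<^sup>+k. (\<integral>\<^sup>+y. ennreal (heat t (x - y) * (g y)\<^sup>2) * indicator (unit_cube k) y \<partial>lborel) \<partial>count_space int_lattice)"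
      by (rule nn_integral_unit_cubes) measurable
    also have "\<dots> \<le> (\<integral>\<^sup>+k. ennreal (C * K\<^sup>2) * ?I k \<partial>count_space int_lattice)"
    proof (intro nn_integral_mono)
      fix k :: 'a assume "k \<in> space (count_space int_lattice)"
      then have k: "k \<in> int_lattice" by simp
      have "(\<integral>\<^sup>+y. ennreal (heat t (x - y) * (g y)\<^sup>2) * indicator (unit_cube k) y \<partial>lborel) \<le>
         (\<integral>\<^sup>+y. (ennreal C * ?I k) * (ennreal ((g y)\<^sup>2) * indicator (unit_cube k) y) \<partial>lborel)"
      proof (intro nn_integral_mono)
        fix y
        show "ennreal (heat t (x - y) * (g y)\<^sup>2) * indicator (unit_cube k) y \<le> (ennreal C * ?I k) * (ennreal ((g y)\<^sup>2) * indicator (unit_cube k) y)"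
          using pt[of y k] by (auto simp: ennreal_mult indicator_def intro!: mult_right_mono)
      qed
      also have "\<dots> = (ennreal C * ?I k) * (\<integral>\<^sup>+y. (ennreal ((g y)\<^sup>2) * indicator (unit_cube k) y) \<partial>lborel)"
        by (intro nn_integral_cmult) measurable
      also have "\<dots> \<le> (ennreal C * ?I k) * ennreal (K\<^sup>2)"
        by (intro mult_left_mono cube k) auto
      finally show "(\<integral>\<^sup>+y. ennreal (heat t (x - y) * (g y)\<^sup>2) * indicator (unit_cube k) y \<partial>lborel) \<le> ennreal (C * K\<^sup>2) * ?I k"
        using C by (simp add: ennreal_mult mult_ac)
    qed
    also have "\<dots> = ennreal (C * K\<^sup>2)"
      by (subst nn_integral_cmult) (simp_all add: one)
    finally show ?thesis .
  qed
  have int: "integrable lborel (\<lambda>y. heat t (x - y) * (g y)\<^sup>2)" if "t \<ge> 1" for x t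
    using main[OF that, of x] by (intro integrableI_bounded) (auto simp: abs_mult le_less_trans)
  show thesis
  proof (rule that[of "C * K\<^sup>2"])
    show "(LINT y|lborel. heat t (x - y) * (g y)\<^sup>2) \<le> C * K\<^sup>2" if "t \<ge> 1" for x t
    proof -
      have "ennreal (LINT y|lborel. heat t (x - y) * (g y)\<^sup>2) \<le> ennreal (C * K\<^sup>2)"
        using main[OF that, of x] int[OF that, of x] by (subst nn_integral_eq_integral[symmetric]) auto
      then show ?thesis using C by (simp add: ennreal_le_iff)
    qed
  qed (use C int in auto)
qed

section \<open>Oscillation over balls and its Gaussian version\<close>

lemma measure_ball_scale:
  fixes x :: "'a::euclidean_space"
  assumes "r \<ge> 0"
  shows "measure lborel (ball x r) = r ^ DIM('a) * measure lborel (ball (0::'a) 1)"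
  using content_ball_conv_unit_ball[OF assms, of x] by simp

lemma measure_ball_pos: "r > 0 \<Longrightarrow> measure lborel (ball (x::'a::euclidean_space) r) > 0"
  using content_ball_pos[of r x] by simp

lemma integrable_on_ball_const: "set_integrable lborel (ball (x::'a::euclidean_space) r) (\<lambda>y. c::real)"
  using emeasure_lborel_ball_finite[of x r] unfolding set_integrable_def by simp

lemma bmo_ball_osc:
  fixes g :: "'a::euclidean_space \<Rightarrow> real"
  assumes g: "g \<in> bmo"
  obtains M where "M \<ge> 0"
    "\<And>x r. r > 0 \<Longrightarrow> (LINT y:ball x r|lborel. \<bar>g y - ball_avg g (ball x r)\<bar>) \<le> M * measure lborel (ball x r)"
proof -
  have "bdd_above {mean_osc g (ball x r) | x r. r > 0}"
    using g by (simp add: bmo_def)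
  then obtain M where "\<forall>v\<in>{mean_osc g (ball x r) | x r. r > 0}. v \<le> M"
    unfolding bdd_above_def by auto
  then have M: "mean_osc g (ball x r) \<le> M" if "r > 0" for x r using that by auto
  show thesis
  proof (rule that[of "max M 0"])
    fix x :: 'a and r :: real assume r: "r > 0"
    have "mean_osc g (ball x r) \<le> max M 0" using M[OF r, of x] by simp
    then show "(LINT y:ball x r|lborel. \<bar>g y - ball_avg g (ball x r)\<bar>) \<le> max M 0 * measure lborel (ball x r)"
      using measure_ball_pos[OF r, of x] unfolding mean_osc_def by (simp add: divide_le_eq)
  qed simp
qed

text \<open>The two means differ by at most the average over the small ball of the oscillation about
  the large mean, and extending that integral to the large ball costs the volume ratio. A chain of
  doublings would give a logarithm instead, but a power of \<open>R / r\<close> is harmless against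
  Gaussian decay.\<close>

lemma ball_osc_enlarge:
  fixes g :: "'a::euclidean_space \<Rightarrow> real"
  assumes int: "\<And>x r. set_integrable lborel (ball x r) g"
    and M: "\<And>x r. r > 0 \<Longrightarrow> (LINT y:ball x r|lborel. \<bar>g y - ball_avg g (ball x r)\<bar>) \<le> M * measure lborel (ball x r)"
    and r: "0 < r" "r \<le> R"
  shows "(LINT y:ball x R|lborel. \<bar>g y - ball_avg g (ball x r)\<bar>) \<le> (1 + (R / r) ^ DIM('a)) * M * measure lborel (ball x R)"
proof -
  let ?m = "\<lambda>r. measure lborel (ball x r)"
  define c d where "c = ball_avg g (ball x r)" and "d = ball_avg g (ball x R)"
  have R: "R > 0" using r by simp
  have m: "?m r > 0" "?m R > 0" using measure_ball_pos r R by auto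
  have ratio: "?m R = (R / r) ^ DIM('a) * ?m r"
    using r R measure_ball_scale[of r x] measure_ball_scale[of R x] by (simp add: power_divide)
  have si: "set_integrable lborel (ball x \<rho>) (\<lambda>y. g y - a)" for \<rho> a
    by (intro set_integral_diff int integrable_on_ball_const)
  have sia: "set_integrable lborel (ball x \<rho>) (\<lambda>y. \<bar>g y - a\<bar>)" for \<rho> a
    using si by (rule set_integrable_abs)
  have const: "(LINT y:ball x \<rho>|lborel. a) = ?m \<rho> * a" for \<rho> a
    unfolding set_lebesgue_integral_def by simp
  have "(LINT y:ball x r|lborel. g y - d) = ?m r * (c - d)"
    using set_integral_diff(2)[OF int integrable_on_ball_const, of x r d] m
    by (simp add: const c_def ball_avg_def right_diff_distrib)
  then have "?m r * \<bar>c - d\<bar> = \<bar>LINT y:ball x r|lborel. g y - d\<bar>"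
    using m by (simp add: abs_mult)
  also have "\<dots> \<le> (LINT y:ball x r|lborel. \<bar>g y - d\<bar>)"
    using set_integral_norm_bound[OF si, of r d] by simp
  also have "\<dots> \<le> (LINT y:ball x R|lborel. \<bar>g y - d\<bar>)"
    using sia[of r d] sia[of R d] subset_ball[OF r(2), of x] unfolding set_lebesgue_integral_def set_integrable_def
    by (intro integral_mono) (auto simp: indicator_def)
  also have "\<dots> \<le> M * ?m R" unfolding d_def by (rule M[OF R])
  also have "\<dots> = ?m r * (M * (R / r) ^ DIM('a))" by (simp add: ratio)
  finally have cd: "\<bar>c - d\<bar> \<le> M * (R / r) ^ DIM('a)" using m by simp
  have "(LINT y:ball x R|lborel. \<bar>g y - c\<bar>) \<le> (LINT y:ball x R|lborel. \<bar>g y - d\<bar> + \<bar>c - d\<bar>)"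
    by (intro set_integral_mono set_integral_add sia integrable_on_ball_const) auto
  also have "\<dots> = (LINT y:ball x R|lborel. \<bar>g y - d\<bar>) + ?m R * \<bar>c - d\<bar>"
    using set_integral_add(2)[OF sia integrable_on_ball_const, of R d "\<bar>c - d\<bar>"] by (simp add: const)
  also have "\<dots> \<le> M * ?m R + ?m R * (M * (R / r) ^ DIM('a))"
    using M[OF R, of x] cd m unfolding d_def by (intro add_mono mult_left_mono) auto
  finally show ?thesis by (simp add: c_def algebra_simps)
qed

lemma summable_gauss_poly: "summable (\<lambda>k. exp (- (real k)\<^sup>2 / 16) * (1 + (real k + 1) ^ p) * (real k + 1) ^ p)"
proof (rule summable_comparison_test')
  show "summable (\<lambda>k. 2 * exp (4 * (2 * real p + 1)\<^sup>2) * exp (- 1) ^ k)"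
    by (intro summable_mult summable_geometric) simp
  fix k :: nat
  have "(1 + (real k + 1) ^ p) * (real k + 1) ^ p \<le> (2 * (real k + 1) ^ p) * (real k + 1) ^ p"
    by (intro mult_right_mono) auto
  also have "\<dots> = 2 * (1 + real k) ^ (2 * p)" by (simp add: power_even_eq power2_eq_square add.commute)
  also have "(1 + real k) ^ (2 * p) \<le> exp (real k) ^ (2 * p)"
    by (intro power_mono exp_ge_add_one_self) auto
  also have "\<dots> = exp (2 * real p * real k)" by (simp add: exp_of_nat_mult[symmetric])
  finally have "exp (- (real k)\<^sup>2 / 16) * ((1 + (real k + 1) ^ p) * (real k + 1) ^ p) \<le> exp (- (real k)\<^sup>2 / 16) * (2 * exp (2 * real p * real k))"
    by (intro mult_left_mono) auto
  also have "\<dots> = 2 * exp (2 * real p * real k - (real k)\<^sup>2 / 16)"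
    by (simp add: exp_add[symmetric])
  \<comment> \<open>Complete the square so that the exponent drops below a constant minus
    \<open>k\<close>; this leaves a geometric series.\<close>
  also have "2 * real p * real k - (real k)\<^sup>2 / 16 \<le> 4 * (2 * real p + 1)\<^sup>2 - real k * 1"
  proof -
    have "0 \<le> (real k / 4 - 2 * (2 * real p + 1))\<^sup>2" by simp
    then show ?thesis by (simp add: power2_eq_square algebra_simps)
  qed
  also have "exp (4 * (2 * real p + 1)\<^sup>2 - real k * 1) = exp (4 * (2 * real p + 1)\<^sup>2) * exp (- 1) ^ k"
    by (simp add: exp_diff exp_minus exp_of_nat_mult[symmetric] power_inverse field_simps)
  finally show "norm (exp (- (real k)\<^sup>2 / 16) * (1 + (real k + 1) ^ p) * (real k + 1) ^ p) \<le> 2 * exp (4 * (2 * real p + 1)\<^sup>2) * exp (- 1) ^ k"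
    by (simp add: abs_mult mult_ac)
qed

text \<open>The Gaussian is dominated by \<open>\<Sum>k. exp (- k\<^sup>2 / 16)\<close> times indicators of balls of radius \<open>(k + 1) * sqrt t\<close>;
  on these the oscillation about the mean over the smallest ball grows only polynomially in \<open>k\<close>.\<close>

lemma bmo_heat_osc_bound:
  fixes g :: "'a::euclidean_space \<Rightarrow> real"
  assumes g: "g \<in> bmo"
  obtains M where "M \<ge> 0"
    "\<And>x t. t > 0 \<Longrightarrow> \<exists>c. integrable lborel (\<lambda>y. heat (4 * t) (x - y) * \<bar>g y - c\<bar>)
       \<and> (LINT y|lborel. heat (4 * t) (x - y) * \<bar>g y - c\<bar>) \<le> M"
proof -
  have [measurable]: "g \<in> borel_measurable borel" using g by (simp add: bmo_def)
  have int: "set_integrable lborel (ball x r) g" for x r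
  proof (rule set_integrable_subset)
    show "set_integrable lborel (cball x r) g" using g by (simp add: bmo_def)
  qed auto
  obtain M where M0: "M \<ge> 0" and M: "\<And>x r. r > 0 \<Longrightarrow> (LINT y:ball x r|lborel. \<bar>g y - ball_avg g (ball x r)\<bar>) \<le> M * measure lborel (ball x r)"
    using bmo_ball_osc[OF g] by blast
  define V where "V = measure lborel (ball (0::'a) 1)"
  define T where "T k = exp (- (real k)\<^sup>2 / 16) * (1 + (real k + 1) ^ DIM('a)) * (real k + 1) ^ DIM('a)" for k
  define M' where "M' = M * V * (\<Sum>k. T k)"
  have V: "V \<ge> 0" by (simp add: V_def)
  have T: "summable T" "\<And>k. T k \<ge> 0" unfolding T_def by (rule summable_gauss_poly) auto
  have M': "M' \<ge> 0" unfolding M'_def using M0 V T by (intro mult_nonneg_nonneg suminf_nonneg) auto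
  have main: "(\<integral>\<^sup>+y. ennreal (heat (4 * t) (x - y) * \<bar>g y - ball_avg g (ball x (sqrt t))\<bar>) \<partial>lborel) \<le> ennreal M'"
    if t: "t > 0" for x t
  proof -
    define r c A where "r = sqrt t" and "c = ball_avg g (ball x r)" and "A = (16 * pi * t) powr (- real DIM('a) / 2)"
    have r: "r > 0" "r\<^sup>2 = t" using t by (auto simp: r_def)
    have A: "A \<ge> 0" by (simp add: A_def)
    \<comment> \<open>The normalising constant compensates the volume of a ball of radius
      \<open>sqrt t\<close>, which makes the final bound independent of \<open>t\<close>.\<close>
    have Ar: "A * r ^ DIM('a) \<le> 1"
    proof -
      have "A \<le> t powr (- real DIM('a) / 2)"
        unfolding A_def using t pi_ge_two by (intro powr_mono2') auto
      also have "\<dots> = (r powr 2) powr (- real DIM('a) / 2)" using r by (simp add: powr_numeral)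
      also have "\<dots> = 1 / r ^ DIM('a)" using r unfolding powr_powr by (simp add: powr_minus_divide powr_realpow)
      finally show ?thesis using r by (simp add: field_simps)
    qed
    let ?B = "\<lambda>k. ball x ((real k + 1) * r)"
    have "(\<integral>\<^sup>+y. ennreal (heat (4 * t) (x - y) * \<bar>g y - c\<bar>) \<partial>lborel) \<le>
       (\<integral>\<^sup>+y. (\<Sum>k. ennreal (A * exp (- (real k)\<^sup>2 / 16)) * (ennreal \<bar>g y - c\<bar> * indicator (?B k) y)) \<partial>lborel)"
    proof (intro nn_integral_mono)
      fix y
      \<comment> \<open>Number of the shell of width \<open>sqrt t\<close> around \<open>x\<close>
        that contains \<open>y\<close>; this one term of the series already dominates the kernel at
        \<open>y\<close>.\<close>
      define k where "k = nat \<lfloor>norm (x - y) / r\<rfloor>"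
      have k: "real k \<le> norm (x - y) / r" "norm (x - y) / r < real k + 1"
        unfolding k_def using r by (auto simp: le_floor_iff)
      have y: "y \<in> ?B k" using k(2) r by (simp add: dist_norm divide_less_eq)
      have "(real k)\<^sup>2 \<le> (norm (x - y) / r)\<^sup>2" using k by (intro power_mono) auto
      then have "(real k)\<^sup>2 / 16 \<le> (norm (x - y))\<^sup>2 / (16 * t)"
        using r t by (simp add: power_divide field_simps)
      then have "heat (4 * t) (x - y) \<le> A * exp (- (real k)\<^sup>2 / 16)"
        unfolding heat_def A_def by (intro mult_mono) (simp_all add: mult_ac)
      then have "heat (4 * t) (x - y) * \<bar>g y - c\<bar> \<le> (A * exp (- (real k)\<^sup>2 / 16)) * \<bar>g y - c\<bar>"
        by (intro mult_right_mono) auto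
      then have "ennreal (heat (4 * t) (x - y) * \<bar>g y - c\<bar>) \<le> ennreal (A * exp (- (real k)\<^sup>2 / 16)) * (ennreal \<bar>g y - c\<bar> * indicator (?B k) y)"
        using y A by (simp add: ennreal_mult[symmetric] ennreal_leI)
      also have "\<dots> = (\<Sum>k\<in>{k}. ennreal (A * exp (- (real k)\<^sup>2 / 16)) * (ennreal \<bar>g y - c\<bar> * indicator (?B k) y))"
        by simp
      also have "\<dots> \<le> (\<Sum>k. ennreal (A * exp (- (real k)\<^sup>2 / 16)) * (ennreal \<bar>g y - c\<bar> * indicator (?B k) y))"
        by (rule sum_le_suminf) auto
      finally show "ennreal (heat (4 * t) (x - y) * \<bar>g y - c\<bar>) \<le> (\<Sum>k. ennreal (A * exp (- (real k)\<^sup>2 / 16)) * (ennreal \<bar>g y - c\<bar> * indicator (?B k) y))" .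
    qed
    also have "\<dots> = (\<Sum>k. ennreal (A * exp (- (real k)\<^sup>2 / 16)) * (\<integral>\<^sup>+y. ennreal \<bar>g y - c\<bar> * indicator (?B k) y \<partial>lborel))"
    proof -
      have [measurable]: "(\<lambda>y. ennreal \<bar>g y - c\<bar> * indicator (?B k) y) \<in> borel_measurable lborel" for k
        by (intro borel_measurable_times_ennreal borel_measurable_indicator) auto
      show ?thesis
        by (subst nn_integral_suminf) (auto intro!: suminf_cong nn_integral_cmult)
    qed
    also have "\<dots> \<le> (\<Sum>k. ennreal (M * V * T k))"
    proof (intro suminf_le allI)
      fix k :: nat
      have sia: "set_integrable lborel (?B k) (\<lambda>y. \<bar>g y - c\<bar>)"
        by (intro set_integrable_abs set_integral_diff int integrable_on_ball_const)
      have "(\<integral>\<^sup>+y. ennreal \<bar>g y - c\<bar> * indicator (?B k) y \<partial>lborel) = (\<integral>\<^sup>+y. ennreal (indicator (?B k) y *\<^sub>R \<bar>g y - c\<bar>) \<partial>lborel)"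
        by (intro nn_integral_cong) (auto simp: indicator_def)
      also have "\<dots> = ennreal (LINT y:?B k|lborel. \<bar>g y - c\<bar>)"
        using sia unfolding set_integrable_def set_lebesgue_integral_def by (intro nn_integral_eq_integral) auto
      also have "\<dots> \<le> ennreal ((1 + (real k + 1) ^ DIM('a)) * M * (((real k + 1) * r) ^ DIM('a) * V))"
      proof (rule ennreal_leI)
        have "r \<le> (real k + 1) * r" using r by (simp add: algebra_simps)
        from ball_osc_enlarge[OF int M r(1) this, of x]
        show "(LINT y:?B k|lborel. \<bar>g y - c\<bar>) \<le> (1 + (real k + 1) ^ DIM('a)) * M * (((real k + 1) * r) ^ DIM('a) * V)"
          using r measure_ball_scale[of "(real k + 1) * r" x] by (simp add: c_def V_def)
      qed
      finally have "ennreal (A * exp (- (real k)\<^sup>2 / 16)) * (\<integral>\<^sup>+y. ennreal \<bar>g y - c\<bar> * indicator (?B k) y \<partial>lborel) \<le>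
         ennreal (A * exp (- (real k)\<^sup>2 / 16)) * ennreal ((1 + (real k + 1) ^ DIM('a)) * M * (((real k + 1) * r) ^ DIM('a) * V))"
        by (intro mult_left_mono) auto
      also have "\<dots> = ennreal ((A * r ^ DIM('a)) * (M * V * T k))"
        using A M0 V r by (simp add: ennreal_mult[symmetric] T_def power_mult_distrib mult_ac)
      also have "\<dots> \<le> ennreal (M * V * T k)"
        using Ar A r M0 V T(2)[of k] by (intro ennreal_leI mult_left_le_one_le) auto
      finally show "ennreal (A * exp (- (real k)\<^sup>2 / 16)) * (\<integral>\<^sup>+y. ennreal \<bar>g y - c\<bar> * indicator (?B k) y \<partial>lborel) \<le> ennreal (M * V * T k)" .
    qed auto
    also have "\<dots> = ennreal M'"
      unfolding M'_def using T M0 V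
      by (subst suminf_ennreal2) (auto intro!: summable_mult simp: suminf_mult)
    finally show ?thesis unfolding c_def r_def .
  qed
  show thesis
  proof (rule that[OF M'])
    fix x :: 'a and t :: real assume t: "t > 0"
    let ?c = "ball_avg g (ball x (sqrt t))"
    have i: "integrable lborel (\<lambda>y. heat (4 * t) (x - y) * \<bar>g y - ?c\<bar>)"
      using main[OF t, of x] by (intro integrableI_bounded) (auto simp: abs_mult le_less_trans)
    have "ennreal (LINT y|lborel. heat (4 * t) (x - y) * \<bar>g y - ?c\<bar>) \<le> ennreal M'"
      using main[OF t, of x] i by (subst nn_integral_eq_integral[symmetric]) auto
    with i M' show "\<exists>c. integrable lborel (\<lambda>y. heat (4 * t) (x - y) * \<bar>g y - c\<bar>)
       \<and> (LINT y|lborel. heat (4 * t) (x - y) * \<bar>g y - c\<bar>) \<le> M'"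
      by (intro exI[of _ ?c]) (simp add: ennreal_le_iff)
  qed
qed

section \<open>Heat extensions\<close>

definition hconv :: "real \<Rightarrow> ('a::euclidean_space \<Rightarrow> real) \<Rightarrow> 'a \<Rightarrow> real" where
  "hconv t w x = (LINT y|lborel. heat t (x - y) * w y)"

lemma heat_minus_has_integral:
  fixes x :: "'a::euclidean_space"
  assumes "t > 0"
  shows "has_bochner_integral lborel (\<lambda>y. heat t (x - y)) 1"
  using heat_has_integral[OF assms, where 'a='a]
  by (simp add: has_bochner_integral_iff lborel_integrable_minus lborel_integral_minus)

lemma heat_minus_integrable:
  fixes x :: "'a::euclidean_space"
  assumes "t > 0"
  shows "integrable lborel (\<lambda>y. heat t (x - y))" and "(LINT y|lborel. heat t (x - y)) = 1"
  using heat_minus_has_integral[OF assms, of x] by (auto simp: has_bochner_integral_iff)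

lemma heat_bounded_integrable:
  fixes w :: "'a::euclidean_space \<Rightarrow> real"
  assumes t: "t > 0" and [measurable]: "w \<in> borel_measurable borel" and B: "\<And>x. \<bar>w x\<bar> \<le> B"
  shows "integrable lborel (\<lambda>y. heat t (x - y) * w y)"
proof (rule Bochner_Integration.integrable_bound)
  show "integrable lborel (\<lambda>y. B * heat t (x - y))" using heat_minus_integrable[OF t] by auto
  have "\<bar>heat t (x - y) * w y\<bar> \<le> B * heat t (x - y)" for y
    using B[of y] by (simp add: abs_mult mult.commute mult_right_mono)
  moreover have "B \<ge> 0" using B[of 0] by simp
  ultimately show "AE y in lborel. norm (heat t (x - y) * w y) \<le> norm (B * heat t (x - y))"
    by (simp add: abs_mult)
qed measurable

lemma hconv_measurable [measurable]:
  assumes [measurable]: "w \<in> borel_measurable borel"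
  shows "hconv t w \<in> borel_measurable borel"
  unfolding hconv_def by measurable

lemma hconv_bounded:
  assumes t: "t > 0" and w: "w \<in> borel_measurable borel" and B: "\<And>x. \<bar>w x\<bar> \<le> B"
  shows "\<bar>hconv t w x\<bar> \<le> B"
proof -
  have "\<bar>hconv t w x\<bar> \<le> (LINT y|lborel. \<bar>heat t (x - y) * w y\<bar>)"
    unfolding hconv_def by (rule integral_abs_bound)
  also have "\<dots> \<le> (LINT y|lborel. heat t (x - y) * B)"
    using heat_minus_integrable[OF t, of x] B
    by (intro integral_mono integrable_abs heat_bounded_integrable[OF t w B]) (auto simp: abs_mult intro!: mult_left_mono)
  also have "\<dots> = B" using heat_minus_integrable(2)[OF t, of x] by simp
  finally show ?thesis .
qed

lemma sdiff_pow_0 [simp]: "sdiff_pow 0 h f = f"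
  by (simp add: sdiff_pow_def)

lemma sdiff_pow_Suc: "sdiff_pow (Suc k) h f = sdiff h (sdiff_pow k h f)"
  by (simp add: sdiff_pow_def)

lemma sdiff_pow_Suc2: "sdiff_pow (Suc k) h f = sdiff_pow k h (sdiff h f)"
  by (simp add: sdiff_pow_def funpow_swap1)

lemma sdiff_measurable [measurable]:
  assumes [measurable]: "w \<in> borel_measurable borel"
  shows "sdiff h w \<in> borel_measurable borel"
  unfolding sdiff_def by measurable

lemma sdiff_pow_measurable [measurable]:
  assumes "w \<in> borel_measurable borel"
  shows "sdiff_pow k h w \<in> borel_measurable borel"
  by (induction k) (auto simp: sdiff_pow_Suc assms)

lemma sdiff_pow_bounded:
  assumes "\<And>x. \<bar>w x\<bar> \<le> B"
  shows "\<bar>sdiff_pow k h w x\<bar> \<le> 2 ^ k * B"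
proof (induction k arbitrary: x)
  case (Suc k)
  have "\<bar>sdiff_pow (Suc k) h w x\<bar> \<le> \<bar>sdiff_pow k h w (x + h /\<^sub>R 2)\<bar> + \<bar>sdiff_pow k h w (x - h /\<^sub>R 2)\<bar>"
    unfolding sdiff_pow_Suc sdiff_def by linarith
  also have "\<dots> \<le> 2 ^ k * B + 2 ^ k * B" by (intro add_mono Suc)
  finally show ?case by (simp add: mult_ac)
qed (use assms in simp)

lemma sdiff_pow_diff: "sdiff_pow k h (\<lambda>x. f x - g x) x = sdiff_pow k h f x - sdiff_pow k h g x"
  by (induction k arbitrary: x) (auto simp: sdiff_pow_Suc sdiff_def)

lemma sdiff_pow_cmult: "sdiff_pow k h (\<lambda>x. c * f x) x = c * sdiff_pow k h f x"
  by (induction k arbitrary: x) (auto simp: sdiff_pow_Suc sdiff_def algebra_simps)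

lemma hconv_translate:
  assumes [measurable]: "w \<in> borel_measurable borel"
  shows "hconv t (\<lambda>y. w (y + a)) x = hconv t w (x + a)"
proof -
  have "hconv t w (x + a) = (LINT y|lborel. heat t (x + a - (a + y)) * w (a + y))"
    unfolding hconv_def by (rule lborel_integral_plus[symmetric]) measurable
  then show ?thesis by (simp add: hconv_def add.commute)
qed

lemma sdiff_hconv:
  fixes w :: "'a::euclidean_space \<Rightarrow> real"
  assumes t: "t > 0" and [measurable]: "w \<in> borel_measurable borel" and B: "\<And>x. \<bar>w x\<bar> \<le> B"
  shows "sdiff h (hconv t w) = hconv t (sdiff h w)"
proof
  fix x
  have i: "integrable lborel (\<lambda>y. heat t (x - y) * w (y + a))" for a
    using B by (intro heat_bounded_integrable[OF t, of _ B]) auto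
  show "sdiff h (hconv t w) x = hconv t (sdiff h w) x"
    unfolding sdiff_def using i[of "h /\<^sub>R 2"] i[of "- (h /\<^sub>R 2)"]
      hconv_translate[of w t "h /\<^sub>R 2" x] hconv_translate[of w t "- (h /\<^sub>R 2)" x]
    by (simp add: hconv_def right_diff_distrib)
qed

lemma sdiff_pow_hconv:
  fixes w :: "'a::euclidean_space \<Rightarrow> real"
  assumes t: "t > 0" and w: "w \<in> borel_measurable borel" and B: "\<And>x. \<bar>w x\<bar> \<le> B"
  shows "sdiff_pow k h (hconv t w) = hconv t (sdiff_pow k h w)"
proof (induction k)
  case (Suc k)
  then show ?case
    using sdiff_hconv[OF t sdiff_pow_measurable[OF w] sdiff_pow_bounded[OF B]] by (simp add: sdiff_pow_Suc)
qed simp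

lemma half_plus_half: "h /\<^sub>R 2 + h /\<^sub>R 2 = (h :: 'a::real_vector)"
  by (simp add: scaleR_add_left[symmetric])

lemma heat_diff_integral_le:
  fixes x h :: "'a::euclidean_space"
  assumes t: "t > 0" and h: "norm h \<le> sqrt t"
  shows "integrable lborel (\<lambda>y. \<bar>heat t (x + h - y) - heat t (x - y)\<bar>)"
    and "(LINT y|lborel. \<bar>heat t (x + h - y) - heat t (x - y)\<bar>) \<le> 2 ^ (DIM('a) + 2) * (norm h / sqrt t)"
proof -
  show i: "integrable lborel (\<lambda>y. \<bar>heat t (x + h - y) - heat t (x - y)\<bar>)"
    using heat_minus_integrable(1)[OF t] by (intro integrable_abs Bochner_Integration.integrable_diff)
  have "(LINT y|lborel. \<bar>heat t (x + h - y) - heat t (x - y)\<bar>) \<le> (LINT y|lborel. 2 ^ (DIM('a) + 2) * (norm h / sqrt t) * heat (4 * t) (x - y))"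
  proof (intro integral_mono i)
    show "\<bar>heat t (x + h - y) - heat t (x - y)\<bar> \<le> 2 ^ (DIM('a) + 2) * (norm h / sqrt t) * heat (4 * t) (x - y)" for y
      using heat_diff_le[OF t h, of "x - y"] by (simp add: algebra_simps)
    show "integrable lborel (\<lambda>y. 2 ^ (DIM('a) + 2) * (norm h / sqrt t) * heat (4 * t) (x - y))"
      using t by (intro integrable_mult_right heat_minus_integrable) simp
  qed
  also have "\<dots> = 2 ^ (DIM('a) + 2) * (norm h / sqrt t)"
    using heat_minus_integrable(2)[of "4 * t" x] t by simp
  finally show "(LINT y|lborel. \<bar>heat t (x + h - y) - heat t (x - y)\<bar>) \<le> 2 ^ (DIM('a) + 2) * (norm h / sqrt t)" .
qed

text \<open>For bounded \<open>w\<close> the integrated modulus of continuity of the kernel is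
  enough. This serves each difference after the first in the iterated estimate, when the function is
  already smoothed.\<close>

lemma sdiff_hconv_bounded:
  fixes w :: "'a::euclidean_space \<Rightarrow> real"
  assumes t: "t > 0" and h: "norm h \<le> sqrt t"
    and w [measurable]: "w \<in> borel_measurable borel" and B: "\<And>x. \<bar>w x\<bar> \<le> B"
  shows "\<bar>sdiff h (hconv t w) x\<bar> \<le> 2 ^ (DIM('a) + 2) * (norm h / sqrt t) * B"
proof -
  \<comment> \<open>Recentring turns the symmetric difference into the one-sided one of the kernel
    estimate.\<close>
  define z where "z = x - h /\<^sub>R 2"
  have z: "x + h /\<^sub>R 2 = z + h" using half_plus_half[of h] by (simp add: z_def algebra_simps)
  have int: "integrable lborel (\<lambda>y. heat t (a - y) * w y)" for a
    by (rule heat_bounded_integrable[OF t w B])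
  have "sdiff h (hconv t w) x = (LINT y|lborel. (heat t (z + h - y) - heat t (z - y)) * w y)"
    unfolding sdiff_def z z_def[symmetric] hconv_def left_diff_distrib
    by (rule Bochner_Integration.integral_diff[symmetric]) (rule int)+
  also have "\<bar>\<dots>\<bar> \<le> (LINT y|lborel. \<bar>(heat t (z + h - y) - heat t (z - y)) * w y\<bar>)"
    by (rule integral_abs_bound)
  also have "\<dots> \<le> (LINT y|lborel. \<bar>heat t (z + h - y) - heat t (z - y)\<bar> * B)"
  proof (rule integral_mono)
    show "integrable lborel (\<lambda>y. \<bar>(heat t (z + h - y) - heat t (z - y)) * w y\<bar>)"
      unfolding left_diff_distrib by (intro integrable_abs Bochner_Integration.integrable_diff int)
  qed (use heat_diff_integral_le(1)[OF t h, of z] B in \<open>auto simp: abs_mult intro!: mult_left_mono\<close>)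
  also have "\<dots> \<le> 2 ^ (DIM('a) + 2) * (norm h / sqrt t) * B"
    using mult_right_mono[OF heat_diff_integral_le(2)[OF t h, of z], of B] B[of 0] by simp
  finally show ?thesis .
qed

text \<open>Bringing \<open>q\<close> above 1 takes about \<open>log 4 (1 / q)\<close> quadruplings,
  and a logarithm is bounded by any positive power.\<close>

lemma power_of_4_ge:
  fixes \<delta> :: real
  assumes "\<delta> > 0"
  obtains K where "K \<ge> 0" "\<And>q. 0 < q \<Longrightarrow> q < 1 \<Longrightarrow> \<exists>k. 1 \<le> 4 ^ k * q \<and> real k \<le> K * q powr (- \<delta>)"
proof -
  define K where "K = 1 + 1 / (\<delta> * ln 4)"
  have "\<exists>k. 1 \<le> 4 ^ k * q \<and> real k \<le> K * q powr (- \<delta>)" if q: "0 < q" "q < 1" for q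
  proof -
    define k where "k = nat \<lceil>log 4 (1 / q)\<rceil>"
    have l: "log 4 (1 / q) \<ge> 0" using q by simp
    have k: "log 4 (1 / q) \<le> real k" "real k \<le> log 4 (1 / q) + 1"
      unfolding k_def using l by linarith+
    have "1 / q \<le> 4 powr real k" using k(1) q by (simp add: log_le_iff)
    then have "1 \<le> 4 ^ k * q" using q by (simp add: powr_realpow divide_le_eq)
    moreover have "real k \<le> K * q powr (- \<delta>)"
    proof -
      have inv: "(1 / q) powr \<delta> = q powr (- \<delta>)" using q by (simp add: powr_minus_divide powr_divide)
      have "ln (1 / q) \<le> (1 / q) powr \<delta> / \<delta>" using q assms by (intro ln_powr_bound) auto
      then have "log 4 (1 / q) \<le> q powr (- \<delta>) / \<delta> / ln 4"
        unfolding log_def inv by (intro divide_right_mono) auto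
      moreover have "1 \<le> q powr (- \<delta>)" using q assms ge_one_powr_ge_zero[of "1 / q" \<delta>] by (simp add: inv)
      ultimately have "real k \<le> q powr (- \<delta>) / \<delta> / ln 4 + q powr (- \<delta>)" using k(2) by linarith
      then show ?thesis by (simp add: K_def algebra_simps)
    qed
    ultimately show ?thesis by blast
  qed
  then show thesis using assms by (intro that[of K]) (auto simp: K_def)
qed

text \<open>Everything proved later about an arbitrary function in \<open>bmo\<close> rests on these
  bounds. The constant \<open>c\<close> may depend on both \<open>x\<close> and \<open>t\<close>,
  while \<open>M\<close> and \<open>N\<close> do not. Cube averages control the square only at
  scales of at least a cube, hence \<open>t \<ge> 1\<close> there.\<close>

locale heat_tame =
  fixes g :: "'a::euclidean_space \<Rightarrow> real" and N M :: real
  assumes meas [measurable]: "g \<in> borel_measurable borel"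
    and sq_int: "\<And>x t. t \<ge> 1 \<Longrightarrow> integrable lborel (\<lambda>y. heat t (x - y) * (g y)\<^sup>2)"
    and sq_le: "\<And>x t. t \<ge> 1 \<Longrightarrow> (LINT y|lborel. heat t (x - y) * (g y)\<^sup>2) \<le> N"
    and osc: "\<And>x t. t > 0 \<Longrightarrow> \<exists>c. integrable lborel (\<lambda>y. heat (4 * t) (x - y) * \<bar>g y - c\<bar>)
       \<and> (LINT y|lborel. heat (4 * t) (x - y) * \<bar>g y - c\<bar>) \<le> M"
    and N_nonneg: "N \<ge> 0" and M_nonneg: "M \<ge> 0"
begin

text \<open>The same \<open>c\<close> serves both times, which makes the two heat extensions
  comparable with each other.\<close>

lemma osc_both:
  assumes t: "t > 0"
  obtains c where "integrable lborel (\<lambda>y. heat (4 * t) (x - y) * \<bar>g y - c\<bar>)"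
    "(LINT y|lborel. heat (4 * t) (x - y) * \<bar>g y - c\<bar>) \<le> M"
    "integrable lborel (\<lambda>y. heat t (x - y) * \<bar>g y - c\<bar>)"
    "(LINT y|lborel. heat t (x - y) * \<bar>g y - c\<bar>) \<le> 2 ^ DIM('a) * M"
proof -
  obtain c where c: "integrable lborel (\<lambda>y. heat (4 * t) (x - y) * \<bar>g y - c\<bar>)"
    "(LINT y|lborel. heat (4 * t) (x - y) * \<bar>g y - c\<bar>) \<le> M"
    using osc[OF t, of x] by blast
  have i: "integrable lborel (\<lambda>y. 2 ^ DIM('a) * (heat (4 * t) (x - y) * \<bar>g y - c\<bar>))"
    using c(1) by simp
  have le: "heat t (x - y) * \<bar>g y - c\<bar> \<le> 2 ^ DIM('a) * (heat (4 * t) (x - y) * \<bar>g y - c\<bar>)" for y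
    using mult_right_mono[OF heat_le_heat_4[OF t, of "x - y"], of "\<bar>g y - c\<bar>"] by (simp add: mult_ac)
  have j: "integrable lborel (\<lambda>y. heat t (x - y) * \<bar>g y - c\<bar>)"
    using le by (intro Bochner_Integration.integrable_bound[OF i]) (auto simp: abs_mult)
  have "(LINT y|lborel. heat t (x - y) * \<bar>g y - c\<bar>) \<le> (LINT y|lborel. 2 ^ DIM('a) * (heat (4 * t) (x - y) * \<bar>g y - c\<bar>))"
    by (intro integral_mono i j le)
  also have "\<dots> \<le> 2 ^ DIM('a) * M" using c(2) by simp
  finally show thesis using that[OF c j] by simp
qed

lemma osc_integrable:
  assumes t: "t > 0" and i: "integrable lborel (\<lambda>y. heat t (x - y) * \<bar>g y - c\<bar>)"
  shows "integrable lborel (\<lambda>y. heat t (x - y) * (g y - c))"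
    and "integrable lborel (\<lambda>y. heat t (x - y) * g y)"
    and "(LINT y|lborel. heat t (x - y) * (g y - c)) = hconv t g x - c"
    and "\<bar>hconv t g x - c\<bar> \<le> (LINT y|lborel. heat t (x - y) * \<bar>g y - c\<bar>)"
proof -
  show 1: "integrable lborel (\<lambda>y. heat t (x - y) * (g y - c))"
    by (rule Bochner_Integration.integrable_bound[OF i]) (auto simp: abs_mult)
  have 0: "integrable lborel (\<lambda>y. heat t (x - y) * c)" "(LINT y|lborel. heat t (x - y) * c) = c"
    using heat_minus_integrable[OF t, of x] by auto
  show 2: "integrable lborel (\<lambda>y. heat t (x - y) * g y)"
    using Bochner_Integration.integrable_add[OF 1 0(1)] by (simp add: algebra_simps)
  show 3: "(LINT y|lborel. heat t (x - y) * (g y - c)) = hconv t g x - c"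
    unfolding hconv_def right_diff_distrib using Bochner_Integration.integral_diff[OF 2 0(1)] 0(2) by simp
  show "\<bar>hconv t g x - c\<bar> \<le> (LINT y|lborel. heat t (x - y) * \<bar>g y - c\<bar>)"
    using integral_abs_bound[of lborel "\<lambda>y. heat t (x - y) * (g y - c)"] by (simp add: 3 abs_mult)
qed

lemma heat_integrable:
  assumes t: "t > 0"
  shows "integrable lborel (\<lambda>y. heat t (x - y) * g y)" and "integrable lborel (\<lambda>y. heat t (x - y) * \<bar>g y\<bar>)"
proof -
  obtain c where "integrable lborel (\<lambda>y. heat t (x - y) * \<bar>g y - c\<bar>)" using osc_both[OF t, of x] by metis
  from osc_integrable(2)[OF t this] show 1: "integrable lborel (\<lambda>y. heat t (x - y) * g y)" .
  show "integrable lborel (\<lambda>y. heat t (x - y) * \<bar>g y\<bar>)"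
    using integrable_abs[OF 1] by (simp add: abs_mult)
qed

definition "step_bound = (2 ^ DIM('a) + 1) * M"

lemma step_bound_nonneg: "step_bound \<ge> 0" using M_nonneg by (simp add: step_bound_def)

lemma hconv_4:
  assumes t: "t > 0"
  shows "\<bar>hconv t g x - hconv (4 * t) g x\<bar> \<le> step_bound"
proof -
  obtain c where c: "integrable lborel (\<lambda>y. heat (4 * t) (x - y) * \<bar>g y - c\<bar>)"
    "(LINT y|lborel. heat (4 * t) (x - y) * \<bar>g y - c\<bar>) \<le> M"
    "integrable lborel (\<lambda>y. heat t (x - y) * \<bar>g y - c\<bar>)"
    "(LINT y|lborel. heat t (x - y) * \<bar>g y - c\<bar>) \<le> 2 ^ DIM('a) * M"
    by (rule osc_both[OF t, of x])
  have "\<bar>hconv t g x - c\<bar> \<le> 2 ^ DIM('a) * M" using osc_integrable(4)[OF t c(3)] c(4) by linarith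
  moreover have "\<bar>hconv (4 * t) g x - c\<bar> \<le> M" using osc_integrable(4)[OF _ c(1)] t c(2) by linarith
  ultimately have "\<bar>hconv t g x - hconv (4 * t) g x\<bar> \<le> 2 ^ DIM('a) * M + M" by linarith
  then show ?thesis by (simp add: step_bound_def algebra_simps)
qed

lemma hconv_4_power:
  assumes t: "t > 0"
  shows "\<bar>hconv t g x - hconv (4 ^ k * t) g x\<bar> \<le> real k * step_bound"
proof (induction k)
  case (Suc k)
  have "\<bar>hconv (4 ^ k * t) g x - hconv (4 * (4 ^ k * t)) g x\<bar> \<le> step_bound" using t by (intro hconv_4) simp
  with Suc show ?case by (simp add: algebra_simps)
qed simp

text \<open>Split off \<open>c\<close>. Its modulus is the heat extension up to one more
  oscillation, whence twice \<open>2 ^ DIM('a) * M\<close>.\<close>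

lemma abs_conv_le:
  assumes t: "t > 0"
  shows "(LINT y|lborel. heat t (x - y) * \<bar>g y\<bar>) \<le> 2 ^ (DIM('a) + 1) * M + \<bar>hconv t g x\<bar>"
proof -
  obtain c where cc: "integrable lborel (\<lambda>y. heat (4 * t) (x - y) * \<bar>g y - c\<bar>)"
    "(LINT y|lborel. heat (4 * t) (x - y) * \<bar>g y - c\<bar>) \<le> M"
    "integrable lborel (\<lambda>y. heat t (x - y) * \<bar>g y - c\<bar>)"
    "(LINT y|lborel. heat t (x - y) * \<bar>g y - c\<bar>) \<le> 2 ^ DIM('a) * M"
    by (rule osc_both[OF t, of x])
  note c = cc(3,4)
  have 0: "integrable lborel (\<lambda>y. heat t (x - y) * \<bar>c\<bar>)" "(LINT y|lborel. heat t (x - y) * \<bar>c\<bar>) = \<bar>c\<bar>"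
    using heat_minus_integrable[OF t, of x] by auto
  have "(LINT y|lborel. heat t (x - y) * \<bar>g y\<bar>) \<le> (LINT y|lborel. heat t (x - y) * \<bar>g y - c\<bar> + heat t (x - y) * \<bar>c\<bar>)"
    by (intro integral_mono heat_integrable(2)[OF t] Bochner_Integration.integrable_add c(1) 0(1))
       (auto simp: distrib_left[symmetric] intro!: mult_left_mono)
  also have "\<dots> = (LINT y|lborel. heat t (x - y) * \<bar>g y - c\<bar>) + \<bar>c\<bar>"
    using Bochner_Integration.integral_add[OF c(1) 0(1)] 0(2) by simp
  also have "\<dots> \<le> 2 * (2 ^ DIM('a) * M) + \<bar>hconv t g x\<bar>"
    using osc_integrable(4)[OF t c(1)] c(2) by linarith
  finally show ?thesis by simp
qed

lemma abs_conv_large: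
  assumes t: "t \<ge> 1"
  shows "(LINT y|lborel. heat t (x - y) * \<bar>g y\<bar>) \<le> (1 + N) / 2"
proof -
  have t0: "t > 0" using t by simp
  have i: "integrable lborel (\<lambda>y. (heat t (x - y) + heat t (x - y) * (g y)\<^sup>2) / 2)"
    using sq_int[OF t, of x] heat_minus_integrable(1)[OF t0, of x] by simp
  have "(LINT y|lborel. heat t (x - y) * \<bar>g y\<bar>) \<le> (LINT y|lborel. (heat t (x - y) + heat t (x - y) * (g y)\<^sup>2) / 2)"
  proof (intro integral_mono heat_integrable(2)[OF t0] i)
    fix y
    have "\<bar>g y\<bar> \<le> (1 + (g y)\<^sup>2) / 2"
      using zero_le_power2[of "\<bar>g y\<bar> - 1"] by (simp add: power2_diff)
    from mult_left_mono[OF this, of "heat t (x - y)"]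
    show "heat t (x - y) * \<bar>g y\<bar> \<le> (heat t (x - y) + heat t (x - y) * (g y)\<^sup>2) / 2" by (simp add: distrib_left)
  qed
  also have "\<dots> = ((LINT y|lborel. heat t (x - y)) + (LINT y|lborel. heat t (x - y) * (g y)\<^sup>2)) / 2"
    using Bochner_Integration.integral_add[OF heat_minus_integrable(1)[OF t0, of x] sq_int[OF t, of x]] by simp
  also have "\<dots> \<le> (1 + N) / 2"
    using heat_minus_integrable(2)[OF t0, of x] sq_le[OF t, of x] by simp
  finally show ?thesis .
qed

lemma hconv_abs_le:
  shows "\<bar>hconv t g x\<bar> \<le> (LINT y|lborel. heat t (x - y) * \<bar>g y\<bar>)"
  using integral_abs_bound[of lborel "\<lambda>y. heat t (x - y) * g y"] by (simp add: hconv_def abs_mult)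

text \<open>For \<open>t < 1\<close>, quadruple the time until it is at least 1, where the square
  bound applies. Each quadrupling costs \<open>step_bound\<close>, and their number is traded for a
  small negative power of \<open>t\<close>.\<close>

lemma abs_conv_power_bound:
  assumes d: "\<delta> > 0"
  obtains C where "C \<ge> 0" "\<And>t x. t > 0 \<Longrightarrow> (LINT y|lborel. heat t (x - y) * \<bar>g y\<bar>) \<le> C * (1 + t powr (- \<delta>))"
proof -
  obtain K where K: "K \<ge> 0" "\<And>q. 0 < q \<Longrightarrow> q < 1 \<Longrightarrow> \<exists>k. 1 \<le> 4 ^ k * q \<and> real k \<le> K * q powr (- \<delta>)"
    using power_of_4_ge[OF d] by blast
  define A where "A = (1 + N) / 2 + 2 ^ (DIM('a) + 1) * M"
  define C where "C = A + K * step_bound"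
  have A: "A \<ge> (1 + N) / 2" "A \<ge> 0" using N_nonneg M_nonneg by (auto simp: A_def)
  have C: "C \<ge> A" "C \<ge> 0" "C \<ge> K * step_bound" using A K step_bound_nonneg by (auto simp: C_def)
  show thesis
  proof (rule that[OF C(2)])
    fix t :: real and x assume t: "t > 0"
    show "(LINT y|lborel. heat t (x - y) * \<bar>g y\<bar>) \<le> C * (1 + t powr (- \<delta>))"
    proof (cases "t \<ge> 1")
      case True
      have "(LINT y|lborel. heat t (x - y) * \<bar>g y\<bar>) \<le> C * 1" using abs_conv_large[OF True, of x] A C by linarith
      also have "\<dots> \<le> C * (1 + t powr (- \<delta>))" using C by (intro mult_left_mono) auto
      finally show ?thesis .
    next
      case False
      then obtain k where k: "1 \<le> 4 ^ k * t" "real k \<le> K * t powr (- \<delta>)" using K(2)[of t] t by auto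
      have "\<bar>hconv (4 ^ k * t) g x\<bar> \<le> (1 + N) / 2"
        using abs_conv_large[OF k(1), of x] hconv_abs_le[of "4 ^ k * t" x] by linarith
      moreover have "\<bar>hconv t g x - hconv (4 ^ k * t) g x\<bar> \<le> (K * t powr (- \<delta>)) * step_bound"
        using hconv_4_power[OF t, of x k] mult_right_mono[OF k(2) step_bound_nonneg] by linarith
      ultimately have "(LINT y|lborel. heat t (x - y) * \<bar>g y\<bar>) \<le> A + (K * step_bound) * t powr (- \<delta>)"
        using abs_conv_le[OF t, of x] unfolding A_def mult.assoc mult.commute[of step_bound] by linarith
      also have "\<dots> \<le> C + C * t powr (- \<delta>)" using C by (intro add_mono mult_right_mono) auto
      finally show ?thesis by (simp add: distrib_left)
    qed
  qed
qed

text \<open>A qualitative bound, allowed to depend on \<open>t\<close>; it justifies commuting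
  differences with a further convolution.\<close>

lemma hconv_uniformly_bounded:
  assumes t: "t > 0"
  obtains B where "\<And>x. \<bar>hconv t g x\<bar> \<le> B"
proof -
  obtain C where "\<And>t x. t > 0 \<Longrightarrow> (LINT y|lborel. heat t (x - y) * \<bar>g y\<bar>) \<le> C * (1 + t powr (- 1))"
    using abs_conv_power_bound[of 1] by (metis zero_less_one)
  then show thesis using t by (intro that[of "C * (1 + t powr (- 1))"]) (rule order_trans[OF hconv_abs_le])
qed

text \<open>The kernel difference has integral 0, so \<open>g\<close> may be replaced by
  \<open>g - c\<close>; the kernel estimate then leads to the oscillation at time
  \<open>4 * t\<close>.\<close>

lemma sdiff_hconv_tame:
  assumes t: "t > 0" and h: "norm h \<le> sqrt t"
  shows "\<bar>sdiff h (hconv t g) x\<bar> \<le> 2 ^ (DIM('a) + 2) * (norm h / sqrt t) * M"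
proof -
  define z where "z = x - h /\<^sub>R 2"
  have z: "x + h /\<^sub>R 2 = z + h" using half_plus_half[of h] by (simp add: z_def algebra_simps)
  obtain c where c: "integrable lborel (\<lambda>y. heat (4 * t) (z - y) * \<bar>g y - c\<bar>)"
    "(LINT y|lborel. heat (4 * t) (z - y) * \<bar>g y - c\<bar>) \<le> M"
    "integrable lborel (\<lambda>y. heat t (z - y) * \<bar>g y - c\<bar>)"
    "(LINT y|lborel. heat t (z - y) * \<bar>g y - c\<bar>) \<le> 2 ^ DIM('a) * M"
    by (rule osc_both[OF t, of z])
  \<comment> \<open>The constant \<open>c\<close> belongs to the centre \<open>z\<close>. At
    \<open>z + h\<close>, integrability of \<open>g - c\<close> comes from \<open>g\<close> and the
    constant separately.\<close>
  have i1: "integrable lborel (\<lambda>y. heat t (a - y) * (g y - c))"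
    and e1: "(LINT y|lborel. heat t (a - y) * (g y - c)) = hconv t g a - c" for a
  proof -
    have "integrable lborel (\<lambda>y. heat t (a - y) * g y - heat t (a - y) * c)"
      using heat_integrable(1)[OF t] heat_minus_integrable(1)[OF t, of a] by (intro Bochner_Integration.integrable_diff) auto
    then have i: "integrable lborel (\<lambda>y. heat t (a - y) * (g y - c))" by (simp add: right_diff_distrib)
    then have "integrable lborel (\<lambda>y. heat t (a - y) * \<bar>g y - c\<bar>)" using integrable_abs[OF i] by (simp add: abs_mult)
    from osc_integrable(3)[OF t this] i
    show "integrable lborel (\<lambda>y. heat t (a - y) * (g y - c))"
      "(LINT y|lborel. heat t (a - y) * (g y - c)) = hconv t g a - c" by auto
  qed
  have i2: "integrable lborel (\<lambda>y. (heat t (z + h - y) - heat t (z - y)) * (g y - c))"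
    unfolding left_diff_distrib by (intro Bochner_Integration.integrable_diff i1)
  have "sdiff h (hconv t g) x = (LINT y|lborel. (heat t (z + h - y) - heat t (z - y)) * (g y - c))"
    unfolding left_diff_distrib sdiff_def z z_def[symmetric]
    using Bochner_Integration.integral_diff[OF i1 i1, of "z + h" z] by (simp add: e1)
  also have "\<bar>\<dots>\<bar> \<le> (LINT y|lborel. \<bar>(heat t (z + h - y) - heat t (z - y)) * (g y - c)\<bar>)"
    by (rule integral_abs_bound)
  also have "\<dots> \<le> (LINT y|lborel. 2 ^ (DIM('a) + 2) * (norm h / sqrt t) * (heat (4 * t) (z - y) * \<bar>g y - c\<bar>))"
  proof (intro integral_mono integrable_abs i2)
    fix y
    show "\<bar>(heat t (z + h - y) - heat t (z - y)) * (g y - c)\<bar> \<le> 2 ^ (DIM('a) + 2) * (norm h / sqrt t) * (heat (4 * t) (z - y) * \<bar>g y - c\<bar>)"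
      using mult_right_mono[OF heat_diff_le[OF t h, of "z - y"], of "\<bar>g y - c\<bar>"]
      by (simp add: abs_mult mult_ac diff_add_eq)
  qed (use c(1) in simp)
  also have "\<dots> \<le> 2 ^ (DIM('a) + 2) * (norm h / sqrt t) * M"
    using mult_left_mono[OF c(2), of "2 ^ (DIM('a) + 2) * (norm h / sqrt t)"] t by simp
  finally show ?thesis .
qed


lemma hconv_continuous:
  assumes t: "t > 0"
  shows "continuous_on UNIV (hconv t g)"
proof -
  have "isCont (hconv t g) x" for x
    unfolding isCont_iff
  proof (rule LIM_zero_cancel, rule Lim_null_comparison)
    show "((\<lambda>h. 2 ^ (DIM('a) + 2) * (norm h / sqrt t) * M) \<longlongrightarrow> 0) (at 0)"
      using t by (auto intro!: tendsto_eq_intros)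
    have "eventually (\<lambda>h::'a. norm h \<le> sqrt t) (at 0)"
      unfolding eventually_at using t by (intro exI[of _ "sqrt t"]) (auto simp: dist_norm)
    then show "eventually (\<lambda>h. norm (hconv t g (x + h) - hconv t g x) \<le> 2 ^ (DIM('a) + 2) * (norm h / sqrt t) * M) (at 0)"
    proof (rule eventually_mono)
      fix h :: 'a assume "norm h \<le> sqrt t"
      from sdiff_hconv_tame[OF t this, of "x + h /\<^sub>R 2"]
      show "norm (hconv t g (x + h) - hconv t g x) \<le> 2 ^ (DIM('a) + 2) * (norm h / sqrt t) * M"
        using half_plus_half[of h] by (simp add: sdiff_def add.assoc)
    qed
  qed
  then show ?thesis by (simp add: continuous_at_imp_continuous_on)
qed

text \<open>Fubini applies because integrating moduli in \<open>y\<close> first collapses the two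
  kernels into one, leaving the Gaussian mean of the modulus of \<open>g\<close>.\<close>

lemma hconv_semigroup:
  assumes a: "a > 0" and b: "b > 0"
  shows "hconv a (hconv b g) x = hconv (a + b) g x"
proof -
  let ?f = "\<lambda>(z, y). heat a (x - y) * heat b (y - z) * g z"
  have ab: "a + b > 0" using a b by simp
  have s: "integrable lborel (\<lambda>y. heat a (x - y) * heat b (y - z))"
    "(LINT y|lborel. heat a (x - y) * heat b (y - z)) = heat (a + b) (x - z)" for z
    using heat_semigroup[OF a b, of x z] by (auto simp: has_bochner_integral_iff)
  have i: "integrable (lborel \<Otimes>\<^sub>M lborel) ?f"
  proof (rule lborel_pair.Fubini_integrable)
    show "integrable lborel (\<lambda>z. LINT y|lborel. norm (?f (z, y)))"
      using heat_integrable(2)[OF ab, of x] s(2) by (simp add: abs_mult)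
    show "AE z in lborel. integrable lborel (\<lambda>y. ?f (z, y))"
      using s(1) by simp
  qed measurable
  have "hconv a (hconv b g) x = (LINT y|lborel. (LINT z|lborel. ?f (z, y)))"
    unfolding hconv_def by (simp add: mult.assoc)
  also have "\<dots> = (LINT z|lborel. (LINT y|lborel. ?f (z, y)))"
    using lborel_pair.Fubini_integral[of "\<lambda>z y. ?f (z, y)"] i by simp
  also have "\<dots> = hconv (a + b) g x"
    unfolding hconv_def using s(2) by simp
  finally show ?thesis .
qed

text \<open>Cut the time into equal slices and spend one slice on each difference. The first
  difference uses the oscillation of \<open>g\<close>; every later one acts on a bounded
  function.\<close>

lemma sdiff_pow_hconv_multiple:
  assumes t: "\<tau> > 0" and h: "norm h \<le> sqrt \<tau>"
  shows "\<bar>sdiff_pow (Suc j) h (hconv (real (Suc j) * \<tau>) g) x\<bar> \<le> (2 ^ (DIM('a) + 2) * (norm h / sqrt \<tau>)) ^ Suc j * M"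
proof (induction j arbitrary: x)
  case 0
  then show ?case using sdiff_hconv_tame[OF t h, of x] by (simp add: sdiff_pow_Suc)
next
  case (Suc j)
  let ?b = "real (Suc j) * \<tau>"
  let ?D = "2 ^ (DIM('a) + 2) * (norm h / sqrt \<tau>)"
  have b: "?b > 0" using t by simp
  obtain B where B: "\<And>x. \<bar>hconv ?b g x\<bar> \<le> B" using hconv_uniformly_bounded[OF b] by blast
  have "hconv (real (Suc (Suc j)) * \<tau>) g = hconv \<tau> (hconv ?b g)"
    using hconv_semigroup[OF t b] by (intro ext) (simp add: algebra_simps)
  then have "sdiff_pow (Suc (Suc j)) h (hconv (real (Suc (Suc j)) * \<tau>) g) = sdiff h (hconv \<tau> (sdiff_pow (Suc j) h (hconv ?b g)))"
    unfolding sdiff_pow_Suc[of "Suc j"] using sdiff_pow_hconv[OF t hconv_measurable[OF meas] B] by simp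
  then have "\<bar>sdiff_pow (Suc (Suc j)) h (hconv (real (Suc (Suc j)) * \<tau>) g) x\<bar> \<le> ?D * (?D ^ Suc j * M)"
    using sdiff_hconv_bounded[OF t h sdiff_pow_measurable[OF hconv_measurable[OF meas]] Suc.IH, of x] by simp
  then show ?case by (simp only: power_Suc mult.assoc)
qed

lemma sdiff_pow_hconv_large:
  assumes m: "m > 0" and t: "t > 0" and h: "real m * (norm h)\<^sup>2 \<le> t"
  shows "\<bar>sdiff_pow m h (hconv t g) x\<bar> \<le> (2 ^ (DIM('a) + 2) * sqrt (real m)) ^ m * M * (norm h / sqrt t) ^ m"
proof -
  obtain j where j: "m = Suc j" using m by (cases m) auto
  \<comment> \<open>One slice per difference; the hypothesis on \<open>h\<close> says exactly that
    \<open>norm h \<le> sqrt \<tau>\<close>.\<close>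
  define \<tau> where "\<tau> = t / real m"
  have \<tau>: "\<tau> > 0" "real m * \<tau> = t" using t m by (auto simp: \<tau>_def)
  have "(norm h)\<^sup>2 \<le> \<tau>" using h m by (simp add: \<tau>_def field_simps)
  then have "norm h \<le> sqrt \<tau>" by (rule real_le_rsqrt)
  from sdiff_pow_hconv_multiple[OF \<tau>(1) this, of j x]
  have "\<bar>sdiff_pow m h (hconv t g) x\<bar> \<le> (2 ^ (DIM('a) + 2) * (norm h / sqrt \<tau>)) ^ m * M"
    using \<tau>(2) by (simp add: j)
  also have "norm h / sqrt \<tau> = sqrt (real m) * (norm h / sqrt t)"
    by (simp add: \<tau>_def real_sqrt_divide)
  finally show ?thesis by (simp only: power_mult_distrib mult_ac)
qed

text \<open>For \<open>t\<close> below \<open>m * \<bar>h\<bar>\<^sup>2\<close> one first passes to \<open>4 ^ k * t\<close>, which costs only a multiple of \<open>k\<close>.\<close>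

lemma sdiff_pow_hconv_all:
  assumes m: "m > 0" and d: "\<delta> > 0"
  obtains C where "C \<ge> 0"
    "\<And>h t x. t > 0 \<Longrightarrow> h \<noteq> 0 \<Longrightarrow> \<bar>sdiff_pow m h (hconv t g) x\<bar> \<le>
       C * (if t / (norm h)\<^sup>2 < real m then (t / (norm h)\<^sup>2) powr (- \<delta>) else (t / (norm h)\<^sup>2) powr (- real m / 2))"
proof -
  obtain K where K: "K \<ge> 0" "\<And>q. 0 < q \<Longrightarrow> q < 1 \<Longrightarrow> \<exists>k. 1 \<le> 4 ^ k * q \<and> real k \<le> K * q powr (- \<delta>)"
    using power_of_4_ge[OF d] by blast
  define A where "A = (2 ^ (DIM('a) + 2) * sqrt (real m)) ^ m * M"
  define C1 where "C1 = (A + 2 ^ m * (K * step_bound)) * real m powr \<delta>"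
  have A: "A \<ge> 0" using M_nonneg by (simp add: A_def)
  have C1: "C1 \<ge> 0" using A K step_bound_nonneg by (simp add: C1_def)
  show thesis
  proof (rule that[of "A + C1"])
    fix h x :: 'a and t :: real assume t: "t > 0" and h: "h \<noteq> 0"
    \<comment> \<open>The bound depends on \<open>t\<close> and \<open>h\<close> only through this
      parabolic ratio, so integrating in \<open>t\<close> will reduce to a change of scale.\<close>
    define q where "q = t / (norm h)\<^sup>2"
    have q: "q > 0" using t h by (simp add: q_def)
    have tq: "t = q * (norm h)\<^sup>2" using h by (simp add: q_def)
    show "\<bar>sdiff_pow m h (hconv t g) x\<bar> \<le>
       (A + C1) * (if t / (norm h)\<^sup>2 < real m then (t / (norm h)\<^sup>2) powr (- \<delta>) else (t / (norm h)\<^sup>2) powr (- real m / 2))"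
      unfolding q_def[symmetric]
    proof (cases "q < real m")
      case False
      have "norm h / sqrt t = 1 / sqrt q" using h by (simp add: tq real_sqrt_mult)
      also have "\<dots> = q powr (- 1 / 2)" using q by (simp add: powr_minus_divide powr_half_sqrt)
      finally have e: "(norm h / sqrt t) ^ m = q powr (- real m / 2)"
        using q by (simp add: powr_realpow[symmetric] powr_powr)
      have "real m * (norm h)\<^sup>2 \<le> t" using False by (simp add: tq mult_right_mono)
      from sdiff_pow_hconv_large[OF m t this, of x]
      have "\<bar>sdiff_pow m h (hconv t g) x\<bar> \<le> A * q powr (- real m / 2)" by (simp only: A_def e)
      also have "\<dots> \<le> (A + C1) * q powr (- real m / 2)" using C1 by (intro mult_right_mono) auto
      finally show "\<bar>sdiff_pow m h (hconv t g) x\<bar> \<le> (A + C1) * (if q < real m then q powr (- \<delta>) else q powr (- real m / 2))"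
        using False by simp
    next
      case True
      then obtain k where k: "1 \<le> 4 ^ k * (q / real m)" "real k \<le> K * (q / real m) powr (- \<delta>)"
        using K(2)[of "q / real m"] q m by auto
      let ?t = "4 ^ k * t"
      have t': "?t > 0" using t by simp
      have mt: "real m * (norm h)\<^sup>2 \<le> ?t"
      proof -
        have "real m \<le> 4 ^ k * q" using k(1) m by (simp add: field_simps)
        then have "real m * (norm h)\<^sup>2 \<le> (4 ^ k * q) * (norm h)\<^sup>2" by (rule mult_right_mono) simp
        then show ?thesis by (simp add: tq mult_ac)
      qed
      have "norm h / sqrt ?t \<le> 1"
      proof -
        have "1 * (norm h)\<^sup>2 \<le> real m * (norm h)\<^sup>2" using m by (intro mult_right_mono) auto
        then have "norm h \<le> sqrt ?t" using mt by (intro real_le_rsqrt) simp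
        then show ?thesis using t' by (simp add: divide_le_eq)
      qed
      then have "(norm h / sqrt ?t) ^ m \<le> 1" using t' by (intro power_le_one) auto
      then have "A * (norm h / sqrt ?t) ^ m \<le> A * 1" using A by (rule mult_left_mono)
      with sdiff_pow_hconv_large[OF m t' mt, of x]
      have 1: "\<bar>sdiff_pow m h (hconv ?t g) x\<bar> \<le> A" unfolding A_def by linarith
      have "\<bar>hconv t g z - hconv ?t g z\<bar> \<le> real k * step_bound" for z by (rule hconv_4_power[OF t])
      \<comment> \<open>Replacing \<open>t\<close> by \<open>4 ^ k * t\<close> changes the function
        by at most \<open>k\<close> steps, and an \<open>m\<close>-fold difference multiplies a sup
        bound by \<open>2 ^ m\<close>.\<close>
      from sdiff_pow_bounded[where w="\<lambda>z. hconv t g z - hconv ?t g z", OF this, of m h x]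
      have 2: "\<bar>sdiff_pow m h (hconv t g) x - sdiff_pow m h (hconv ?t g) x\<bar> \<le> 2 ^ m * (real k * step_bound)"
        unfolding sdiff_pow_diff .
      have qm: "(q / real m) powr (- \<delta>) = real m powr \<delta> * q powr (- \<delta>)"
        using q m by (simp add: powr_divide powr_minus_divide field_simps)
      have "1 \<le> (q / real m) powr (- \<delta>)"
        using True q m d ge_one_powr_ge_zero[of "real m / q" \<delta>]
        by (simp add: powr_minus_divide powr_divide)
      then have "A * 1 \<le> A * (q / real m) powr (- \<delta>)" using A by (rule mult_left_mono)
      moreover have "2 ^ m * (real k * step_bound) \<le> 2 ^ m * ((K * (q / real m) powr (- \<delta>)) * step_bound)"
        using k(2) step_bound_nonneg by (intro mult_left_mono mult_right_mono) auto
      ultimately have "\<bar>sdiff_pow m h (hconv t g) x\<bar> \<le> A * (q / real m) powr (- \<delta>) + 2 ^ m * ((K * (q / real m) powr (- \<delta>)) * step_bound)"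
        using 1 2 by linarith
      also have "\<dots> = C1 * q powr (- \<delta>)" unfolding qm C1_def by (simp add: algebra_simps)
      also have "\<dots> \<le> (A + C1) * q powr (- \<delta>)" using A by (intro mult_right_mono) auto
      finally show "\<bar>sdiff_pow m h (hconv t g) x\<bar> \<le> (A + C1) * (if q < real m then q powr (- \<delta>) else q powr (- real m / 2))"
        using True by simp
    qed
  qed (use A C1 in simp)
qed

end

section \<open>Bessel potentials of bmo functions lie in the Zygmund space\<close>

lemma Gamma_has_bochner_integral:
  fixes a c :: real
  assumes a: "a > 0" and c: "c > 0"
  shows "has_bochner_integral lborel (\<lambda>t. indicator {0<..} t * (t powr (a - 1) * exp (- (c * t)))) (Gamma a / c powr a)"
proof -
  have "has_bochner_integral lborel (\<lambda>t. indicator {0<..} t * (t powr (a - 1) * exp (- t))) (Gamma a)"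
  proof (rule has_bochner_integral_nn_integral)
    show "(\<integral>\<^sup>+t. ennreal (indicator {0<..} t * (t powr (a - 1) * exp (- t))) \<partial>lborel) = ennreal (Gamma a)"
      unfolding Gamma_conv_nn_integral_real[OF a]
      by (intro nn_integral_cong) (auto simp: indicator_def exp_minus field_simps)
  qed (use a in \<open>auto simp: indicator_def\<close>)
  then have "has_bochner_integral lborel (\<lambda>t. indicator {0<..} (0 + c * t) * ((0 + c * t) powr (a - 1) * exp (- (0 + c * t)))) (Gamma a /\<^sub>R \<bar>c\<bar>)"
    using c by (subst (asm) lborel_has_bochner_integral_real_affine_iff[of c _ _ 0]) auto
  then have "has_bochner_integral lborel (\<lambda>t. c powr (1 - a) * (indicator {0<..} (0 + c * t) * ((0 + c * t) powr (a - 1) * exp (- (0 + c * t))))) (c powr (1 - a) * (Gamma a /\<^sub>R \<bar>c\<bar>))"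
    by (rule has_bochner_integral_mult_right)
  moreover have "c powr (1 - a) * (Gamma a /\<^sub>R \<bar>c\<bar>) = Gamma a / c powr a"
    using c by (simp add: powr_diff)
  moreover have "c powr (1 - a) * (indicator {0<..} (0 + c * t) * ((0 + c * t) powr (a - 1) * exp (- (0 + c * t))))
     = indicator {0<..} t * (t powr (a - 1) * exp (- (c * t)))" for t
  proof (cases "t > 0")
    case True
    have "c powr (1 - a) * c powr (a - 1) = 1" using c by (simp add: powr_add[symmetric])
    then show ?thesis using True c by (simp add: powr_mult)
  next
    case False
    then show ?thesis using c by (simp add: zero_less_mult_iff indicator_def)
  qed
  ultimately show ?thesis by (simp only:)
qed

text \<open>For positive \<open>s\<close> this is the density of the Gamma law of shape
  \<open>s / 2\<close>, extended by zero so that all time integrals run over the whole line.\<close>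

definition bweight :: "real \<Rightarrow> real \<Rightarrow> real" where
  "bweight s t = indicator {0<..} t * (t powr (s / 2 - 1) * exp (- t)) / Gamma (s / 2)"

lemma bweight_nonneg [simp]: "s > 0 \<Longrightarrow> 0 \<le> bweight s t"
  by (simp add: bweight_def less_imp_le Gamma_real_pos)

lemma bweight_nonpos [simp]: "t \<le> 0 \<Longrightarrow> bweight s t = 0"
  by (simp add: bweight_def)

lemma bweight_measurable [measurable]: "bweight s \<in> borel_measurable borel"
  unfolding bweight_def by measurable

text \<open>The extra power only lowers the Gamma parameter to \<open>s / 2 - \<delta>\<close>,
  which is still positive.\<close>

lemma bweight_powr_integrable:
  assumes "s > 0" "\<delta> < s / 2"
  shows "integrable lborel (\<lambda>t. bweight s t * t powr (- \<delta>))"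
proof -
  have "integrable lborel (\<lambda>t. indicator {0<..} t * (t powr ((s / 2 - \<delta>) - 1) * exp (- (1 * t))) / Gamma (s / 2))"
    using Gamma_has_bochner_integral[of "s / 2 - \<delta>" 1] assms by (intro integrable_divide) (auto simp: has_bochner_integral_iff)
  also have "(\<lambda>t. indicator {0<..} t * (t powr ((s / 2 - \<delta>) - 1) * exp (- (1 * t))) / Gamma (s / 2)) = (\<lambda>t. bweight s t * t powr (- \<delta>))"
  proof
    fix t :: real
    have e: "(s / 2 - \<delta>) - 1 = (s / 2 - 1) + (- \<delta>)" by simp
    show "indicator {0<..} t * (t powr ((s / 2 - \<delta>) - 1) * exp (- (1 * t))) / Gamma (s / 2) = bweight s t * t powr (- \<delta>)"
      unfolding e powr_add bweight_def by (simp add: mult_ac)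
  qed
  finally show ?thesis .
qed

lemma bweight_integrable: "s > 0 \<Longrightarrow> integrable lborel (bweight s)"
proof -
  assume s: "s > 0"
  have "(\<lambda>t. bweight s t * t powr (- 0)) = bweight s" by (auto simp: bweight_def indicator_def)
  then show ?thesis using bweight_powr_integrable[of s 0] s by simp
qed

text \<open>Heat flow multiplies a cosine of frequency \<open>l\<close> by
  \<open>exp (- t * l^2)\<close>; averaging this factor produces the symbol of the Bessel
  potential.\<close>

lemma bweight_laplace:
  assumes s: "s > 0"
  shows "has_bochner_integral lborel (\<lambda>t. bweight s t * exp (- t * l\<^sup>2)) ((1 + l\<^sup>2) powr (- s / 2))"
proof -
  have c: "1 + l\<^sup>2 > 0" by (simp add: add_pos_nonneg)
  have "has_bochner_integral lborel (\<lambda>t. indicator {0<..} t * (t powr (s / 2 - 1) * exp (- ((1 + l\<^sup>2) * t))) / Gamma (s / 2))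
     (Gamma (s / 2) / (1 + l\<^sup>2) powr (s / 2) / Gamma (s / 2))"
    using s c by (intro has_bochner_integral_divide Gamma_has_bochner_integral) auto
  moreover have "Gamma (s / 2) / (1 + l\<^sup>2) powr (s / 2) / Gamma (s / 2) = (1 + l\<^sup>2) powr (- s / 2)"
  proof -
    have "Gamma (s / 2) > 0" using s by (intro Gamma_real_pos) simp
    then show ?thesis by (simp add: powr_minus_divide)
  qed
  moreover have "indicator {0<..} t * (t powr (s / 2 - 1) * exp (- ((1 + l\<^sup>2) * t))) / Gamma (s / 2) = bweight s t * exp (- t * l\<^sup>2)" for t
    by (simp add: bweight_def exp_add[symmetric] algebra_simps)
  ultimately show ?thesis by simp
qed

lemma bessel_kernel_eq: "bessel_kernel s x = (LINT t|lborel. bweight s t * heat t x)"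
  unfolding bessel_kernel_def set_lebesgue_integral_def integral_mult_right_zero[symmetric]
  by (intro Bochner_Integration.integral_cong) (auto simp: bweight_def heat_def)

text \<open>Fubini in time and space, with the power bound \<open>C\<close> making the absolute
  double integral finite. The last conclusion provides the dominating function for continuity in
  \<open>x\<close>.\<close>

lemma bessel_pot_eq:
  fixes g :: "'a::euclidean_space \<Rightarrow> real"
  assumes s: "s > 0" and d: "\<delta> < s / 2" and [measurable]: "g \<in> borel_measurable borel"
    and int: "\<And>t. t > 0 \<Longrightarrow> integrable lborel (\<lambda>y. heat t (x - y) * g y)"
    and C: "\<And>t. t > 0 \<Longrightarrow> (LINT y|lborel. heat t (x - y) * \<bar>g y\<bar>) \<le> C * (1 + t powr (- \<delta>))"
  shows "integrable lborel (\<lambda>t. bweight s t * hconv t g x)"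
    and "bessel_pot s g x = (LINT t|lborel. bweight s t * hconv t g x)"
    and "\<bar>bessel_pot s g x\<bar> \<le> (LINT t|lborel. bweight s t * (C * (1 + t powr (- \<delta>))))"
    and "integrable lborel (\<lambda>t. bweight s t * (C * (1 + t powr (- \<delta>))))"
proof -
  let ?f = "\<lambda>(t, y). bweight s t * heat t (x - y) * g y"
  show dom: "integrable lborel (\<lambda>t. bweight s t * (C * (1 + t powr (- \<delta>))))"
  proof -
    have "integrable lborel (\<lambda>t. C * bweight s t + C * (bweight s t * t powr (- \<delta>)))"
      using bweight_integrable[OF s] bweight_powr_integrable[OF s d] by simp
    then show ?thesis by (simp add: algebra_simps)
  qed
  have le: "bweight s t * (LINT y|lborel. heat t (x - y) * \<bar>g y\<bar>) \<le> bweight s t * (C * (1 + t powr (- \<delta>)))" for t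
    using C[of t] s by (cases "t > 0") (auto intro!: mult_left_mono)
  have nn: "0 \<le> (LINT y|lborel. heat t (x - y) * \<bar>g y\<bar>)" for t
    by (intro Bochner_Integration.integral_nonneg) simp
  have A: "integrable lborel (\<lambda>t. bweight s t * (LINT y|lborel. heat t (x - y) * \<bar>g y\<bar>))"
  proof (rule Bochner_Integration.integrable_bound[OF dom])
    show "AE t in lborel. norm (bweight s t * (LINT y|lborel. heat t (x - y) * \<bar>g y\<bar>)) \<le> norm (bweight s t * (C * (1 + t powr (- \<delta>))))"
    proof (intro AE_I2)
      fix t
      have "0 \<le> bweight s t * (LINT y|lborel. heat t (x - y) * \<bar>g y\<bar>)" using nn s by simp
      then show "norm (bweight s t * (LINT y|lborel. heat t (x - y) * \<bar>g y\<bar>)) \<le> norm (bweight s t * (C * (1 + t powr (- \<delta>))))"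
        using le[of t] unfolding real_norm_def by linarith
    qed
  qed measurable
  have i: "integrable (lborel \<Otimes>\<^sub>M lborel) ?f"
  proof (rule lborel_pair.Fubini_integrable)
    show "integrable lborel (\<lambda>t. LINT y|lborel. norm (?f (t, y)))"
      using A s by (simp add: abs_mult mult.assoc)
    show "AE t in lborel. integrable lborel (\<lambda>y. ?f (t, y))"
    proof (intro AE_I2)
      fix t show "integrable lborel (\<lambda>y. ?f (t, y))"
        using int[of t] by (cases "t > 0") (auto simp: mult.assoc)
    qed
  qed measurable
  have h: "(LINT y|lborel. ?f (t, y)) = bweight s t * hconv t g x" for t
    by (simp add: hconv_def mult.assoc)
  show "integrable lborel (\<lambda>t. bweight s t * hconv t g x)"
    using lborel_pair.integrable_fst'[OF i] unfolding h .
  have "bessel_pot s g x = (LINT y|lborel. (LINT t|lborel. ?f (t, y)))"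
    unfolding bessel_pot_def bessel_kernel_eq by simp
  also have "\<dots> = (LINT t|lborel. (LINT y|lborel. ?f (t, y)))"
    using lborel_pair.Fubini_integral[of "\<lambda>t y. ?f (t, y)"] i by simp
  finally show e: "bessel_pot s g x = (LINT t|lborel. bweight s t * hconv t g x)" unfolding h .
  have "\<bar>bessel_pot s g x\<bar> \<le> (LINT t|lborel. \<bar>bweight s t * hconv t g x\<bar>)"
    unfolding e by (rule integral_abs_bound)
  also have "\<dots> \<le> (LINT t|lborel. bweight s t * (C * (1 + t powr (- \<delta>))))"
  proof (intro integral_mono integrable_abs dom)
    show "integrable lborel (\<lambda>t. bweight s t * hconv t g x)" by fact
    fix t
    have "\<bar>hconv t g x\<bar> \<le> (LINT y|lborel. heat t (x - y) * \<bar>g y\<bar>)"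
      using integral_abs_bound[of lborel "\<lambda>y. heat t (x - y) * g y"] by (simp add: hconv_def abs_mult)
    then have "bweight s t * \<bar>hconv t g x\<bar> \<le> bweight s t * (LINT y|lborel. heat t (x - y) * \<bar>g y\<bar>)"
      using s by (intro mult_left_mono) auto
    then show "\<bar>bweight s t * hconv t g x\<bar> \<le> bweight s t * (C * (1 + t powr (- \<delta>)))"
      using le[of t] s by (simp add: abs_mult)
  qed
  finally show "\<bar>bessel_pot s g x\<bar> \<le> (LINT t|lborel. bweight s t * (C * (1 + t powr (- \<delta>))))" .
qed

lemma sdiff_pow_integral:
  assumes "\<And>x. integrable lborel (\<lambda>t. b t * F t x)"
  shows "integrable lborel (\<lambda>t. b t * sdiff_pow m h (F t) x)
     \<and> sdiff_pow m h (\<lambda>x. LINT t|lborel. b t * F t x) x = (LINT t|lborel. b t * sdiff_pow m h (F t) x)"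
proof (induction m arbitrary: x)
  case (Suc m)
  then show ?case by (simp add: sdiff_pow_Suc sdiff_def right_diff_distrib)
qed (use assms in simp)

text \<open>At 0 the exponent is \<open>s / 2 - 1 - \<delta> > -1\<close>, at infinity it is
  \<open>s / 2 - 1 - m / 2 < -1\<close>; the latter is where the order of the difference must exceed
  \<open>s\<close>.\<close>

lemma powr_pieces_integrable:
  fixes s \<delta> :: real
  assumes s: "\<delta> < s / 2" "s < real m" "m > 0"
  shows "integrable lborel (\<lambda>q. indicator {0<..} q * (q powr (s / 2 - 1) * (if q < real m then q powr (- \<delta>) else q powr (- real m / 2))))"
proof -
  \<comment> \<open>The integrals of powers are available as gauge integrals; nonnegativity turns
    them into Lebesgue integrability.\<close>
  have nn: "integrable lborel (\<lambda>x. indicator \<Omega> x * f x)"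
    if "(f has_integral I) \<Omega>" "\<And>x. 0 \<le> f x" "f \<in> borel_measurable borel" "\<Omega> \<in> sets borel" for f :: "real \<Rightarrow> real" and I \<Omega>
  proof (rule integrableI_nonneg)
    have "(\<integral>\<^sup>+x. ennreal (indicator \<Omega> x * f x) \<partial>lborel) = ennreal I"
      using nn_integral_has_integral_lebesgue[OF that(2,1)] by simp
    then show "(\<integral>\<^sup>+x. ennreal (indicator \<Omega> x * f x) \<partial>lborel) < \<infinity>" by simp
  qed (use that in auto)
  have 1: "integrable lborel (\<lambda>x. indicator {0..real m} x * x powr (s / 2 - 1 - \<delta>))"
    by (rule nn[OF has_integral_powr_from_0]) (use s in auto)
  have 2: "integrable lborel (\<lambda>x. indicator {real m..} x * x powr (s / 2 - 1 - real m / 2))"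
    by (rule nn[OF has_integral_powr_to_inf]) (use s in auto)
  show ?thesis
  proof (rule Bochner_Integration.integrable_bound[OF Bochner_Integration.integrable_add[OF 1 2]])
    show "AE q in lborel. norm (indicator {0<..} q * (q powr (s / 2 - 1) * (if q < real m then q powr (- \<delta>) else q powr (- real m / 2))))
       \<le> norm (indicator {0..real m} q * q powr (s / 2 - 1 - \<delta>) + indicator {real m..} q * q powr (s / 2 - 1 - real m / 2))"
      by (intro AE_I2) (auto simp: indicator_def powr_add[symmetric] abs_mult)
  qed measurable
qed

lemma LambdaI:
  assumes "continuous_on UNIV f" and B: "\<And>x. \<bar>f x\<bar> \<le> B"
    and C: "\<And>h x. 0 < norm h \<Longrightarrow> norm h \<le> 1 \<Longrightarrow> \<bar>sdiff_pow (nat \<lfloor>s\<rfloor> + 1) h f x\<bar> \<le> C * norm h powr s"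
  shows "f \<in> Lambda s" and "Lambda_norm s f \<le> B + C"
proof -
  have z: "v \<le> C" if "v \<in> zyg_quot s f" for v
    using that C by (auto simp: zyg_quot_def divide_le_eq)
  have "bounded (range f)" unfolding bounded_iff using B by auto
  then show "f \<in> Lambda s" using assms(1) z by (auto simp: Lambda_def bdd_above_def)
  obtain b :: 'a where "b \<in> Basis" using nonempty_Basis by blast
  then have "zyg_quot s f \<noteq> {}" unfolding zyg_quot_def by (auto intro!: exI[of _ b])
  then show "Lambda_norm s f \<le> B + C" unfolding Lambda_norm_def
    using B z by (intro add_mono cSUP_least cSup_least) auto
qed

context heat_tame
begin

lemma bessel_pot_in_Lambda:
  assumes s: "s > 0"
  shows "bessel_pot s g \<in> Lambda s"
proof -
  \<comment> \<open>Any \<open>\<delta>\<close> strictly between 0 and \<open>s / 2\<close> would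
    do.\<close>
  define \<delta> m where "\<delta> = s / 4" and "m = nat \<lfloor>s\<rfloor> + 1"
  have d: "\<delta> > 0" "\<delta> < s / 2" using s by (auto simp: \<delta>_def)
  have m: "m > 0" "s < real m" using s by (auto simp: m_def) linarith
  obtain C where C: "C \<ge> 0" "\<And>t x. t > 0 \<Longrightarrow> (LINT y|lborel. heat t (x - y) * \<bar>g y\<bar>) \<le> C * (1 + t powr (- \<delta>))"
    using abs_conv_power_bound[OF d(1)] by blast
  note bp = bessel_pot_eq[OF s d(2) meas heat_integrable(1) C(2)]
  have eq: "bessel_pot s g = (\<lambda>x. LINT t|lborel. bweight s t * hconv t g x)"
    using bp(2) by auto
  have cont: "continuous_on UNIV (bessel_pot s g)"
    unfolding continuous_on_sequentially
  proof (intro allI ballI impI)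
    fix X :: "nat \<Rightarrow> 'a" and a assume "(\<forall>n. X n \<in> UNIV) \<and> X \<longlonglongrightarrow> a"
    then have X: "X \<longlonglongrightarrow> a" by simp
    have "(\<lambda>n. LINT t|lborel. bweight s t * hconv t g (X n)) \<longlonglongrightarrow> (LINT t|lborel. bweight s t * hconv t g a)"
    proof (rule integral_dominated_convergence[OF borel_measurable_integrable[OF bp(1)] borel_measurable_integrable[OF bp(1)] bp(4)])
      show "AE t in lborel. (\<lambda>n. bweight s t * hconv t g (X n)) \<longlonglongrightarrow> bweight s t * hconv t g a"
      proof (intro AE_I2)
        fix t show "(\<lambda>n. bweight s t * hconv t g (X n)) \<longlonglongrightarrow> bweight s t * hconv t g a"
        proof (cases "t > 0")
          case True
          then show ?thesis
            using continuous_on_tendsto_compose[OF hconv_continuous[OF True] X] by (intro tendsto_mult) auto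
        qed simp
      qed
      show "AE t in lborel. norm (bweight s t * hconv t g (X n)) \<le> bweight s t * (C * (1 + t powr (- \<delta>)))" for n
      proof (intro AE_I2)
        fix t show "norm (bweight s t * hconv t g (X n)) \<le> bweight s t * (C * (1 + t powr (- \<delta>)))"
          using order_trans[OF hconv_abs_le C(2), of t "X n"] s
          by (cases "t > 0") (auto simp: abs_mult intro!: mult_left_mono)
      qed
    qed
    then show "(bessel_pot s g \<circ> X) \<longlonglongrightarrow> bessel_pot s g a" by (simp add: eq o_def)
  qed
  obtain D where D: "D \<ge> 0"
    "\<And>h t x. t > 0 \<Longrightarrow> h \<noteq> 0 \<Longrightarrow> \<bar>sdiff_pow m h (hconv t g) x\<bar> \<le>
       D * (if t / (norm h)\<^sup>2 < real m then (t / (norm h)\<^sup>2) powr (- \<delta>) else (t / (norm h)\<^sup>2) powr (- real m / 2))"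
    using sdiff_pow_hconv_all[OF m(1) d(1)] by blast
  \<comment> \<open>The time integrand as a function of \<open>t / (norm h)^2\<close>. Substitution
    then yields the factor \<open>norm h powr (s - 2)\<close> from the weight and
    \<open>(norm h)^2\<close> from the measure.\<close>
  define \<Phi> where "\<Phi> q = indicator {0<..} q * (q powr (s / 2 - 1) * (if q < real m then q powr (- \<delta>) else q powr (- real m / 2)))" for q
  have \<Phi>: "integrable lborel \<Phi>" unfolding \<Phi>_def by (rule powr_pieces_integrable[OF d(2) m(2,1)])
  define E where "E = D / Gamma (s / 2) * integral\<^sup>L lborel \<Phi>"
  have "\<bar>sdiff_pow m h (bessel_pot s g) x\<bar> \<le> E * norm h powr s" if h: "0 < norm h" for h x
  proof -
    let ?r = "norm h"
    have r2: "?r\<^sup>2 > 0" using h by simp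
    have sc: "has_bochner_integral lborel (\<lambda>t. \<Phi> (0 + (1 / ?r\<^sup>2) * t)) (integral\<^sup>L lborel \<Phi> /\<^sub>R \<bar>1 / ?r\<^sup>2\<bar>)"
      using \<Phi> r2 by (subst lborel_has_bochner_integral_real_affine_iff[of "1 / ?r\<^sup>2" _ _ 0, symmetric]) (auto simp: has_bochner_integral_iff)
    then have sc: "has_bochner_integral lborel (\<lambda>t. \<Phi> (t / ?r\<^sup>2)) (?r\<^sup>2 * integral\<^sup>L lborel \<Phi>)" by simp
    have pt: "\<bar>bweight s t * sdiff_pow m h (hconv t g) x\<bar> \<le> (D / Gamma (s / 2) * ?r powr (s - 2)) * \<Phi> (t / ?r\<^sup>2)" for t
    proof (cases "t > 0")
      case True
      let ?q = "t / ?r\<^sup>2"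
      let ?p = "if ?q < real m then ?q powr (- \<delta>) else ?q powr (- real m / 2)"
      have G: "Gamma (s / 2) > 0" using s by (simp add: Gamma_real_pos)
      have "\<bar>bweight s t * sdiff_pow m h (hconv t g) x\<bar> \<le> bweight s t * (D * ?p)"
        using D(2)[OF True, of h x] h s by (simp add: abs_mult mult_left_mono)
      \<comment> \<open>Dropping \<open>exp (- t) \<le> 1\<close> makes the integrand
        homogeneous.\<close>
      also have "\<dots> \<le> (t powr (s / 2 - 1) / Gamma (s / 2)) * (D * ?p)"
        using True D(1) G by (intro mult_right_mono) (auto simp: bweight_def divide_simps mult_left_le)
      also have "t powr (s / 2 - 1) = ?r powr (s - 2) * ?q powr (s / 2 - 1)"
      proof -
        have "?r powr (s - 2) = (?r powr 2) powr (s / 2 - 1)" unfolding powr_powr by (simp add: right_diff_distrib)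
        also have "\<dots> = (?r\<^sup>2) powr (s / 2 - 1)" using h by (simp add: powr_numeral)
        finally show ?thesis using True r2 by (simp add: powr_divide)
      qed
      finally show ?thesis using True r2 by (simp add: \<Phi>_def mult_ac)
    next
      case False
      then have "\<not> t / ?r\<^sup>2 > 0" using r2 by (simp add: zero_less_divide_iff)
      then show ?thesis using False by (simp add: \<Phi>_def)
    qed
    have "\<bar>sdiff_pow m h (bessel_pot s g) x\<bar> = \<bar>LINT t|lborel. bweight s t * sdiff_pow m h (hconv t g) x\<bar>"
      unfolding eq using sdiff_pow_integral[of "bweight s" "\<lambda>t. hconv t g" m h x] bp(1) by simp
    also have "\<dots> \<le> (LINT t|lborel. \<bar>bweight s t * sdiff_pow m h (hconv t g) x\<bar>)" by (rule integral_abs_bound)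
    also have "\<dots> \<le> (LINT t|lborel. (D / Gamma (s / 2) * ?r powr (s - 2)) * \<Phi> (t / ?r\<^sup>2))"
    proof (intro integral_mono pt integrable_abs integrable_mult_right)
      show "integrable lborel (\<lambda>t. bweight s t * sdiff_pow m h (hconv t g) x)"
        using sdiff_pow_integral[of "bweight s" "\<lambda>t. hconv t g" m h x] bp(1) by simp
      show "integrable lborel (\<lambda>t. \<Phi> (t / ?r\<^sup>2))" using sc by (simp add: has_bochner_integral_iff)
    qed
    also have "\<dots> = (D / Gamma (s / 2) * ?r powr (s - 2)) * (?r\<^sup>2 * integral\<^sup>L lborel \<Phi>)"
      using sc by (simp add: has_bochner_integral_iff)
    also have "\<dots> = E * ?r powr s"
    proof -
      have "?r powr (s - 2) * ?r\<^sup>2 = ?r powr (s - 2) * ?r powr 2" using h by (simp add: powr_numeral)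
      also have "\<dots> = ?r powr (s - 2 + 2)" by (rule powr_add[symmetric])
      finally have "?r powr (s - 2) * ?r\<^sup>2 = ?r powr s" by simp
      then show ?thesis by (simp add: E_def mult_ac)
    qed
    finally show ?thesis .
  qed
  then show ?thesis
    using cont bp(3) unfolding m_def by (intro LambdaI(1)) auto
qed

end

lemma bmo_heat_tame:
  fixes g :: "'a::euclidean_space \<Rightarrow> real"
  assumes "g \<in> bmo"
  obtains N M where "heat_tame g N M"
proof -
  obtain N where N: "N \<ge> 0" "\<And>x t. t \<ge> 1 \<Longrightarrow> integrable lborel (\<lambda>y. heat t (x - y) * (g y)\<^sup>2)"
    "\<And>x t. t \<ge> 1 \<Longrightarrow> (LINT y|lborel. heat t (x - y) * (g y)\<^sup>2) \<le> N"
    using bmo_heat_sq_bound[OF assms] by blast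
  obtain M where M: "M \<ge> 0"
    "\<And>x t. t > 0 \<Longrightarrow> \<exists>c. integrable lborel (\<lambda>y. heat (4 * t) (x - y) * \<bar>g y - c\<bar>)
       \<and> (LINT y|lborel. heat (4 * t) (x - y) * \<bar>g y - c\<bar>) \<le> M"
    using bmo_heat_osc_bound[OF assms] by blast
  have "g \<in> borel_measurable borel" using assms by (simp add: bmo_def)
  with N M show thesis by (intro that[of N M]) (unfold_locales, auto)
qed

lemma J_bmo_subset_Lambda:
  assumes "s > 0"
  shows "J_bmo s \<subseteq> Lambda s"
proof
  fix f assume "f \<in> J_bmo s"
  then obtain g where g: "g \<in> bmo" "f = bessel_pot s g" by (auto simp: J_bmo_def)
  obtain N M where "heat_tame g N M" using bmo_heat_tame[OF g(1)] by blast
  then show "f \<in> Lambda s" using heat_tame.bessel_pot_in_Lambda[OF _ assms] g(2) by blast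
qed

section \<open>Trigonometric and lacunary series\<close>

lemma set_integral_bounded:
  fixes f :: "'a::euclidean_space \<Rightarrow> real"
  assumes [measurable]: "f \<in> borel_measurable borel" "A \<in> sets borel" and A: "emeasure lborel A < \<infinity>" and c: "\<And>x. \<bar>f x\<bar> \<le> c"
  shows "set_integrable lborel A f" and "\<bar>LINT x:A|lborel. f x\<bar> \<le> c * measure lborel A"
proof -
  have ic: "integrable lborel (\<lambda>x. c * indicator A x)" "(LINT x|lborel. c * indicator A x) = c * measure lborel A"
    using A by auto
  have le: "\<bar>indicator A x *\<^sub>R f x\<bar> \<le> c * indicator A x" for x using c[of x] by (auto simp: indicator_def)
  have c0: "c \<ge> 0" using c[of 0] by linarith
  show i: "set_integrable lborel A f"
    unfolding set_integrable_def
    by (rule Bochner_Integration.integrable_bound[OF ic(1)]) (use le c0 in \<open>auto simp: abs_mult\<close>)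
  have "\<bar>LINT x:A|lborel. f x\<bar> \<le> (LINT x|lborel. \<bar>indicator A x *\<^sub>R f x\<bar>)"
    unfolding set_lebesgue_integral_def by (rule integral_abs_bound)
  also have "\<dots> \<le> (LINT x|lborel. c * indicator A x)"
    by (intro integral_mono integrable_abs ic le i[unfolded set_integrable_def])
  finally show "\<bar>LINT x:A|lborel. f x\<bar> \<le> c * measure lborel A" using ic by simp
qed

lemma bounded_continuous_bmo:
  fixes g :: "'a::euclidean_space \<Rightarrow> real"
  assumes cont: "continuous_on UNIV g" and B: "\<And>x. \<bar>g x\<bar> \<le> B"
  shows "g \<in> bmo"
proof -
  have m [measurable]: "g \<in> borel_measurable borel" using cont by (rule borel_measurable_continuous_onI)
  have B0: "B \<ge> 0" using B[of 0] by linarith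
  have comp: "set_integrable lborel K g" if "compact K" for K
    using set_integral_bounded(1)[OF m _ emeasure_compact_finite[OF that] B] borel_closed[OF compact_imp_closed[OF that]] by simp
  have osc: "mean_osc g (ball x r) \<le> 2 * B" if r: "r > 0" for x r
  proof -
    have b: "ball x r \<in> sets borel" "emeasure lborel (ball x r) < \<infinity>" "measure lborel (ball x r) > 0"
      using emeasure_lborel_ball_finite measure_ball_pos[OF r, of x] by auto
    have "\<bar>ball_avg g (ball x r)\<bar> \<le> B"
      using set_integral_bounded(2)[OF m b(1,2) B] b(3) by (simp add: ball_avg_def abs_div divide_le_eq)
    then have "\<bar>\<bar>g y - ball_avg g (ball x r)\<bar>\<bar> \<le> 2 * B" for y using B[of y] by linarith
    from set_integral_bounded(2)[where f="\<lambda>y. \<bar>g y - ball_avg g (ball x r)\<bar>", OF _ b(1,2) this] b(3)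
    show ?thesis by (simp add: mean_osc_def divide_le_eq)
  qed
  have sq: "\<bar>(g x)\<^sup>2\<bar> \<le> B\<^sup>2" for x using B[of x] by (simp add: abs_le_square_iff[symmetric])
  have c: "emeasure lborel (unit_cube k) < \<infinity>" "measure lborel (unit_cube k) = 1" for k :: 'a
    using emeasure_unit_cube[of k] by (auto simp: measure_def)
  have s1: "set_integrable lborel (unit_cube k) (\<lambda>x. (g x)\<^sup>2)" for k
    by (rule set_integral_bounded(1)[OF _ _ c(1) sq]) auto
  have s2: "sqrt (LINT x:unit_cube k|lborel. (g x)\<^sup>2) \<le> B" for k
  proof -
    have "\<bar>LINT x:unit_cube k|lborel. (g x)\<^sup>2\<bar> \<le> B\<^sup>2 * measure lborel (unit_cube k)"
      by (rule set_integral_bounded(2)[OF _ _ c(1) sq]) auto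
    then have "sqrt (LINT x:unit_cube k|lborel. (g x)\<^sup>2) \<le> sqrt (B\<^sup>2)" unfolding c(2) by (intro real_sqrt_le_mono) simp
    then show ?thesis using B0 by simp
  qed
  have "bdd_above {mean_osc g (ball x r) | x r. r > 0}"
    using osc by (intro bdd_aboveI[of _ "2 * B"]) auto
  moreover have "bdd_above {sqrt (LINT x:unit_cube k|lborel. (g x)\<^sup>2) | k. k \<in> int_lattice}"
    using s2 by (intro bdd_aboveI[of _ B]) auto
  ultimately show ?thesis using m comp s1 by (simp add: bmo_def)
qed

lemma hconv_cos:
  fixes b x :: "'a::euclidean_space"
  assumes t: "t > 0" and b: "b \<in> Basis"
  shows "hconv t (\<lambda>y. cos (l * (y \<bullet> b) + th)) x = exp (- t * l\<^sup>2) * cos (l * (x \<bullet> b) + th)"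
proof -
  have "hconv t (\<lambda>y. cos (l * (y \<bullet> b) + th)) x = (LINT y|lborel. heat t (x - (x - y)) * cos (l * ((x - y) \<bullet> b) + th))"
    unfolding hconv_def by (rule lborel_integral_minus[symmetric]) measurable
  also have "\<dots> = (LINT y|lborel. heat t y * cos (- l * (y \<bullet> b) + (l * (x \<bullet> b) + th)))"
    by (intro Bochner_Integration.integral_cong) (auto simp: algebra_simps)
  also have "\<dots> = exp (- t * l\<^sup>2) * cos (l * (x \<bullet> b) + th)"
    using heat_cos_integral[OF t b, of "- l" "l * (x \<bullet> b) + th"] by (simp add: has_bochner_integral_iff)
  finally show ?thesis .
qed

lemma bessel_kernel_measurable [measurable]: "(bessel_kernel s :: 'a::euclidean_space \<Rightarrow> real) \<in> borel_measurable borel"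
  unfolding bessel_kernel_eq by measurable

lemma bessel_kernel_nonneg [simp]: "s > 0 \<Longrightarrow> 0 \<le> bessel_kernel s x"
  unfolding bessel_kernel_eq by (intro Bochner_Integration.integral_nonneg) simp

lemma bessel_kernel_integrable:
  assumes s: "s > 0"
  shows "integrable lborel (bessel_kernel s :: 'a::euclidean_space \<Rightarrow> real)"
proof -
  have "integrable (lborel \<Otimes>\<^sub>M lborel) (\<lambda>(t, z::'a). bweight s t * heat t z)"
  proof (rule lborel_pair.Fubini_integrable)
    have "(LINT z|lborel. norm (bweight s t * heat t (z::'a))) = bweight s t" for t
      using heat_has_integral[of t, where 'a='a] s by (cases "t > 0") (auto simp: abs_mult has_bochner_integral_iff)
    then show "integrable lborel (\<lambda>t. LINT z|lborel. norm ((\<lambda>(t, z::'a). bweight s t * heat t z) (t, z)))"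
      using bweight_integrable[OF s] by simp
    show "AE t in lborel. integrable lborel (\<lambda>z. (\<lambda>(t, z::'a). bweight s t * heat t z) (t, z))"
    proof (intro AE_I2)
      fix t show "integrable lborel (\<lambda>z. (\<lambda>(t, z::'a). bweight s t * heat t z) (t, z))"
        using heat_has_integral[of t, where 'a='a] by (cases "t > 0") (auto simp: has_bochner_integral_iff)
    qed
  qed measurable
  from lborel_pair.integrable_snd[OF this] show ?thesis unfolding bessel_kernel_eq .
qed

lemma bessel_pot_cos:
  fixes b x :: "'a::euclidean_space"
  assumes s: "s > 0" and b: "b \<in> Basis"
  shows "bessel_pot s (\<lambda>y. cos (l * (y \<bullet> b) + th)) x = (1 + l\<^sup>2) powr (- s / 2) * cos (l * (x \<bullet> b) + th)"
proof -
  let ?g = "\<lambda>y::'a. cos (l * (y \<bullet> b) + th)"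
  have gm: "?g \<in> borel_measurable borel" by measurable
  have gB: "\<bar>?g y\<bar> \<le> 1" for y by simp
  \<comment> \<open>A bounded function admits the exponent \<open>\<delta> = 0\<close> in the power
    bound.\<close>
  have "(LINT y|lborel. heat t (x - y) * \<bar>?g y\<bar>) \<le> 1 * (1 + t powr (- 0))" if "t > 0" for t
    using hconv_bounded[OF that, of "\<lambda>y. \<bar>?g y\<bar>" 1 x] that unfolding hconv_def by simp
  from bessel_pot_eq(2)[OF s _ gm heat_bounded_integrable[OF _ gm gB] this] s
  have "bessel_pot s ?g x = (LINT t|lborel. bweight s t * hconv t ?g x)" by simp
  also have "\<dots> = (LINT t|lborel. (bweight s t * exp (- t * l\<^sup>2)) * cos (l * (x \<bullet> b) + th))"
  proof (intro Bochner_Integration.integral_cong refl)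
    fix t show "bweight s t * hconv t ?g x = (bweight s t * exp (- t * l\<^sup>2)) * cos (l * (x \<bullet> b) + th)"
      using hconv_cos[OF _ b, of t l th x] by (cases "t > 0") auto
  qed
  also have "\<dots> = (1 + l\<^sup>2) powr (- s / 2) * cos (l * (x \<bullet> b) + th)"
    using bweight_laplace[OF s, of l] by (simp add: has_bochner_integral_iff)
  finally show ?thesis .
qed

text \<open>Dividing each coefficient by the symbol inverts the potential. The density obtained is a
  finite sum of cosines, hence bounded; its bound depends on \<open>K\<close>, so this handles
  truncations of a lacunary series.\<close>

lemma trig_sum_in_J_bmo:
  fixes b :: "'a::euclidean_space"
  assumes s: "s > 0" and b: "b \<in> Basis"
  shows "(\<lambda>x. \<Sum>k<K. c k * cos (l k * (x \<bullet> b))) \<in> J_bmo s"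
proof -
  define d where "d k = c k * (1 + (l k)\<^sup>2) powr (s / 2)" for k
  define g where "g x = (\<Sum>k<K. d k * cos (l k * (x \<bullet> b)))" for x :: 'a
  have "bessel_pot s g x = (\<Sum>k<K. c k * cos (l k * (x \<bullet> b)))" for x
  proof -
    have ik: "integrable lborel (\<lambda>y. bessel_kernel s (x - y))"
      using bessel_kernel_integrable[OF s] by (simp add: lborel_integrable_minus)
    have i: "integrable lborel (\<lambda>y. bessel_kernel s (x - y) * cos (l k * (y \<bullet> b)))" for k
      by (rule Bochner_Integration.integrable_bound[OF ik]) (auto simp: abs_mult mult_left_le)
    have "bessel_pot s g x = (LINT y|lborel. (\<Sum>k<K. d k * (bessel_kernel s (x - y) * cos (l k * (y \<bullet> b)))))"
      unfolding bessel_pot_def g_def by (simp add: sum_distrib_left mult_ac)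
    also have "\<dots> = (\<Sum>k<K. d k * bessel_pot s (\<lambda>y. cos (l k * (y \<bullet> b) + 0)) x)"
      using i unfolding bessel_pot_def by (subst Bochner_Integration.integral_sum) auto
    also have "\<dots> = (\<Sum>k<K. c k * cos (l k * (x \<bullet> b)))"
    proof (intro sum.cong refl)
      fix k
      have "1 + (l k)\<^sup>2 > 0" by (simp add: add_pos_nonneg)
      then have "(1 + (l k)\<^sup>2) powr (s / 2) * (1 + (l k)\<^sup>2) powr (- s / 2) = 1"
        by (simp add: powr_add[symmetric])
      then show "d k * bessel_pot s (\<lambda>y. cos (l k * (y \<bullet> b) + 0)) x = c k * cos (l k * (x \<bullet> b))"
        unfolding d_def bessel_pot_cos[OF s b] by (simp add: mult_ac)
    qed
    finally show ?thesis .
  qed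
  then have "(\<lambda>x. \<Sum>k<K. c k * cos (l k * (x \<bullet> b))) = bessel_pot s g" by auto
  moreover have "g \<in> bmo"
  proof (rule bounded_continuous_bmo)
    show "continuous_on UNIV g" unfolding g_def by (intro continuous_intros)
    show "\<bar>g x\<bar> \<le> (\<Sum>k<K. \<bar>d k\<bar>)" for x
      unfolding g_def by (rule order_trans[OF sum_abs]) (auto intro!: sum_mono simp: abs_mult mult_left_le)
  qed
  ultimately show ?thesis by (simp add: J_bmo_def)
qed

text \<open>Starting at 4, which exceeds \<open>pi\<close>, keeps the step
  \<open>pi / freq k\<close> in the range \<open>norm h \<le> 1\<close> of the Zygmund quotient.
  Doubling makes the relevant sums geometric and keeps distinct frequencies at least 1
  apart.\<close>

definition freq :: "nat \<Rightarrow> real" where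
  "freq k = 2 ^ (k + 2)"

lemma freq_pos [simp]: "freq k > 0"
  by (simp add: freq_def)

lemma freq_ge_1: "1 \<le> freq k"
  unfolding freq_def by (rule one_le_power) simp

lemma freq_powr_add: "freq (j + i) powr e = freq j powr e * (2 powr e) ^ i"
proof -
  have "freq (j + i) = freq j * 2 powr real i" by (simp add: freq_def power_add powr_realpow)
  then have "freq (j + i) powr e = freq j powr e * (2 powr real i) powr e" by (simp add: powr_mult)
  also have "(2 powr real i) powr e = (2 powr e) powr real i" unfolding powr_powr by (simp add: mult.commute)
  finally show ?thesis by (simp add: powr_realpow)
qed

lemma freq_summable: "s > 0 \<Longrightarrow> summable (\<lambda>k. freq k powr (- s))"
proof -
  assume "s > 0"
  then have "summable (\<lambda>k. freq 0 powr (- s) * (2 powr (- s)) ^ k)"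
    by (intro summable_mult summable_geometric) (simp add: powr_less_one)
  moreover have "(\<lambda>k. freq k powr (- s)) = (\<lambda>k. freq 0 powr (- s) * (2 powr (- s)) ^ k)"
    by (rule ext) (rule freq_powr_add[of 0 _ "- s", unfolded add_0])
  ultimately show ?thesis by (rule ssubst[rotated])
qed

text \<open>Split at the first frequency with \<open>freq j * r \<ge> 1\<close>. Below it the terms
  grow geometrically like \<open>freq k powr (m - s)\<close>, so the last ones dominate; above it
  they decay like \<open>freq k powr (- s)\<close>. Both sides are comparable to
  \<open>r powr s\<close>, with a constant independent of \<open>r\<close> and
  \<open>F\<close>.\<close>

lemma freq_threshold_sum:
  fixes s :: real
  assumes s: "s > 0" "s < real m"
  obtains C where "\<And>r F. 0 < r \<Longrightarrow> r \<le> 1 \<Longrightarrow> (\<And>k. 0 \<le> F k) \<Longrightarrow>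
    (\<And>k. F k \<le> freq k powr (- s) * 2 ^ m) \<Longrightarrow> (\<And>k. F k \<le> freq k powr (- s) * (freq k * r) ^ m) \<Longrightarrow>
    suminf F \<le> C * r powr s"
proof -
  define e where "e = real m - s"
  define x y where "x = 2 powr (- e)" and "y = 2 powr (- s)"
  have e: "e > 0" using s by (simp add: e_def)
  have x: "0 < x" "x < 1" and y: "0 < y" "y < 1" using e s by (auto simp: x_def y_def powr_less_one)
  define C where "C = 2 powr e / (1 - x) + 2 ^ m / (1 - y)"
  show thesis
  proof (rule that[of C])
    fix r :: real and F :: "nat \<Rightarrow> real"
    assume r: "0 < r" "r \<le> 1" and F0: "\<And>k. 0 \<le> F k"
      and U: "\<And>k. F k \<le> freq k powr (- s) * 2 ^ m" and V: "\<And>k. F k \<le> freq k powr (- s) * (freq k * r) ^ m"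
    have sF: "summable F"
    proof (rule summable_comparison_test')
      show "summable (\<lambda>k. freq k powr (- s) * 2 ^ m)" using freq_summable[OF s(1)] by (rule summable_mult2)
      show "norm (F k) \<le> freq k powr (- s) * 2 ^ m" for k using U[of k] F0[of k] by simp
    qed
    define P where "P j \<longleftrightarrow> 1 \<le> freq j * r" for j
    define j where "j = (LEAST j. P j)"
    have "\<exists>j. P j"
    proof -
      obtain i where "1 / r < 2 ^ i" using real_arch_pow[of 2 "1 / r"] by auto
      also have "(2::real) ^ i \<le> freq i" by (simp add: freq_def power_add)
      finally show ?thesis using r by (intro exI[of _ i]) (simp add: P_def field_simps)
    qed
    then have Pj: "P j" unfolding j_def by (rule LeastI_ex)
    \<comment> \<open>The premise only says that \<open>j\<close> is positive. Then
      \<open>j - 1\<close> fails the threshold, and one doubling gives the factor 2.\<close>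
    have below: "freq j * r \<le> 2" if "k < j" for k
    proof -
      have "\<not> P (j - 1)" using that unfolding j_def by (intro not_less_Least) auto
      moreover have "freq j = 2 * freq (j - 1)" using that by (cases j) (auto simp: freq_def)
      ultimately show ?thesis by (simp add: P_def)
    qed
    have rs: "freq k powr (- s) * (freq k * r) ^ m = (freq k powr e) * r powr real m" for k
      using r by (simp add: power_mult_distrib powr_realpow[symmetric] e_def powr_add[symmetric] mult_ac)
    have low: "(\<Sum>k<j. F k) \<le> (2 powr e / (1 - x)) * r powr s"
    proof (cases "j = 0")
      case False
      \<comment> \<open>Read downwards from the threshold frequency, the sum has ratio
        \<open>x < 1\<close>; the separate factor \<open>x\<close> accounts for the last index being
        \<open>j - 1\<close>.\<close>
      have "(\<Sum>k<j. F k) \<le> (\<Sum>k<j. (freq j powr e * r powr real m * x) * x ^ (j - Suc k))"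
      proof (rule sum_mono)
        fix k assume "k \<in> {..<j}"
        then obtain i where i: "j = k + Suc i" by (auto dest: less_imp_Suc_add)
        have "x * 2 powr e = 1" by (simp add: x_def powr_add[symmetric])
        then have 1: "(2 powr e) ^ Suc i * x ^ Suc i = 1"
          unfolding power_mult_distrib[symmetric] by (simp add: mult.commute)
        have "freq j powr e * x ^ Suc i = freq k powr e * ((2 powr e) ^ Suc i * x ^ Suc i)"
          unfolding i freq_powr_add by (rule mult.assoc)
        then have "freq k powr e = freq j powr e * x ^ Suc (j - Suc k)"
          unfolding 1 by (simp add: i)
        then show "F k \<le> (freq j powr e * r powr real m * x) * x ^ (j - Suc k)"
          using V[of k] unfolding rs by (simp add: mult_ac)
      qed
      also have "\<dots> = (freq j powr e * r powr real m * x) * (\<Sum>k<j. x ^ k)"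
        unfolding sum_distrib_left[symmetric] by (simp add: sum.nat_diff_reindex)
      also have "\<dots> \<le> (freq j powr e * r powr real m * 1) * (1 / (1 - x))"
      proof (intro mult_mono)
        show "(\<Sum>k<j. x ^ k) \<le> 1 / (1 - x)"
          using x sum_le_suminf[of "\<lambda>k. x ^ k" "{..<j}"] by (simp add: suminf_geometric summable_geometric)
      qed (use x in \<open>auto intro!: sum_nonneg\<close>)
      also have "freq j powr e * r powr real m * 1 \<le> 2 powr e * r powr s"
      proof -
        have "r powr real m = r powr e * r powr s" by (simp add: e_def powr_add[symmetric])
        then have "freq j powr e * r powr real m * 1 = (freq j * r) powr e * r powr s" using r by (simp add: powr_mult)
        also have "\<dots> \<le> 2 powr e * r powr s"
          using below[of "j - 1"] False e r by (intro mult_right_mono powr_mono2) (auto simp: less_imp_le)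
        finally show ?thesis .
      qed
      finally show ?thesis using x by (simp add: divide_right_mono)
    qed (use x r in simp)
    have high: "(\<Sum>k. F (k + j)) \<le> (2 ^ m / (1 - y)) * r powr s"
    proof -
      have g: "summable (\<lambda>k. (freq j powr (- s) * 2 ^ m) * y ^ k)" using y by (intro summable_mult summable_geometric) auto
      have "(\<Sum>k. F (k + j)) \<le> (\<Sum>k. (freq j powr (- s) * 2 ^ m) * y ^ k)"
      proof (rule suminf_le[OF _ summable_ignore_initial_segment[OF sF] g])
        show "F (k + j) \<le> (freq j powr (- s) * 2 ^ m) * y ^ k" for k
          using U[of "k + j"] freq_powr_add[of j k "- s"] by (simp add: y_def add.commute mult_ac)
      qed
      also have "\<dots> = (freq j powr (- s) * 2 ^ m) * (1 / (1 - y))"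
        using y by (simp add: suminf_mult summable_geometric suminf_geometric)
      also have "freq j powr (- s) \<le> r powr s"
      proof -
        have "freq j powr (- s) = (freq j * r) powr (- s) * r powr s"
          using r by (simp add: powr_mult powr_add[symmetric])
        also have "\<dots> \<le> 1 * r powr s"
          using Pj s powr_mono2'[of "- s" 1 "freq j * r"] by (intro mult_right_mono) (auto simp: P_def)
        finally show ?thesis by simp
      qed
      finally show ?thesis using y by (simp add: mult_ac divide_right_mono)
    qed
    show "suminf F \<le> C * r powr s"
      using suminf_split_initial_segment[OF sF, of j] low high by (simp add: C_def distrib_right)
  qed
qed

section \<open>Differences and norms of lacunary series\<close>

lemma sdiff_cos:
  "sdiff h (\<lambda>x. cos (l * (x \<bullet> b) + th)) = (\<lambda>x. 2 * sin (l * (h \<bullet> b) / 2) * cos (l * (x \<bullet> b) + (th + pi / 2)))"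
proof
  fix x
  define u v where "u = l * (x \<bullet> b) + th" and "v = l * (h \<bullet> b) / 2"
  have "sdiff h (\<lambda>x. cos (l * (x \<bullet> b) + th)) x = cos (u + v) - cos (u - v)"
    by (simp add: sdiff_def u_def v_def inner_add_left inner_diff_left algebra_simps)
  also have "\<dots> = 2 * sin v * cos (u + pi / 2)"
    by (simp add: cos_add cos_diff)
  finally show "sdiff h (\<lambda>x. cos (l * (x \<bullet> b) + th)) x = 2 * sin (l * (h \<bullet> b) / 2) * cos (l * (x \<bullet> b) + (th + pi / 2))"
    by (simp add: u_def v_def add.assoc)
qed

text \<open>Expressing the sine as a phase shift by \<open>pi / 2\<close> keeps every difference
  within the same family of cosines, so the induction closes.\<close>

lemma sdiff_pow_cos:
  "sdiff_pow m h (\<lambda>x. cos (l * (x \<bullet> b) + th)) x = (2 * sin (l * (h \<bullet> b) / 2)) ^ m * cos (l * (x \<bullet> b) + (th + real m * pi / 2))"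
proof (induction m arbitrary: th x)
  case (Suc m)
  show ?case
    unfolding sdiff_pow_Suc2 sdiff_cos sdiff_pow_cmult Suc.IH by (simp add: algebra_simps add_divide_distrib)
qed simp

lemma sdiff_pow_suminf:
  assumes "\<And>x. summable (\<lambda>k. F k x)"
  shows "summable (\<lambda>k. sdiff_pow m h (F k) x) \<and> sdiff_pow m h (\<lambda>x. \<Sum>k. F k x) x = (\<Sum>k. sdiff_pow m h (F k) x :: real)"
proof (induction m arbitrary: x)
  case (Suc m)
  then show ?case by (simp add: sdiff_pow_Suc sdiff_def summable_diff suminf_diff)
qed (use assms in simp)

definition lac :: "'a::euclidean_space \<Rightarrow> real \<Rightarrow> (nat \<Rightarrow> real) \<Rightarrow> 'a \<Rightarrow> real" where
  "lac b s a x = (\<Sum>k. a k * freq k powr (- s) * cos (freq k * (x \<bullet> b)))"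

lemma lac_summable:
  fixes A :: real
  assumes s: "s > 0" and a: "\<And>k. \<bar>a k\<bar> \<le> A"
  shows "summable (\<lambda>k. A * freq k powr (- s))"
    and "\<bar>a k * freq k powr (- s) * cos v\<bar> \<le> A * freq k powr (- s)"
    and "summable (\<lambda>k. a k * freq k powr (- s) * cos (freq k * (x \<bullet> b)))"
proof -
  show 1: "summable (\<lambda>k. A * freq k powr (- s))" using freq_summable[OF s] by (rule summable_mult)
  show 2: "\<bar>a k * freq k powr (- s) * cos v\<bar> \<le> A * freq k powr (- s)" for k v
  proof -
    have "\<bar>a k\<bar> * freq k powr (- s) * \<bar>cos v\<bar> \<le> A * freq k powr (- s) * 1"
      using a[of k] by (intro mult_mono) auto
    then show ?thesis by (simp add: abs_mult)
  qed
  show "summable (\<lambda>k. a k * freq k powr (- s) * cos (freq k * (x \<bullet> b)))"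
    by (rule summable_comparison_test'[OF 1]) (use 2 in auto)
qed

lemma lac_continuous:
  assumes s: "s > 0" and a: "\<And>k. \<bar>a k\<bar> \<le> A"
  shows "continuous_on UNIV (lac b s a)"
proof -
  have "uniform_limit UNIV (\<lambda>n x. \<Sum>k<n. a k * freq k powr (- s) * cos (freq k * (x \<bullet> b))) (\<lambda>x. \<Sum>k. a k * freq k powr (- s) * cos (freq k * (x \<bullet> b))) sequentially"
    using lac_summable(2)[where a=a, OF s a] by (intro Weierstrass_m_test[OF _ lac_summable(1)[where a=a, OF s a]]) auto
  then show ?thesis unfolding lac_def
    by (rule uniform_limit_theorem[rotated]) (auto intro!: always_eventually continuous_intros)
qed

text \<open>The difference of each cosine is bounded both by \<open>2 ^ m\<close> and by
  \<open>(freq k * norm h) ^ m\<close>, the two hypotheses of the threshold sum. Since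
  \<open>C\<close> does not depend on \<open>a\<close>, a series with uniformly small coefficients
  has small norm.\<close>

lemma lac_Lambda:
  fixes b :: "'a::euclidean_space"
  assumes s: "s > 0" and b: "b \<in> Basis"
  obtains C where "\<And>a A. (\<And>k. \<bar>a k\<bar> \<le> A) \<Longrightarrow> lac b s a \<in> Lambda s \<and> Lambda_norm s (lac b s a) \<le> C * A"
proof -
  define m where "m = nat \<lfloor>s\<rfloor> + 1"
  have m: "s < real m" using s by (simp add: m_def) linarith
  obtain C2 where C2: "\<And>r F. 0 < r \<Longrightarrow> r \<le> 1 \<Longrightarrow> (\<And>k. 0 \<le> F k) \<Longrightarrow>
    (\<And>k. F k \<le> freq k powr (- s) * 2 ^ m) \<Longrightarrow> (\<And>k. F k \<le> freq k powr (- s) * (freq k * r) ^ m) \<Longrightarrow>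
    suminf F \<le> C2 * r powr s"
    using freq_threshold_sum[OF s m] by blast
  define C1 where "C1 = (\<Sum>k. freq k powr (- s))"
  show thesis
  proof (rule that[of "C1 + C2"])
    fix a :: "nat \<Rightarrow> real" and A assume a: "\<And>k. \<bar>a k\<bar> \<le> A"
    have A0: "A \<ge> 0" using a[of 0] by linarith
    note sm = lac_summable[where a=a, OF s a]
    have bd: "\<bar>lac b s a x\<bar> \<le> C1 * A" for x
    proof -
      have "norm (lac b s a x) \<le> (\<Sum>k. A * freq k powr (- s))"
        unfolding lac_def using sm(2) by (intro norm_suminf_le sm(1)) auto
      also have "\<dots> = C1 * A" unfolding C1_def by (subst suminf_mult[OF freq_summable[OF s]]) simp
      finally show ?thesis by simp
    qed
    have df: "\<bar>sdiff_pow m h (lac b s a) x\<bar> \<le> (C2 * A) * norm h powr s" if h: "0 < norm h" "norm h \<le> 1" for h x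
    proof -
      define F where "F k = freq k powr (- s) * \<bar>2 * sin (freq k * (h \<bullet> b) / 2)\<bar> ^ m" for k
      have s2: "\<bar>2 * sin (freq k * (h \<bullet> b) / 2)\<bar> \<le> 2" for k
        using abs_sin_le_one[of "freq k * (h \<bullet> b) / 2"] by (simp add: abs_mult)
      have s3: "\<bar>2 * sin (freq k * (h \<bullet> b) / 2)\<bar> \<le> freq k * norm h" for k
      proof -
        have "\<bar>2 * sin (freq k * (h \<bullet> b) / 2)\<bar> \<le> 2 * \<bar>freq k * (h \<bullet> b) / 2\<bar>"
          using abs_sin_x_le_abs_x[of "freq k * (h \<bullet> b) / 2"] by (simp add: abs_mult)
        also have "\<dots> = freq k * \<bar>h \<bullet> b\<bar>" by (simp add: abs_mult abs_of_pos[OF freq_pos])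
        also have "\<dots> \<le> freq k * norm h" using Basis_le_norm[OF b, of h] by (intro mult_left_mono) (auto simp: less_imp_le)
        finally show ?thesis .
      qed
      have F: "0 \<le> F k" "F k \<le> freq k powr (- s) * 2 ^ m" "F k \<le> freq k powr (- s) * (freq k * norm h) ^ m" for k
        unfolding F_def using s2[of k] s3[of k] by (auto intro!: mult_left_mono power_mono)
      have sF: "summable F"
        by (rule summable_comparison_test'[OF summable_mult2[OF freq_summable[OF s], of "2 ^ m"]]) (use F in auto)
      have t: "sdiff_pow m h (\<lambda>x. a k * freq k powr (- s) * cos (freq k * (x \<bullet> b))) x
         = a k * freq k powr (- s) * ((2 * sin (freq k * (h \<bullet> b) / 2)) ^ m * cos (freq k * (x \<bullet> b) + real m * pi / 2))" for k
        unfolding sdiff_pow_cmult using sdiff_pow_cos[of m h "freq k" b 0 x] by simp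
      have lf: "lac b s a = (\<lambda>x. \<Sum>k. a k * freq k powr (- s) * cos (freq k * (x \<bullet> b)))"
        by (rule ext) (rule lac_def)
      have eq: "sdiff_pow m h (lac b s a) x = (\<Sum>k. sdiff_pow m h (\<lambda>x. a k * freq k powr (- s) * cos (freq k * (x \<bullet> b))) x)"
        unfolding lf using sdiff_pow_suminf[of "\<lambda>k x. a k * freq k powr (- s) * cos (freq k * (x \<bullet> b))" m h x, OF sm(3)] by blast
      have "norm (sdiff_pow m h (lac b s a) x) \<le> (\<Sum>k. A * F k)"
        unfolding eq
      proof (intro norm_suminf_le summable_mult sF)
        fix k
        have "\<bar>a k\<bar> * (F k * \<bar>cos (freq k * (x \<bullet> b) + real m * pi / 2)\<bar>) \<le> A * (F k * 1)"
          using a[of k] F(1)[of k] by (intro mult_mono) auto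
        then show "norm (sdiff_pow m h (\<lambda>x. a k * freq k powr (- s) * cos (freq k * (x \<bullet> b))) x) \<le> A * F k"
          unfolding t F_def by (simp add: abs_mult power_abs mult_ac)
      qed
      also have "\<dots> = A * suminf F" by (rule suminf_mult[OF sF])
      also have "\<dots> \<le> A * (C2 * norm h powr s)"
        using A0 F h by (intro mult_left_mono C2) auto
      finally show ?thesis by (simp add: mult_ac)
    qed
    show "lac b s a \<in> Lambda s \<and> Lambda_norm s (lac b s a) \<le> (C1 + C2) * A"
      using LambdaI[OF lac_continuous[where a=a, OF s a] bd df[unfolded m_def]] by (simp add: distrib_right)
  qed
qed

lemma lac_split:
  assumes s: "s > 0" and a: "\<And>k. \<bar>a k\<bar> \<le> A"
  shows "lac b s a x - (\<Sum>k<K. a k * freq k powr (- s) * cos (freq k * (x \<bullet> b))) = lac b s (\<lambda>k. if k < K then 0 else a k) x"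
proof -
  define a' where "a' k = (if k < K then 0 else a k)" for k
  have a': "\<bar>a' k\<bar> \<le> A" for k using a[of k] by (auto simp: a'_def)
  have 1: "(\<Sum>k<K. a' k * freq k powr (- s) * cos (freq k * (x \<bullet> b))) = 0" by (intro sum.neutral) (auto simp: a'_def)
  have 2: "(\<lambda>k. a' (k + K) * freq (k + K) powr (- s) * cos (freq (k + K) * (x \<bullet> b))) = (\<lambda>k. a (k + K) * freq (k + K) powr (- s) * cos (freq (k + K) * (x \<bullet> b)))"
    by (auto simp: a'_def)
  show ?thesis
    using suminf_split_initial_segment[OF lac_summable(3)[where a=a and x=x and b=b, OF s a], of K]
      suminf_split_initial_segment[OF lac_summable(3)[where a=a' and x=x and b=b, OF s a'], of K]
    unfolding 1 2 by (simp add: lac_def a'_def)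
qed

text \<open>Truncations lie in \<open>J_bmo s\<close>, and the tail has coefficients of small
  supremum, hence small norm.\<close>

lemma lac_in_closure:
  fixes b :: "'a::euclidean_space"
  assumes s: "s > 0" and b: "b \<in> Basis" and a: "a \<longlonglongrightarrow> 0"
  shows "lac b s a \<in> Lambda_closure s (J_bmo s)"
proof -
  obtain C where C: "\<And>a A. (\<And>k. \<bar>a k\<bar> \<le> A) \<Longrightarrow> lac b s a \<in> Lambda s \<and> Lambda_norm s (lac b s a) \<le> C * A"
    using lac_Lambda[OF s b] by blast
  have "Bseq a" using a by (rule convergent_imp_Bseq[OF convergentI])
  then obtain A where A: "\<And>k. \<bar>a k\<bar> \<le> A" by (auto simp: Bseq_def)
  show ?thesis
    unfolding Lambda_closure_def
  proof (intro CollectI conjI allI impI)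
    show "lac b s a \<in> Lambda s" using C[of a, OF A] by blast
    fix \<epsilon> :: real assume e: "\<epsilon> > 0"
    \<comment> \<open>\<open>\<bar>C\<bar> + 1\<close> is used because nothing is known about the
      sign of \<open>C\<close>.\<close>
    define \<eta> where "\<eta> = \<epsilon> / (2 * (\<bar>C\<bar> + 1))"
    have eta: "\<eta> > 0" using e by (simp add: \<eta>_def)
    obtain K where K: "\<And>k. k \<ge> K \<Longrightarrow> \<bar>a k\<bar> < \<eta>" using LIMSEQ_D[OF a eta] by auto
    let ?g = "\<lambda>x. \<Sum>k<K. a k * freq k powr (- s) * cos (freq k * (x \<bullet> b))"
    have "\<bar>if k < K then 0 else a k\<bar> \<le> \<eta>" for k using K[of k] eta by auto
    from C[of "\<lambda>k. if k < K then 0 else a k", OF this] have "Lambda_norm s (\<lambda>x. lac b s a x - ?g x) \<le> C * \<eta>"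
      unfolding lac_split[where a=a, OF s A] by blast
    also have "C * \<eta> \<le> (\<bar>C\<bar> + 1) * \<eta>" using eta by (intro mult_right_mono) auto
    also have "\<dots> = \<epsilon> / 2" by (simp add: \<eta>_def field_simps)
    also have "\<dots> < \<epsilon>" using e by simp
    finally show "\<exists>g\<in>J_bmo s. Lambda_norm s (\<lambda>x. lac b s a x - g x) < \<epsilon>"
      using trig_sum_in_J_bmo[OF s b, where K=K and c="\<lambda>k. a k * freq k powr (- s)" and l=freq] by (rule bexI)
  qed
qed

section \<open>Gaussian means at lacunary frequencies\<close>

text \<open>Gaussian means are asymptotically translation invariant, at rate
  \<open>norm z / sqrt t\<close>, even when they do not converge.\<close>

lemma hconv_shift_limit:
  fixes w :: "'a::euclidean_space \<Rightarrow> real"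
  assumes w: "w \<in> borel_measurable borel" and B: "\<And>x. \<bar>w x\<bar> \<le> B"
  shows "((\<lambda>t. hconv t w z - hconv t w 0) \<longlongrightarrow> 0) at_top"
proof (rule Lim_null_comparison)
  have "eventually (\<lambda>t::real. 1 \<le> t \<and> (norm z)\<^sup>2 \<le> t) at_top"
    by (intro eventually_conj eventually_ge_at_top)
  then show "eventually (\<lambda>t. norm (hconv t w z - hconv t w 0) \<le> 2 ^ (DIM('a) + 2) * (norm z / sqrt t) * B) at_top"
  proof (rule eventually_mono)
    fix t assume t: "1 \<le> t \<and> (norm z)\<^sup>2 \<le> t"
    then have "norm z \<le> sqrt t" by (intro real_le_rsqrt) simp
    from sdiff_hconv_bounded[OF _ this w B, of "z /\<^sub>R 2"] t
    show "norm (hconv t w z - hconv t w 0) \<le> 2 ^ (DIM('a) + 2) * (norm z / sqrt t) * B"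
      using half_plus_half[of z] by (simp add: sdiff_def)
  qed
  have "filterlim sqrt at_top at_top" by (rule sqrt_at_top)
  then have "((\<lambda>t. norm z / sqrt t) \<longlongrightarrow> 0) at_top"
    by (intro tendsto_divide_0[OF tendsto_const] filterlim_at_top_imp_at_infinity)
  then show "((\<lambda>t. 2 ^ (DIM('a) + 2) * (norm z / sqrt t) * B) \<longlongrightarrow> 0) at_top"
    using tendsto_mult[OF tendsto_mult[OF tendsto_const[of "2 ^ (DIM('a) + 2)"]] tendsto_const[of B]] by fastforce
qed

lemma hconv_diff:
  assumes t: "t > 0" and "v \<in> borel_measurable borel" "\<And>x. \<bar>v x\<bar> \<le> B" "w \<in> borel_measurable borel" "\<And>x. \<bar>w x\<bar> \<le> B'"
  shows "hconv t (\<lambda>y. v y - w y) x = hconv t v x - hconv t w x"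
  unfolding hconv_def right_diff_distrib
  by (intro Bochner_Integration.integral_diff heat_bounded_integrable[OF t]) (use assms in auto)

lemma hconv_cmult: "hconv t (\<lambda>y. c * w y) x = c * hconv t w x"
  unfolding hconv_def by (simp add: mult.left_commute)

lemma abs_mult_cos_le: "\<bar>w\<bar> \<le> B \<Longrightarrow> \<bar>w * cos v\<bar> \<le> B" for w :: real
  using mult_mono[of "\<bar>w\<bar>" B "\<bar>cos v\<bar>" 1] by (simp add: abs_mult)

text \<open>With step \<open>\<pi> / l\<close> the difference operator turns the frequency-\<open>l\<close> cosine into a phase-shifted multiple of itself.\<close>

lemma hconv_sdiff_cos_limit:
  fixes w :: "'a::euclidean_space \<Rightarrow> real"
  assumes w [measurable]: "w \<in> borel_measurable borel" and B: "\<And>x. \<bar>w x\<bar> \<le> B" and b: "b \<in> Basis" and l: "l > 0"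
  shows "((\<lambda>t. hconv t (\<lambda>x. sdiff ((pi / l) *\<^sub>R b) w x * cos (l * (x \<bullet> b) + th)) 0
     + 2 * hconv t (\<lambda>x. w x * cos (l * (x \<bullet> b) + (th + pi / 2))) 0) \<longlongrightarrow> 0) at_top"
proof -
  define h where "h = ((pi / l) *\<^sub>R b) /\<^sub>R 2"
  define G where "G x = w x * cos (l * (x \<bullet> b) + (th + pi / 2))" for x
  have G [measurable]: "G \<in> borel_measurable borel" unfolding G_def by measurable
  have GB: "\<bar>G x\<bar> \<le> B" for x unfolding G_def by (rule abs_mult_cos_le[OF B])
  have hb: "l * (h \<bullet> b) = pi / 2" using b l by (simp add: h_def)
  \<comment> \<open>Here \<open>h\<close> is half the step. The phases change so that both
    translates of \<open>G\<close> appear with the same sign; their means add up to a factor -2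
    instead of cancelling.\<close>
  have e: "sdiff ((pi / l) *\<^sub>R b) w x * cos (l * (x \<bullet> b) + th) = - G (x + h) - G (x + (- h))" for x
  proof -
    have 1: "l * ((x + h) \<bullet> b) + (th + pi / 2) = (l * (x \<bullet> b) + th) + pi"
      using hb by (simp add: inner_add_left distrib_left)
    have 2: "l * ((x + (- h)) \<bullet> b) + (th + pi / 2) = l * (x \<bullet> b) + th"
      unfolding inner_add_left distrib_left inner_minus_left using hb by simp
    show ?thesis unfolding G_def 1 2 sdiff_def h_def[symmetric] by (simp add: left_diff_distrib)
  qed
  have "((\<lambda>t. - (hconv t G h - hconv t G 0) - (hconv t G (- h) - hconv t G 0)) \<longlongrightarrow> - 0 - 0) at_top"
    by (intro tendsto_diff tendsto_minus hconv_shift_limit[OF G GB])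
  moreover have "eventually (\<lambda>t. - (hconv t G h - hconv t G 0) - (hconv t G (- h) - hconv t G 0) =
     hconv t (\<lambda>x. sdiff ((pi / l) *\<^sub>R b) w x * cos (l * (x \<bullet> b) + th)) 0 + 2 * hconv t G 0) at_top"
    using eventually_gt_at_top[of 0]
  proof (rule eventually_mono)
    fix t :: real assume t: "t > 0"
    have "hconv t (\<lambda>x. - G (x + h) - G (x + (- h))) 0 = hconv t (\<lambda>x. - G (x + h)) 0 - hconv t (\<lambda>x. G (x + (- h))) 0"
      using GB by (intro hconv_diff[OF t, of _ B _ B]) auto
    also have "\<dots> = - hconv t G h - hconv t G (- h)"
      using hconv_cmult[of t "- 1" "\<lambda>x. G (x + h)" 0] hconv_translate[OF G, of t h 0] hconv_translate[OF G, of t "- h" 0] by simp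
    finally show "- (hconv t G h - hconv t G 0) - (hconv t G (- h) - hconv t G 0) =
     hconv t (\<lambda>x. sdiff ((pi / l) *\<^sub>R b) w x * cos (l * (x \<bullet> b) + th)) 0 + 2 * hconv t G 0"
      unfolding e by simp
  qed
  ultimately show ?thesis unfolding G_def by (auto intro: Lim_transform_eventually)
qed

lemma hconv_sdiff_pow_cos_limit:
  fixes w :: "'a::euclidean_space \<Rightarrow> real"
  assumes w: "w \<in> borel_measurable borel" and B: "\<And>x. \<bar>w x\<bar> \<le> B" and b: "b \<in> Basis" and l: "l > 0"
  shows "((\<lambda>t. hconv t (\<lambda>x. sdiff_pow m ((pi / l) *\<^sub>R b) w x * cos (l * (x \<bullet> b) + th)) 0
     - (- 2) ^ m * hconv t (\<lambda>x. w x * cos (l * (x \<bullet> b) + (th + real m * pi / 2))) 0) \<longlongrightarrow> 0) at_top"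
proof (induction m arbitrary: th)
  case (Suc m)
  let ?h = "(pi / l) *\<^sub>R b"
  have 1: "((\<lambda>t. hconv t (\<lambda>x. sdiff_pow (Suc m) ?h w x * cos (l * (x \<bullet> b) + th)) 0
     + 2 * hconv t (\<lambda>x. sdiff_pow m ?h w x * cos (l * (x \<bullet> b) + (th + pi / 2))) 0) \<longlongrightarrow> 0) at_top"
    unfolding sdiff_pow_Suc by (rule hconv_sdiff_cos_limit[OF sdiff_pow_measurable[OF w] sdiff_pow_bounded[OF B] b l])
  have p: "th + pi / 2 + real m * pi / 2 = th + real (Suc m) * pi / 2" by (simp add: field_simps)
  have "((\<lambda>t. (hconv t (\<lambda>x. sdiff_pow (Suc m) ?h w x * cos (l * (x \<bullet> b) + th)) 0
     + 2 * hconv t (\<lambda>x. sdiff_pow m ?h w x * cos (l * (x \<bullet> b) + (th + pi / 2))) 0)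
     - 2 * (hconv t (\<lambda>x. sdiff_pow m ?h w x * cos (l * (x \<bullet> b) + (th + pi / 2))) 0
        - (- 2) ^ m * hconv t (\<lambda>x. w x * cos (l * (x \<bullet> b) + (th + real (Suc m) * pi / 2))) 0)) \<longlongrightarrow> 0 - 2 * 0) at_top"
    by (intro tendsto_diff[OF 1] tendsto_mult[OF tendsto_const] Suc.IH[of "th + pi / 2", unfolded p])
  then show ?case by (simp add: right_diff_distrib mult.assoc)
qed simp

lemma hconv_cos_cos:
  fixes b :: "'a::euclidean_space"
  assumes t: "t > 0" and b: "b \<in> Basis"
  shows "hconv t (\<lambda>x. cos (l * (x \<bullet> b)) * cos (l' * (x \<bullet> b))) 0 = (exp (- t * (l - l')\<^sup>2) + exp (- t * (l + l')\<^sup>2)) / 2"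
proof -
  have "hconv t (\<lambda>x::'a. cos (l * (x \<bullet> b)) * cos (l' * (x \<bullet> b))) 0
     = hconv t (\<lambda>x. (1 / 2) * (cos ((l - l') * (x \<bullet> b) + 0) - - cos ((l + l') * (x \<bullet> b) + 0))) 0"
    by (simp add: cos_times_cos left_diff_distrib distrib_right)
  also have "\<dots> = (1 / 2) * (hconv t (\<lambda>x. cos ((l - l') * (x \<bullet> b) + 0)) 0 - hconv t (\<lambda>x. - cos ((l + l') * (x \<bullet> b) + 0)) 0)"
    unfolding hconv_cmult by (subst hconv_diff[OF t, of _ 1 _ 1]) auto
  also have "hconv t (\<lambda>x. - cos ((l + l') * (x \<bullet> b) + 0)) 0 = - hconv t (\<lambda>x. cos ((l + l') * (x \<bullet> b) + 0)) 0"
    using hconv_cmult[of t "- 1" "\<lambda>x. cos ((l + l') * (x \<bullet> b) + 0)" 0] by simp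
  finally show ?thesis unfolding hconv_cos[OF t b] by (simp add: field_simps)
qed

lemma freq_diff_ge_1:
  assumes "k \<noteq> j"
  shows "1 \<le> (freq k - freq j)\<^sup>2"
proof -
  have *: "1 \<le> freq k - freq j" if "j < k" for j k
  proof -
    have "freq k \<ge> freq (Suc j)" using that unfolding freq_def by (intro power_increasing) auto
    moreover have "freq (Suc j) = freq j + freq j" "freq j \<ge> 1" using freq_ge_1 by (auto simp: freq_def)
    ultimately show ?thesis by linarith
  qed
  have "1 \<le> \<bar>freq k - freq j\<bar>" using *[of j k] *[of k j] assms by linarith
  then show ?thesis by (simp add: abs_le_square_iff[symmetric, of 1, simplified] one_le_power)
qed

text \<open>Approximate orthogonality. The error is uniform over all pairs of frequencies, which
  permits interchanging the limit with an infinite series.\<close>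

lemma hconv_freq_pair:
  fixes b :: "'a::euclidean_space"
  assumes t: "t > 0" and b: "b \<in> Basis"
  shows "\<bar>hconv t (\<lambda>x. cos (freq k * (x \<bullet> b)) * cos (freq j * (x \<bullet> b))) 0 - (if k = j then 1 / 2 else 0)\<bar> \<le> exp (- t)"
proof -
  have "1 \<le> (freq k + freq j)\<^sup>2"
  proof -
    have "1 \<le> freq k + freq j" using freq_ge_1[of k] freq_pos[of j] by linarith
    then show ?thesis by (rule one_le_power)
  qed
  then have p: "exp (- t * (freq k + freq j)\<^sup>2) \<le> exp (- t)" using t by (simp add: mult_left_mono[of 1 _ t, simplified])
  show ?thesis
  proof (cases "k = j")
    case True
    then have "hconv t (\<lambda>x. cos (freq k * (x \<bullet> b)) * cos (freq j * (x \<bullet> b))) 0 - 1 / 2 = exp (- t * (freq k + freq j)\<^sup>2) / 2"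
      unfolding hconv_cos_cos[OF t b] by (simp add: field_simps)
    then show ?thesis unfolding if_P[OF True] using p exp_gt_zero[of "- t * (freq k + freq j)\<^sup>2"] by linarith
  next
    case False
    have "exp (- t * (freq k - freq j)\<^sup>2) \<le> exp (- t)"
      using t freq_diff_ge_1[OF False] by (simp add: mult_left_mono[of 1 _ t, simplified])
    moreover have "\<bar>(x + y) / 2 - 0\<bar> \<le> z" if "x \<le> z" "y \<le> z" "0 < x" "0 < y" for x y z :: real
      using that by (simp add: abs_if)
    ultimately show ?thesis
      unfolding if_not_P[OF False] hconv_cos_cos[OF t b] using p by (metis exp_gt_zero)
  qed
qed

lemma exp_minus_at_top: "((\<lambda>t::real. exp (- t)) \<longlongrightarrow> 0) at_top"
  by (intro filterlim_compose[OF exp_at_bot] filterlim_uminus_at_bot_at_top)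

lemma hconv_freq_pair_limit:
  fixes b :: "'a::euclidean_space"
  assumes b: "b \<in> Basis"
  shows "((\<lambda>t. hconv t (\<lambda>x. cos (freq k * (x \<bullet> b)) * cos (freq j * (x \<bullet> b))) 0) \<longlongrightarrow> (if k = j then 1 / 2 else 0)) at_top"
proof (rule LIM_zero_cancel, rule Lim_null_comparison[OF _ exp_minus_at_top])
  show "eventually (\<lambda>t. norm (hconv t (\<lambda>x. cos (freq k * (x \<bullet> b)) * cos (freq j * (x \<bullet> b))) 0 - (if k = j then 1 / 2 else 0)) \<le> exp (- t)) at_top"
    using eventually_gt_at_top[of 0] by eventually_elim (simp only: real_norm_def hconv_freq_pair[OF _ b])
qed

text \<open>Integrate termwise: the coefficients are absolutely summable, so the uniform pair errors
  add up to a multiple of \<open>exp (- t)\<close>.\<close>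

lemma hconv_lac_cos_limit:
  fixes b :: "'a::euclidean_space"
  assumes s: "s > 0" and b: "b \<in> Basis" and a: "\<And>k. \<bar>a k\<bar> \<le> A"
  shows "((\<lambda>t. hconv t (\<lambda>x. lac b s a x * cos (freq j * (x \<bullet> b))) 0) \<longlongrightarrow> a j * freq j powr (- s) / 2) at_top"
proof (rule LIM_zero_cancel, rule Lim_null_comparison)
  define S where "S = (\<Sum>k. A * freq k powr (- s))"
  note sm = lac_summable[where a=a, OF s a]
  show "((\<lambda>t. S * exp (- t)) \<longlongrightarrow> 0) at_top"
    using tendsto_mult[OF tendsto_const[of S] exp_minus_at_top] by simp
  show "eventually (\<lambda>t. norm (hconv t (\<lambda>x. lac b s a x * cos (freq j * (x \<bullet> b))) 0 - a j * freq j powr (- s) / 2) \<le> S * exp (- t)) at_top"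
    using eventually_gt_at_top[of 0]
  proof (rule eventually_mono)
    fix t :: real assume t: "t > 0"
    define F where "F k x = a k * freq k powr (- s) * (cos (freq k * (x \<bullet> b)) * cos (freq j * (x \<bullet> b)))" for k and x :: 'a
    define c where "c k = hconv t (\<lambda>x::'a. cos (freq k * (x \<bullet> b)) * cos (freq j * (x \<bullet> b))) 0" for k
    have FB: "\<bar>F k x\<bar> \<le> A * freq k powr (- s)" for k x
      using abs_mult_cos_le[OF sm(2)[of k "freq k * (x \<bullet> b)"]] by (simp add: F_def mult.assoc)
    have Fm [measurable]: "F k \<in> borel_measurable borel" for k unfolding F_def by measurable
    have sF: "summable (\<lambda>k. \<bar>F k x\<bar>)" for x by (rule summable_comparison_test'[OF sm(1)]) (use FB in auto)
    have Fi: "integrable lborel (\<lambda>y. heat t (0 - y) * F k y)" for k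
      by (rule heat_bounded_integrable[OF t Fm FB])
    have Fh: "hconv t (F k) 0 = a k * freq k powr (- s) * c k" for k
      unfolding F_def c_def hconv_cmult ..
    have "hconv t (\<lambda>x. lac b s a x * cos (freq j * (x \<bullet> b))) 0 = (LINT y|lborel. (\<Sum>k. heat t (0 - y) * F k y))"
      unfolding hconv_def
    proof (intro Bochner_Integration.integral_cong refl)
      fix y
      have "lac b s a y * cos (freq j * (y \<bullet> b)) = (\<Sum>k. F k y)"
        unfolding lac_def F_def by (subst suminf_mult2[OF sm(3)]) (simp add: mult.assoc)
      then show "heat t (0 - y) * (lac b s a y * cos (freq j * (y \<bullet> b))) = (\<Sum>k. heat t (0 - y) * F k y)"
        using suminf_mult[OF summable_rabs_cancel[OF sF[of y]], of "heat t (0 - y)"] by simp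
    qed
    also have "\<dots> = (\<Sum>k. LINT y|lborel. heat t (0 - y) * F k y)"
    proof (rule integral_suminf[OF Fi])
      show "AE y in lborel. summable (\<lambda>k. norm (heat t (0 - y) * F k y))"
        using sF by (intro AE_I2) (simp add: abs_mult summable_mult)
      show "summable (\<lambda>k. LINT y|lborel. norm (heat t (0 - y) * F k y))"
      proof (rule summable_comparison_test'[OF sm(1)])
        fix k
        have "\<bar>hconv t (\<lambda>y. \<bar>F k y\<bar>) 0\<bar> \<le> A * freq k powr (- s)" using FB by (intro hconv_bounded[OF t]) auto
        then show "norm (LINT y|lborel. norm (heat t (0 - y) * F k y)) \<le> A * freq k powr (- s)"
          by (simp add: hconv_def abs_mult)
      qed
    qed
    also have "\<dots> = (\<Sum>k. a k * freq k powr (- s) * c k)" using Fh by (simp add: hconv_def)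
    finally have e: "hconv t (\<lambda>x. lac b s a x * cos (freq j * (x \<bullet> b))) 0 = (\<Sum>k. a k * freq k powr (- s) * c k)" .
    let ?d = "\<lambda>k. if k = j then 1 / 2 else 0 :: real"
    have cd: "\<bar>c k - ?d k\<bar> \<le> exp (- t)" for k unfolding c_def by (rule hconv_freq_pair[OF t b])
    have 1: "(\<lambda>k. a k * freq k powr (- s) * ?d k) sums (a j * freq j powr (- s) / 2)"
      using sums_single[of j "\<lambda>k. a k * freq k powr (- s) / 2"] by (simp add: if_distrib cong: if_cong)
    have bd: "\<bar>a k * freq k powr (- s) * (c k - ?d k)\<bar> \<le> A * freq k powr (- s) * exp (- t)" for k
      using a[of k] cd[of k] by (auto simp: abs_mult simp del: abs_ge_zero intro!: mult_mono)
    have 3: "summable (\<lambda>k. A * freq k powr (- s) * exp (- t))" using sm(1) by (rule summable_mult2)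
    have 2: "summable (\<lambda>k. a k * freq k powr (- s) * (c k - ?d k))"
      by (rule summable_comparison_test'[OF 3]) (use bd in auto)
    have "(\<Sum>k. a k * freq k powr (- s) * c k) = (\<Sum>k. a k * freq k powr (- s) * (c k - ?d k) + a k * freq k powr (- s) * ?d k)"
      by (simp add: right_diff_distrib)
    also have "\<dots> = (\<Sum>k. a k * freq k powr (- s) * (c k - ?d k)) + a j * freq j powr (- s) / 2"
      using suminf_add[OF 2 sums_summable[OF 1]] sums_unique[OF 1] by simp
    finally have "hconv t (\<lambda>x. lac b s a x * cos (freq j * (x \<bullet> b))) 0 - a j * freq j powr (- s) / 2 = (\<Sum>k. a k * freq k powr (- s) * (c k - ?d k))"
      unfolding e by simp
    also have "norm \<dots> \<le> (\<Sum>k. A * freq k powr (- s) * exp (- t))"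
      using bd by (intro norm_suminf_le 3) auto
    also have "\<dots> = S * exp (- t)" unfolding S_def by (rule suminf_mult2[OF sm(1), symmetric])
    finally show "norm (hconv t (\<lambda>x. lac b s a x * cos (freq j * (x \<bullet> b))) 0 - a j * freq j powr (- s) / 2) \<le> S * exp (- t)" .
  qed
qed

section \<open>Means of Bessel potentials against cosines\<close>

lemma bessel_pot_minus:
  assumes [measurable]: "g \<in> borel_measurable borel"
  shows "bessel_pot s g x = (LINT z|lborel. bessel_kernel s z * g (x - z))"
proof -
  have "(LINT z|lborel. bessel_kernel s (x - (x - z)) * g (x - z)) = (LINT y|lborel. bessel_kernel s (x - y) * g y)"
    by (rule lborel_integral_minus) measurable
  then show ?thesis by (simp add: bessel_pot_def)
qed

lemma bessel_kernel_minus: "bessel_kernel s (- z) = bessel_kernel s z"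
  by (simp add: bessel_kernel_eq)

lemma bessel_kernel_cos:
  fixes b :: "'a::euclidean_space"
  assumes s: "s > 0" and b: "b \<in> Basis"
  shows "(LINT z|lborel. bessel_kernel s z * cos (l * (z \<bullet> b) + th)) = (1 + l\<^sup>2) powr (- s / 2) * cos th"
  using bessel_pot_cos[OF s b, of l th 0] by (simp add: bessel_pot_def bessel_kernel_minus)

context heat_tame
begin

lemma dominated_integrable:
  assumes t: "t > 0" and [measurable]: "K \<in> borel_measurable borel" and K: "\<And>y. \<bar>K y\<bar> \<le> \<bar>g y\<bar>"
  shows "integrable lborel (\<lambda>y. heat t (x - y) * K y)"
  by (rule Bochner_Integration.integrable_bound[OF heat_integrable(2)[OF t, of x]])
     (use K in \<open>auto simp: abs_mult intro!: mult_left_mono\<close>)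

text \<open>Intended for \<open>g\<close> modulated by cosines: one bound serves all modulations,
  centres and times at least 1.\<close>

lemma dominated_hconv_bounded:
  assumes t: "t \<ge> 1" and K: "K \<in> borel_measurable borel" "\<And>y. \<bar>K y\<bar> \<le> \<bar>g y\<bar>"
  shows "\<bar>hconv t K x\<bar> \<le> (1 + N) / 2"
proof -
  have t0: "t > 0" using t by simp
  have "\<bar>hconv t K x\<bar> \<le> (LINT y|lborel. \<bar>heat t (x - y) * K y\<bar>)"
    unfolding hconv_def by (rule integral_abs_bound)
  also have "\<dots> \<le> (LINT y|lborel. heat t (x - y) * \<bar>g y\<bar>)"
    by (intro integral_mono integrable_abs dominated_integrable[OF t0 K] heat_integrable(2)[OF t0])
       (use K(2) in \<open>auto simp: abs_mult intro!: mult_left_mono\<close>)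
  also have "\<dots> \<le> (1 + N) / 2" by (rule abs_conv_large[OF t])
  finally show ?thesis .
qed

lemma dominated_hconv_shift:
  assumes t: "t \<ge> 1" and z: "norm z \<le> sqrt t" and K: "K \<in> borel_measurable borel" "\<And>y. \<bar>K y\<bar> \<le> \<bar>g y\<bar>"
  shows "\<bar>hconv t K z - hconv t K 0\<bar> \<le> 2 ^ (DIM('a) + 2) * (norm z / sqrt t) * ((1 + N) / 2)"
proof -
  have t0: "t > 0" "4 * t > 0" using t by auto
  let ?D = "2 ^ (DIM('a) + 2) * (norm z / sqrt t)"
  have i: "integrable lborel (\<lambda>y. (heat t (z - y) - heat t (0 - y)) * K y)"
    unfolding left_diff_distrib by (intro Bochner_Integration.integrable_diff dominated_integrable[OF t0(1) K])
  have "hconv t K z - hconv t K 0 = (LINT y|lborel. (heat t (z - y) - heat t (0 - y)) * K y)"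
    unfolding hconv_def left_diff_distrib
    by (intro Bochner_Integration.integral_diff[symmetric] dominated_integrable[OF t0(1) K])
  also have "\<bar>\<dots>\<bar> \<le> (LINT y|lborel. \<bar>(heat t (z - y) - heat t (0 - y)) * K y\<bar>)"
    by (rule integral_abs_bound)
  also have "\<dots> \<le> (LINT y|lborel. ?D * (heat (4 * t) (0 - y) * \<bar>g y\<bar>))"
  proof (intro integral_mono integrable_abs i integrable_mult_right heat_integrable(2)[OF t0(2)])
    fix y
    have "\<bar>heat t (z - y) - heat t (0 - y)\<bar> \<le> ?D * heat (4 * t) (0 - y)"
      using heat_diff_le[OF t0(1) z, of "0 - y"] by (simp add: algebra_simps)
    then have "\<bar>heat t (z - y) - heat t (0 - y)\<bar> * \<bar>K y\<bar> \<le> (?D * heat (4 * t) (0 - y)) * \<bar>g y\<bar>"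
      using K(2)[of y] t by (intro mult_mono) auto
    then show "\<bar>(heat t (z - y) - heat t (0 - y)) * K y\<bar> \<le> ?D * (heat (4 * t) (0 - y) * \<bar>g y\<bar>)"
      by (simp only: abs_mult mult.assoc)
  qed
  also have "\<dots> = ?D * (LINT y|lborel. heat (4 * t) (0 - y) * \<bar>g y\<bar>)" by (rule integral_mult_right_zero)
  also have "\<dots> \<le> ?D * ((1 + N) / 2)"
    using t by (intro mult_left_mono abs_conv_large) auto
  finally show ?thesis .
qed

text \<open>The potential averages the translates of \<open>g\<close> by \<open>z\<close>. Each
  translation is moved onto the cosine, giving \<open>K z\<close>, and onto the centre of the
  Gaussian, which becomes \<open>- z\<close>.\<close>

lemma bessel_pot_cos_mean:
  fixes b :: 'a and l :: real
  assumes s: "s > 0" and b: "b \<in> Basis" and t: "t \<ge> 1"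
  defines "K \<equiv> \<lambda>z y. cos (l * ((y + z) \<bullet> b)) * g y"
  shows "integrable lborel (\<lambda>z. bessel_kernel s z * hconv t (K z) (- z))"
    and "hconv t (\<lambda>x. bessel_pot s g x * cos (l * (x \<bullet> b))) 0 = (LINT z|lborel. bessel_kernel s z * hconv t (K z) (- z))"
proof -
  have t0: "t > 0" using t by simp
  let ?f = "\<lambda>(z, x). bessel_kernel s z * (heat t x * (cos (l * (x \<bullet> b)) * g (x - z)))"
  have Km: "K z \<in> borel_measurable borel" for z unfolding K_def by measurable
  have gz: "integrable lborel (\<lambda>x. heat t x * g (x - z))" for z
  proof -
    have "integrable lborel (\<lambda>y. heat t (- z - y) * g y)" by (rule heat_integrable(1)[OF t0])
    then have "integrable lborel (\<lambda>y. heat t (- z - (- z + y)) * g (- z + y))"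
      by (subst lborel_integrable_plus[of "\<lambda>y. heat t (- z - y) * g y" "- z"]) auto
    then show ?thesis by simp
  qed
  have abs: "(LINT x|lborel. heat t x * \<bar>g (x - z)\<bar>) = (LINT y|lborel. heat t (- z - y) * \<bar>g y\<bar>)" for z
    using lborel_integral_plus[of "\<lambda>y. heat t (- z - y) * \<bar>g y\<bar>" "- z"] by simp
  have gzc: "integrable lborel (\<lambda>x. heat t x * (cos (l * (x \<bullet> b)) * g (x - z)))" for z
    by (rule Bochner_Integration.integrable_bound[OF gz[of z]])
       (auto simp: abs_mult intro!: AE_I2 mult_left_mono mult_left_le_one_le)
  have i: "integrable (lborel \<Otimes>\<^sub>M lborel) ?f"
  proof (rule lborel_pair.Fubini_integrable)
    show "integrable lborel (\<lambda>z. LINT x|lborel. norm (?f (z, x)))"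
    proof (rule Bochner_Integration.integrable_bound)
      show "integrable lborel (\<lambda>z. bessel_kernel s (z::'a) * ((1 + N) / 2))"
        using bessel_kernel_integrable[OF s] by (rule integrable_mult_left)
      show "AE z in lborel. norm (LINT x|lborel. norm (?f (z, x))) \<le> norm (bessel_kernel s z * ((1 + N) / 2))"
      proof (intro AE_I2)
        fix z
        have "(LINT x|lborel. \<bar>heat t x * (cos (l * (x \<bullet> b)) * g (x - z))\<bar>) \<le> (LINT x|lborel. \<bar>heat t x * g (x - z)\<bar>)"
          by (intro integral_mono integrable_abs gzc gz) (auto simp: abs_mult intro!: mult_left_mono mult_left_le_one_le)
        also have "\<dots> \<le> (1 + N) / 2" using abs[of z] abs_conv_large[OF t, of "- z"] by (simp add: abs_mult)
        finally have "bessel_kernel s z * (LINT x|lborel. \<bar>heat t x * (cos (l * (x \<bullet> b)) * g (x - z))\<bar>) \<le> bessel_kernel s z * ((1 + N) / 2)"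
          using s by (intro mult_left_mono) auto
        moreover have "0 \<le> (LINT x|lborel. \<bar>heat t x * (cos (l * (x \<bullet> b)) * g (x - z))\<bar>)"
          by (intro Bochner_Integration.integral_nonneg) simp
        ultimately show "norm (LINT x|lborel. norm (?f (z, x))) \<le> norm (bessel_kernel s z * ((1 + N) / 2))"
          using s N_nonneg by (simp add: abs_mult)
      qed
    qed measurable
    show "AE z in lborel. integrable lborel (\<lambda>x. ?f (z, x))" using gzc by simp
  qed measurable
  have h: "(LINT x|lborel. ?f (z, x)) = bessel_kernel s z * hconv t (K z) (- z)" for z
  proof -
    have "hconv t (K z) (0 + (- z)) = hconv t (\<lambda>y. K z (y + (- z))) 0" by (rule hconv_translate[OF Km, symmetric])
    then show ?thesis by (simp add: hconv_def K_def)
  qed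
  show "integrable lborel (\<lambda>z. bessel_kernel s z * hconv t (K z) (- z))"
    using lborel_pair.integrable_fst'[OF i] unfolding h .
  have "hconv t (\<lambda>x. bessel_pot s g x * cos (l * (x \<bullet> b))) 0 = (LINT x|lborel. (LINT z|lborel. ?f (z, x)))"
    unfolding hconv_def
  proof (intro Bochner_Integration.integral_cong refl)
    fix x :: 'a
    have "(LINT z|lborel. ?f (z, x)) = (LINT z|lborel. (heat t x * cos (l * (x \<bullet> b))) * (bessel_kernel s z * g (x - z)))"
      by (intro Bochner_Integration.integral_cong) auto
    then show "heat t (0 - x) * (bessel_pot s g x * cos (l * (x \<bullet> b))) = (LINT z|lborel. ?f (z, x))"
      by (simp add: bessel_pot_minus[OF meas])
  qed
  also have "\<dots> = (LINT z|lborel. (LINT x|lborel. ?f (z, x)))"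
    using lborel_pair.Fubini_integral[of "\<lambda>z x. ?f (z, x)"] i by simp
  finally show "hconv t (\<lambda>x. bessel_pot s g x * cos (l * (x \<bullet> b))) 0 = (LINT z|lborel. bessel_kernel s z * hconv t (K z) (- z))"
    unfolding h .
qed

text \<open>With the centre back at 0, the addition formula separates \<open>z\<close> from
  \<open>y\<close>. The cosine in \<open>z\<close> integrates to the symbol; the sine integrates to
  0, as phase \<open>pi / 2\<close> in the kernel integral.\<close>

lemma bessel_pot_cos_main_term:
  fixes b :: 'a and l :: real
  assumes s: "s > 0" and b: "b \<in> Basis" and t: "t \<ge> 1"
  defines "K \<equiv> \<lambda>z y. cos (l * ((y + z) \<bullet> b)) * g y"
  shows "integrable lborel (\<lambda>z. bessel_kernel s z * hconv t (K z) 0)"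
    and "(LINT z|lborel. bessel_kernel s z * hconv t (K z) 0) = (1 + l\<^sup>2) powr (- s / 2) * hconv t (\<lambda>x. g x * cos (l * (x \<bullet> b))) 0"
proof -
  have t0: "t > 0" using t by simp
  define p q where "p = hconv t (\<lambda>x. g x * cos (l * (x \<bullet> b))) 0" and "q = hconv t (\<lambda>x. g x * sin (l * (x \<bullet> b))) 0"
  have dom: "\<bar>g y * cos v\<bar> \<le> \<bar>g y\<bar>" "\<bar>g y * sin v\<bar> \<le> \<bar>g y\<bar>" for y v by (auto simp: abs_mult mult_left_le)
  have k: "hconv t (K z) 0 = p * cos (l * (z \<bullet> b) + 0) + q * cos (l * (z \<bullet> b) + pi / 2)" for z
  proof -
    have "hconv t (K z) 0 = (LINT y|lborel. cos (l * (z \<bullet> b)) * (heat t (0 - y) * (g y * cos (l * (y \<bullet> b)))) - sin (l * (z \<bullet> b)) * (heat t (0 - y) * (g y * sin (l * (y \<bullet> b)))))"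
      unfolding hconv_def K_def
      by (intro Bochner_Integration.integral_cong) (auto simp: inner_add_left distrib_left cos_add algebra_simps)
    also have "\<dots> = cos (l * (z \<bullet> b)) * p - sin (l * (z \<bullet> b)) * q"
      unfolding p_def q_def hconv_def
      by (subst Bochner_Integration.integral_diff) (use dom in \<open>auto intro!: integrable_mult_right dominated_integrable[OF t0, of _ 0, simplified]\<close>)
    finally show ?thesis by (simp add: cos_add mult.commute)
  qed
  have ic: "integrable lborel (\<lambda>z. bessel_kernel s z * cos (l * (z \<bullet> b) + th))" for th
    by (rule Bochner_Integration.integrable_bound[OF bessel_kernel_integrable[OF s]])
       (auto simp: abs_mult mult_left_le)
  have e: "(\<lambda>z. bessel_kernel s z * hconv t (K z) 0) = (\<lambda>z. p * (bessel_kernel s z * cos (l * (z \<bullet> b) + 0)) + q * (bessel_kernel s z * cos (l * (z \<bullet> b) + pi / 2)))"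
    unfolding k by (auto simp: algebra_simps)
  show "integrable lborel (\<lambda>z. bessel_kernel s z * hconv t (K z) 0)"
    unfolding e by (intro Bochner_Integration.integrable_add integrable_mult_right ic)
  have "(LINT z|lborel. bessel_kernel s z * hconv t (K z) 0) = p * (LINT z|lborel. bessel_kernel s z * cos (l * (z \<bullet> b) + 0)) + q * (LINT z|lborel. bessel_kernel s z * cos (l * (z \<bullet> b) + pi / 2))"
    unfolding e by (subst Bochner_Integration.integral_add) (use ic in \<open>auto intro!: integrable_mult_right simp del: add_0_right\<close>)
  also have "\<dots> = (1 + l\<^sup>2) powr (- s / 2) * p"
    unfolding bessel_kernel_cos[OF s b] by simp
  finally show "(LINT z|lborel. bessel_kernel s z * hconv t (K z) 0) = (1 + l\<^sup>2) powr (- s / 2) * hconv t (\<lambda>x. g x * cos (l * (x \<bullet> b))) 0"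
    by (simp add: p_def)
qed

text \<open>Moving the centre from \<open>- z\<close> to 0 costs an error vanishing for each fixed
  \<open>z\<close>, though not uniformly; dominated convergence against the integrable kernel takes
  care of large \<open>z\<close>.\<close>

lemma bessel_pot_cos_limit:
  fixes b :: 'a
  assumes s: "s > 0" and b: "b \<in> Basis"
  shows "((\<lambda>t. hconv t (\<lambda>x. bessel_pot s g x * cos (l * (x \<bullet> b))) 0
     - (1 + l\<^sup>2) powr (- s / 2) * hconv t (\<lambda>x. g x * cos (l * (x \<bullet> b))) 0) \<longlongrightarrow> 0) at_top"
proof -
  define K where "K z y = cos (l * ((y + z) \<bullet> b)) * g y" for z y
  have Km: "K z \<in> borel_measurable borel" for z unfolding K_def by measurable
  have Kd: "\<bar>K z y\<bar> \<le> \<bar>g y\<bar>" for z y by (simp add: K_def abs_mult mult_left_le_one_le)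
  have "((\<lambda>t. LINT z|lborel. bessel_kernel s z * (hconv t (K z) (- z) - hconv t (K z) 0)) \<longlongrightarrow> (LINT z|lborel. (\<lambda>z::'a. 0) z)) at_top"
  proof (rule integral_dominated_convergence_at_top)
    show "integrable lborel (\<lambda>z. bessel_kernel s (z::'a) * (1 + N))"
      using bessel_kernel_integrable[OF s] by (rule integrable_mult_left)
    show "eventually (\<lambda>t. AE z in lborel. norm (bessel_kernel s z * (hconv t (K z) (- z) - hconv t (K z) 0)) \<le> bessel_kernel s z * (1 + N)) at_top"
      using eventually_ge_at_top[of 1]
    proof (rule eventually_mono)
      fix t :: real assume t: "1 \<le> t"
      have "\<bar>hconv t (K z) (- z) - hconv t (K z) 0\<bar> \<le> 1 + N" for z
        using abs_triangle_ineq4[of "hconv t (K z) (- z)" "hconv t (K z) 0"]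
          dominated_hconv_bounded[OF t Km Kd, of z "- z"] dominated_hconv_bounded[OF t Km Kd, of z 0] by (simp add: field_simps)
      then show "AE z in lborel. norm (bessel_kernel s z * (hconv t (K z) (- z) - hconv t (K z) 0)) \<le> bessel_kernel s z * (1 + N)"
        using s by (intro AE_I2) (auto simp: abs_mult intro!: mult_left_mono)
    qed
    show "AE z in lborel. ((\<lambda>t. bessel_kernel s z * (hconv t (K z) (- z) - hconv t (K z) 0)) \<longlongrightarrow> 0) at_top"
    proof (intro AE_I2 tendsto_mult_right_zero)
      fix z :: 'a
      show "((\<lambda>t. hconv t (K z) (- z) - hconv t (K z) 0) \<longlongrightarrow> 0) at_top"
      proof (rule Lim_null_comparison)
        have "eventually (\<lambda>t::real. 1 \<le> t \<and> (norm z)\<^sup>2 \<le> t) at_top"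
          by (intro eventually_conj eventually_ge_at_top)
        then show "eventually (\<lambda>t. norm (hconv t (K z) (- z) - hconv t (K z) 0) \<le> 2 ^ (DIM('a) + 2) * (norm z / sqrt t) * ((1 + N) / 2)) at_top"
        proof (rule eventually_mono)
          fix t assume t: "1 \<le> t \<and> (norm z)\<^sup>2 \<le> t"
          then have "norm (- z) \<le> sqrt t" by (simp add: real_le_rsqrt)
          from dominated_hconv_shift[OF _ this Km Kd, of z] t
          show "norm (hconv t (K z) (- z) - hconv t (K z) 0) \<le> 2 ^ (DIM('a) + 2) * (norm z / sqrt t) * ((1 + N) / 2)" by simp
        qed
        have "((\<lambda>t. norm z / sqrt t) \<longlongrightarrow> 0) at_top"
          by (intro tendsto_divide_0[OF tendsto_const] filterlim_at_top_imp_at_infinity sqrt_at_top)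
        then show "((\<lambda>t. 2 ^ (DIM('a) + 2) * (norm z / sqrt t) * ((1 + N) / 2)) \<longlongrightarrow> 0) at_top"
          using tendsto_mult[OF tendsto_mult[OF tendsto_const[of "2 ^ (DIM('a) + 2)"]] tendsto_const[of "(1 + N) / 2"]] by fastforce
      qed
    qed
    show "(\<lambda>z. bessel_kernel s z * (hconv t (K z) (- z) - hconv t (K z) 0)) \<in> borel_measurable lborel" for t
      unfolding hconv_def K_def by measurable
  qed measurable
  then have "((\<lambda>t. LINT z|lborel. bessel_kernel s z * (hconv t (K z) (- z) - hconv t (K z) 0)) \<longlongrightarrow> 0) at_top" by simp
  moreover have "eventually (\<lambda>t. (LINT z|lborel. bessel_kernel s z * (hconv t (K z) (- z) - hconv t (K z) 0)) =
     hconv t (\<lambda>x. bessel_pot s g x * cos (l * (x \<bullet> b))) 0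
     - (1 + l\<^sup>2) powr (- s / 2) * hconv t (\<lambda>x. g x * cos (l * (x \<bullet> b))) 0) at_top"
    using eventually_ge_at_top[of 1]
  proof (rule eventually_mono)
    fix t :: real assume t: "1 \<le> t"
    show "(LINT z|lborel. bessel_kernel s z * (hconv t (K z) (- z) - hconv t (K z) 0)) =
     hconv t (\<lambda>x. bessel_pot s g x * cos (l * (x \<bullet> b))) 0
     - (1 + l\<^sup>2) powr (- s / 2) * hconv t (\<lambda>x. g x * cos (l * (x \<bullet> b))) 0"
      unfolding right_diff_distrib bessel_pot_cos_mean(2)[OF s b t] bessel_pot_cos_main_term(2)[OF s b t, symmetric] K_def
      by (intro Bochner_Integration.integral_diff bessel_pot_cos_mean(1)[OF s b t] bessel_pot_cos_main_term(1)[OF s b t])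
  qed
  ultimately show ?thesis by (rule Lim_transform_eventually)
qed

end

section \<open>Elementary properties of the Zygmund norm\<close>

lemma LambdaD:
  assumes "f \<in> Lambda s"
  obtains B where "\<And>x. \<bar>f x\<bar> \<le> B" "f \<in> borel_measurable borel" "continuous_on UNIV f"
proof -
  obtain B where "\<And>x. \<bar>f x\<bar> \<le> B"
    using assms by (auto simp: Lambda_def bounded_iff)
  moreover have "continuous_on UNIV f" using assms by (simp add: Lambda_def)
  moreover from this have "f \<in> borel_measurable borel" by (rule borel_measurable_continuous_onI)
  ultimately show thesis using that by blast
qed

lemma Lambda_sdiff_le:
  assumes f: "f \<in> Lambda s" and h: "0 < norm h" "norm h \<le> 1"
  shows "\<bar>sdiff_pow (nat \<lfloor>s\<rfloor> + 1) h f x\<bar> \<le> Sup (zyg_quot s f) * norm h powr s"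
    and "Sup (zyg_quot s f) \<le> Lambda_norm s f"
proof -
  have "bdd_above (zyg_quot s f)" using f by (simp add: Lambda_def)
  moreover have "\<bar>sdiff_pow (nat \<lfloor>s\<rfloor> + 1) h f x\<bar> / norm h powr s \<in> zyg_quot s f"
    unfolding zyg_quot_def using h by blast
  ultimately have "\<bar>sdiff_pow (nat \<lfloor>s\<rfloor> + 1) h f x\<bar> / norm h powr s \<le> Sup (zyg_quot s f)"
    by (intro cSup_upper) auto
  then show "\<bar>sdiff_pow (nat \<lfloor>s\<rfloor> + 1) h f x\<bar> \<le> Sup (zyg_quot s f) * norm h powr s"
    using h by (simp add: divide_le_eq)
  obtain B where B: "\<And>x. \<bar>f x\<bar> \<le> B" using LambdaD[OF f] by blast
  \<comment> \<open>This shows the sup part of the norm to be nonnegative.\<close>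
  have "\<bar>f 0\<bar> \<le> (SUP x. \<bar>f x\<bar>)" using B by (intro cSUP_upper) (auto intro!: bdd_aboveI[of _ B])
  then show "Sup (zyg_quot s f) \<le> Lambda_norm s f" unfolding Lambda_norm_def by linarith
qed

lemma Lambda_diff:
  assumes f: "f \<in> Lambda s" and g: "g \<in> Lambda s"
  shows "(\<lambda>x. f x - g x) \<in> Lambda s"
proof -
  obtain B where B: "\<And>x. \<bar>f x\<bar> \<le> B" "continuous_on UNIV f" using LambdaD[OF f] by blast
  obtain B' where B': "\<And>x. \<bar>g x\<bar> \<le> B'" "continuous_on UNIV g" using LambdaD[OF g] by blast
  show ?thesis
  proof (rule LambdaI(1))
    show "continuous_on UNIV (\<lambda>x. f x - g x)" using B(2) B'(2) by (rule continuous_on_diff)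
    show "\<bar>f x - g x\<bar> \<le> B + B'" for x using B(1)[of x] B'(1)[of x] by linarith
    show "\<bar>sdiff_pow (nat \<lfloor>s\<rfloor> + 1) h (\<lambda>x. f x - g x) x\<bar> \<le> (Sup (zyg_quot s f) + Sup (zyg_quot s g)) * norm h powr s"
      if h: "0 < norm h" "norm h \<le> 1" for h x
      using Lambda_sdiff_le(1)[OF f h, of x] Lambda_sdiff_le(1)[OF g h, of x]
      unfolding sdiff_pow_diff distrib_right by linarith
  qed
qed

context heat_tame
begin

text \<open>Testing against \<open>\<Sum>j<J. c j * cos (freq j * (x \<bullet> b))\<close>: only finitely much \<open>\<ell>\<^sup>2\<close>-mass at lacunary
  frequencies is available to \<open>g\<close>, since its Gaussian square means are bounded by \<open>N\<close>.\<close>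

lemma lacunary_coefficients_bound:
  fixes b :: 'a
  assumes s: "s > 0" and b: "b \<in> Basis" and a: "\<And>k. \<bar>a k\<bar> \<le> A" and c: "\<And>j. c j \<ge> 0"
    and eps: "\<And>h x. 0 < norm h \<Longrightarrow> norm h \<le> 1 \<Longrightarrow>
      \<bar>sdiff_pow (nat \<lfloor>s\<rfloor> + 1) h (\<lambda>x. lac b s a x - bessel_pot s g x) x\<bar> \<le> \<epsilon> * norm h powr s"
  shows "(\<Sum>j<J. c j * ((1 + (freq j)\<^sup>2) powr (s / 2) * (a j * freq j powr (- s) / 2 - \<epsilon> * (pi / freq j) powr s)))
     \<le> N / 2 + (\<Sum>j<J. (c j)\<^sup>2) / 4"
proof -
  define m where "m = nat \<lfloor>s\<rfloor> + 1"
  define w where "w x = lac b s a x - bessel_pot s g x" for x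
  define C where "C j x = cos (freq j * (x \<bullet> b))" for j and x :: 'a
  define \<beta> where "\<beta> j = (1 + (freq j)\<^sup>2) powr (s / 2)" for j
  define \<eta> where "\<eta> j = \<epsilon> * (pi / freq j) powr s" for j
  define L where "L j t = hconv t (\<lambda>x. lac b s a x * C j x) 0" for j t
  define U where "U j t = hconv t (\<lambda>x. bessel_pot s g x * C j x) 0" for j t
  define P where "P j t = hconv t (\<lambda>x. g x * C j x) 0" for j t
  define W where "W j t = hconv t (\<lambda>x. w x * C j x) 0" for j t
  define H where "H j = (pi / freq j) *\<^sub>R b" for j
  \<comment> \<open>The phase is chosen so that the shifts by \<open>pi / 2\<close> accumulated over
    \<open>m\<close> differences bring it to 0.\<close>
  define D where "D j t = hconv t (\<lambda>x. sdiff_pow m (H j) w x * cos (freq j * (x \<bullet> b) + (- (real m * pi / 2)))) 0" for j t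
  define E where "E j t = D j t - (- 2) ^ m * W j t" for j t
  define R where "R j t = U j t - (1 + (freq j)\<^sup>2) powr (- s / 2) * P j t" for j t
  \<comment> \<open>A lower bound for \<open>P j t\<close> that converges, whereas
    \<open>P j t\<close> itself may not.\<close>
  define q where "q j t = \<beta> j * (L j t - \<eta> j - \<bar>E j t\<bar> - R j t)" for j t
  define T where "T t = (\<Sum>i<J. \<Sum>j<J. c i * c j * hconv t (\<lambda>x. C i x * C j x) 0)" for t
  have Cm [measurable]: "C j \<in> borel_measurable borel" for j unfolding C_def by measurable
  obtain C0 where C0: "lac b s a \<in> Lambda s \<and> Lambda_norm s (lac b s a) \<le> C0 * A"
    using lac_Lambda[OF s b] a by metis
  obtain BL where BL: "\<And>x. \<bar>lac b s a x\<bar> \<le> BL" "lac b s a \<in> borel_measurable borel"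
    using LambdaD C0 by blast
  obtain BU where BU: "\<And>x. \<bar>bessel_pot s g x\<bar> \<le> BU" "bessel_pot s g \<in> borel_measurable borel"
    using LambdaD[OF bessel_pot_in_Lambda[OF s]] by blast
  note [measurable] = BL(2) BU(2)
  have wm [measurable]: "w \<in> borel_measurable borel" unfolding w_def by measurable
  have wB: "\<bar>w x\<bar> \<le> BL + BU" for x unfolding w_def using BL(1)[of x] BU(1)[of x] by linarith
  have E0: "(E j \<longlongrightarrow> 0) at_top" for j
    unfolding E_def D_def W_def C_def H_def
    using hconv_sdiff_pow_cos_limit[OF wm wB b freq_pos[of j], of m "- (real m * pi / 2)"] by simp
  have R0: "(R j \<longlongrightarrow> 0) at_top" for j
    unfolding R_def U_def P_def C_def by (rule bessel_pot_cos_limit[OF s b])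
  have L0: "(L j \<longlongrightarrow> a j * freq j powr (- s) / 2) at_top" for j
    unfolding L_def C_def by (rule hconv_lac_cos_limit[OF s b a])
  have q0: "(q j \<longlongrightarrow> \<beta> j * (a j * freq j powr (- s) / 2 - \<eta> j - \<bar>0\<bar> - 0)) at_top" for j
    unfolding q_def by (intro tendsto_intros L0 E0 R0)
  have T0: "(T \<longlongrightarrow> (\<Sum>i<J. \<Sum>j<J. c i * c j * (if i = j then 1 / 2 else 0))) at_top"
    unfolding T_def C_def by (intro tendsto_sum tendsto_mult tendsto_const hconv_freq_pair_limit[OF b])
  have Hn: "0 < norm (H j)" "norm (H j) \<le> 1" "norm (H j) powr s = (pi / freq j) powr s" for j
  proof -
    have n: "norm (H j) = pi / freq j" using b by (simp add: H_def abs_of_pos[OF freq_pos])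
    have "freq j = 4 * 2 ^ j" by (simp add: freq_def)
    moreover have "(1::real) \<le> 2 ^ j" by simp
    ultimately have "pi \<le> freq j" using pi_less_4 by linarith
    then show "0 < norm (H j)" "norm (H j) \<le> 1" "norm (H j) powr s = (pi / freq j) powr s" unfolding n by auto
  qed
  have D1: "\<bar>D j t\<bar> \<le> \<eta> j" if t: "t > 0" for j t
    unfolding D_def
  proof (rule hconv_bounded[OF t])
    show "(\<lambda>x. sdiff_pow m (H j) w x * cos (freq j * (x \<bullet> b) + (- (real m * pi / 2)))) \<in> borel_measurable borel"
      using sdiff_pow_measurable[OF wm, of m "H j"] by measurable
    have "\<bar>sdiff_pow m (H j) w x\<bar> \<le> \<eta> j" for x
      using eps[OF Hn(1,2)[of j], of x] unfolding m_def w_def[abs_def] \<eta>_def Hn(3) .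
    then show "\<bar>sdiff_pow m (H j) w x * cos (freq j * (x \<bullet> b) + (- (real m * pi / 2)))\<bar> \<le> \<eta> j" for x
      by (rule abs_mult_cos_le)
  qed
  have qP: "q j t \<le> P j t" if t: "t > 0" for j t
  proof -
    have "W j t = L j t - U j t"
      unfolding W_def w_def left_diff_distrib L_def U_def C_def
      by (rule hconv_diff[OF t]) (use BL BU in \<open>auto intro!: abs_mult_cos_le\<close>)
    moreover have "\<bar>W j t\<bar> \<le> \<eta> j + \<bar>E j t\<bar>"
    proof -
      \<comment> \<open>Of the factor \<open>2 ^ m\<close> gained by the \<open>m\<close>
        differences only \<open>2 ^ m \<ge> 1\<close> is kept.\<close>
      have "\<bar>W j t\<bar> * 1 \<le> \<bar>W j t\<bar> * 2 ^ m" by (intro mult_left_mono) auto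
      also have "\<dots> = \<bar>(- 2) ^ m * W j t\<bar>" by (simp add: abs_mult power_abs)
      also have "\<dots> \<le> \<bar>D j t\<bar> + \<bar>E j t\<bar>" unfolding E_def by linarith
      finally show ?thesis using D1[OF t, of j] by linarith
    qed
    ultimately have "L j t - \<eta> j - \<bar>E j t\<bar> - R j t \<le> U j t - R j t" by linarith
    then have "q j t \<le> \<beta> j * (U j t - R j t)" unfolding q_def by (intro mult_left_mono) (auto simp: \<beta>_def)
    also have "\<dots> = (\<beta> j * (1 + (freq j)\<^sup>2) powr (- s / 2)) * P j t" by (simp add: R_def)
    also have "\<beta> j * (1 + (freq j)\<^sup>2) powr (- s / 2) = 1"
    proof -
      have "1 + (freq j)\<^sup>2 > 0" by (simp add: add_pos_nonneg)
      then show ?thesis unfolding \<beta>_def by (simp add: powr_add[symmetric])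
    qed
    finally show ?thesis by simp
  qed
  \<comment> \<open>Test \<open>g\<close> against \<open>S\<close> using
    \<open>g * S \<le> (g^2 + S^2) / 2\<close>: the first square is bounded by \<open>N\<close>, the
    second is the quadratic form \<open>T\<close>.\<close>
  have up: "(\<Sum>j<J. c j * P j t) \<le> N / 2 + T t / 2" if t: "t \<ge> 1" for t
  proof -
    have t0: "t > 0" using t by simp
    define S where "S x = (\<Sum>j<J. c j * C j x)" for x
    have Cd: "\<bar>g x * C j x\<bar> \<le> \<bar>g x\<bar>" for j x unfolding C_def by (rule abs_mult_cos_le) simp
    have i1: "integrable lborel (\<lambda>y. heat t (0 - y) * (g y * C j y))" for j
      by (rule dominated_integrable[OF t0]) (use Cd in auto)
    have i2: "integrable lborel (\<lambda>y. heat t (0 - y) * (C i y * C j y))" for i j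
    proof (rule heat_bounded_integrable[OF t0, of _ 1])
      show "\<bar>C i y * C j y\<bar> \<le> 1" for y unfolding C_def by (rule abs_mult_cos_le) simp
    qed measurable
    have e1: "heat t (0 - y) * (g y * S y) = (\<Sum>j<J. c j * (heat t (0 - y) * (g y * C j y)))" for y
      by (simp add: S_def sum_distrib_left mult_ac)
    have e2: "heat t (0 - y) * (S y)\<^sup>2 = (\<Sum>i<J. \<Sum>j<J. c i * c j * (heat t (0 - y) * (C i y * C j y)))" for y
      by (simp add: S_def power2_eq_square sum_product sum_distrib_left mult_ac)
    have I1: "integrable lborel (\<lambda>y. heat t (0 - y) * (g y * S y))" unfolding e1 using i1 by (intro Bochner_Integration.integrable_sum integrable_mult_right)
    have I2: "integrable lborel (\<lambda>y. heat t (0 - y) * (S y)\<^sup>2)" unfolding e2 using i2 by (intro Bochner_Integration.integrable_sum integrable_mult_right)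
    have eT: "(LINT y|lborel. heat t (0 - y) * (S y)\<^sup>2) = T t"
      unfolding e2 T_def hconv_def using i2
      by (subst Bochner_Integration.integral_sum, intro Bochner_Integration.integrable_sum integrable_mult_right, simp)+
         simp
    have "(\<Sum>j<J. c j * P j t) = (LINT y|lborel. heat t (0 - y) * (g y * S y))"
      unfolding e1 P_def hconv_def using i1 by (subst Bochner_Integration.integral_sum) (auto intro!: integrable_mult_right)
    also have "\<dots> \<le> (LINT y|lborel. (1 / 2) * (heat t (0 - y) * (g y)\<^sup>2 + heat t (0 - y) * (S y)\<^sup>2))"
    proof (intro integral_mono I1 integrable_mult_right Bochner_Integration.integrable_add sq_int[OF t] I2)
      fix y
      have "g y * S y \<le> (1 / 2) * ((g y)\<^sup>2 + (S y)\<^sup>2)"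
        using zero_le_power2[of "g y - S y"] by (simp add: power2_diff)
      then have "heat t (0 - y) * (g y * S y) \<le> heat t (0 - y) * ((1 / 2) * ((g y)\<^sup>2 + (S y)\<^sup>2))" by (intro mult_left_mono) auto
      then show "heat t (0 - y) * (g y * S y) \<le> (1 / 2) * (heat t (0 - y) * (g y)\<^sup>2 + heat t (0 - y) * (S y)\<^sup>2)"
        by (simp only: distrib_left mult.left_commute)
    qed
    also have "\<dots> = (1 / 2) * ((LINT y|lborel. heat t (0 - y) * (g y)\<^sup>2) + T t)"
      unfolding integral_mult_right_zero Bochner_Integration.integral_add[OF sq_int[OF t] I2] eT ..
    also have "\<dots> \<le> (1 / 2) * (N + T t)"
      by (intro mult_left_mono add_right_mono sq_le[OF t]) simp
    finally show ?thesis by (simp add: add_divide_distrib)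
  qed
  have "(\<Sum>j<J. c j * (\<beta> j * (a j * freq j powr (- s) / 2 - \<eta> j - \<bar>0\<bar> - 0))) \<le> N / 2 + (\<Sum>i<J. \<Sum>j<J. c i * c j * (if i = j then 1 / 2 else 0)) / 2"
  proof (rule tendsto_le)
    show "((\<lambda>t. \<Sum>j<J. c j * q j t) \<longlongrightarrow> (\<Sum>j<J. c j * (\<beta> j * (a j * freq j powr (- s) / 2 - \<eta> j - \<bar>0\<bar> - 0)))) at_top"
      by (intro tendsto_sum tendsto_mult tendsto_const q0)
    show "((\<lambda>t. N / 2 + T t / 2) \<longlongrightarrow> N / 2 + (\<Sum>i<J. \<Sum>j<J. c i * c j * (if i = j then 1 / 2 else 0)) / 2) at_top"
      by (intro tendsto_add tendsto_divide tendsto_const T0) simp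
    show "eventually (\<lambda>t. (\<Sum>j<J. c j * q j t) \<le> N / 2 + T t / 2) at_top"
      using eventually_ge_at_top[of 1]
    proof (rule eventually_mono)
      fix t :: real assume t: "1 \<le> t"
      have "(\<Sum>j<J. c j * q j t) \<le> (\<Sum>j<J. c j * P j t)" using c qP[of t] t by (intro sum_mono mult_left_mono) auto
      then show "(\<Sum>j<J. c j * q j t) \<le> N / 2 + T t / 2" using up[OF t] by linarith
    qed
  qed simp
  \<comment> \<open>In the limit the form is diagonal with entries 1/2; with the 1/2 from the
    product inequality this gives the factor 1/4.\<close>
  moreover have "(\<Sum>i<J. \<Sum>j<J. c i * c j * (if i = j then 1 / 2 else 0)) = (\<Sum>i<J. (c i)\<^sup>2) / 2"
    by (simp add: if_distrib sum.delta power2_eq_square sum_divide_distrib cong: if_cong)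
  ultimately show ?thesis by (simp add: \<beta>_def \<eta>_def)
qed

end

section \<open>Strictness of the two inclusions\<close>

lemma bessel_symbol_ge: "s > 0 \<Longrightarrow> 1 \<le> (1 + (freq j)\<^sup>2) powr (s / 2) * freq j powr (- s)"
proof -
  assume s: "s > 0"
  have "freq j powr s = (freq j powr 2) powr (s / 2)" unfolding powr_powr by simp
  also have "\<dots> = (freq j)\<^sup>2 powr (s / 2)" by (simp add: powr_numeral less_imp_le)
  also have "\<dots> \<le> (1 + (freq j)\<^sup>2) powr (s / 2)" using s by (intro powr_mono2) auto
  finally have "freq j powr s * freq j powr (- s) \<le> (1 + (freq j)\<^sup>2) powr (s / 2) * freq j powr (- s)"
    by (intro mult_right_mono) auto
  then show ?thesis using freq_pos[of j] by (simp add: powr_add[symmetric])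
qed

lemma J_bmo_strict_subset_closure:
  assumes s: "s > 0"
  shows "(J_bmo s :: ('a::euclidean_space \<Rightarrow> real) set) \<subset> Lambda_closure s (J_bmo s)"
proof
  show "(J_bmo s :: ('a \<Rightarrow> real) set) \<subseteq> Lambda_closure s (J_bmo s)"
  proof
    fix f :: "'a \<Rightarrow> real" assume f: "f \<in> J_bmo s"
    have "Lambda_norm s (\<lambda>x::'a. 0) \<le> 0 + 0"
    proof (rule LambdaI(2))
      show "\<bar>sdiff_pow (nat \<lfloor>s\<rfloor> + 1) h (\<lambda>x. 0) x\<bar> \<le> 0 * norm h powr s" for h x :: 'a
        using sdiff_pow_bounded[of "\<lambda>x::'a. 0" 0 "nat \<lfloor>s\<rfloor> + 1" h x] by simp
    qed auto
    then have "Lambda_norm s (\<lambda>x. f x - f x) < \<epsilon>" if "\<epsilon> > 0" for \<epsilon> using that by simp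
    then show "f \<in> Lambda_closure s (J_bmo s)"
      using f J_bmo_subset_Lambda[OF s] unfolding Lambda_closure_def by blast
  qed
next
  define b :: 'a where "b = (SOME i. i \<in> Basis)"
  have b: "b \<in> Basis" by (simp add: b_def SOME_Basis)
  define a where "a k = 1 / sqrt (real (Suc k))" for k
  have a2: "(a k)\<^sup>2 = 1 / real (Suc k)" "a k \<ge> 0" "\<bar>a k\<bar> \<le> 1" for k
    by (auto simp: a_def power_divide)
  have "a \<longlonglongrightarrow> 0"
    unfolding a_def by (intro tendsto_divide_0[OF tendsto_const] filterlim_at_top_imp_at_infinity
        filterlim_compose[OF sqrt_at_top] filterlim_compose[OF filterlim_real_sequentially] filterlim_Suc)
  then have cl: "lac b s a \<in> Lambda_closure s (J_bmo s)" by (rule lac_in_closure[OF s b])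
  have "lac b s a \<notin> J_bmo s"
  proof
    assume "lac b s a \<in> J_bmo s"
    then obtain g where g: "g \<in> bmo" "lac b s a = bessel_pot s g" by (auto simp: J_bmo_def)
    obtain N M where "heat_tame g N M" using bmo_heat_tame[OF g(1)] by blast
    then interpret heat_tame g N M .
    have "(\<Sum>j<J. (a j)\<^sup>2) \<le> 2 * N" for J
    proof -
      \<comment> \<open>Take \<open>c = a\<close> and error 0, as the difference vanishes
        identically. The left side is then half the square sum and absorbs the quarter on the right,
        contradicting the divergence of the harmonic series.\<close>
      have "(\<Sum>j<J. a j * (a j / 2)) \<le> (\<Sum>j<J. a j * ((1 + (freq j)\<^sup>2) powr (s / 2) * (a j * freq j powr (- s) / 2 - 0 * (pi / freq j) powr s)))"
      proof (intro sum_mono mult_left_mono a2(2))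
        fix j
        show "a j / 2 \<le> (1 + (freq j)\<^sup>2) powr (s / 2) * (a j * freq j powr (- s) / 2 - 0 * (pi / freq j) powr s)"
          using mult_right_mono[OF bessel_symbol_ge[OF s, of j], of "a j / 2"] a2(2)[of j] by (simp add: mult_ac)
      qed
      also have "\<dots> \<le> N / 2 + (\<Sum>j<J. (a j)\<^sup>2) / 4"
      proof (rule lacunary_coefficients_bound[OF s b a2(3) a2(2)])
        show "\<bar>sdiff_pow (nat \<lfloor>s\<rfloor> + 1) h (\<lambda>x. lac b s a x - bessel_pot s g x) x\<bar> \<le> 0 * norm h powr s" for h x
          using sdiff_pow_bounded[of "\<lambda>x::'a. 0" 0 "nat \<lfloor>s\<rfloor> + 1" h x] by (simp add: g(2))
      qed
      finally have "(\<Sum>j<J. (a j)\<^sup>2) / 2 \<le> N / 2 + (\<Sum>j<J. (a j)\<^sup>2) / 4"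
        by (simp add: power2_eq_square sum_divide_distrib)
      then show ?thesis by linarith
    qed
    then have "summable (\<lambda>j. (a j)\<^sup>2)" by (intro summableI_nonneg_bounded) auto
    then have "summable (\<lambda>j. inverse (real (Suc j)))" unfolding a2(1) by (simp add: inverse_eq_divide)
    then show False using not_summable_harmonic[where 'a=real] summable_Suc_iff[of "\<lambda>j. inverse (real j)"] by simp
  qed
  with cl show "J_bmo s \<noteq> (Lambda_closure s (J_bmo s) :: ('a \<Rightarrow> real) set)" by blast
qed

lemma closure_strict_subset_Lambda:
  assumes s: "s > 0"
  shows "Lambda_closure s (J_bmo s) \<subset> (Lambda s :: ('a::euclidean_space \<Rightarrow> real) set)"
proof
  show "Lambda_closure s (J_bmo s) \<subseteq> (Lambda s :: ('a \<Rightarrow> real) set)" by (auto simp: Lambda_closure_def)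
next
  define b :: 'a where "b = (SOME i. i \<in> Basis)"
  have b: "b \<in> Basis" by (simp add: b_def SOME_Basis)
  define a where "a = (\<lambda>k::nat. 1::real)"
  have a1: "\<bar>a k\<bar> \<le> 1" for k by (simp add: a_def)
  have L: "lac b s a \<in> Lambda s" using lac_Lambda[OF s b] a1 by metis
  \<comment> \<open>With unit coefficients the main term at each frequency is
    \<open>freq j powr (- s) / 2\<close>; this choice lets the approximation error consume exactly
    half of it.\<close>
  define \<epsilon> where "\<epsilon> = 1 / (4 * pi powr s)"
  have e: "\<epsilon> > 0" "\<epsilon> * pi powr s = 1 / 4" by (auto simp: \<epsilon>_def)
  have "lac b s a \<notin> Lambda_closure s (J_bmo s)"
  proof
    assume "lac b s a \<in> Lambda_closure s (J_bmo s)"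
    then obtain f where f: "f \<in> J_bmo s" "Lambda_norm s (\<lambda>x. lac b s a x - f x) < \<epsilon>"
      using e(1) unfolding Lambda_closure_def by blast
    then obtain g where g: "g \<in> bmo" "f = bessel_pot s g" by (auto simp: J_bmo_def)
    obtain N M where "heat_tame g N M" using bmo_heat_tame[OF g(1)] by blast
    then interpret heat_tame g N M .
    have D: "(\<lambda>x. lac b s a x - bessel_pot s g x) \<in> Lambda s"
      by (rule Lambda_diff[OF L bessel_pot_in_Lambda[OF s]])
    have eps: "\<bar>sdiff_pow (nat \<lfloor>s\<rfloor> + 1) h (\<lambda>x. lac b s a x - bessel_pot s g x) x\<bar> \<le> \<epsilon> * norm h powr s"
      if h: "0 < norm h" "norm h \<le> 1" for h x
    proof -
      have "Sup (zyg_quot s (\<lambda>x. lac b s a x - bessel_pot s g x)) \<le> \<epsilon>"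
        using Lambda_sdiff_le(2)[OF D h] f(2) g(2) by simp
      then have "Sup (zyg_quot s (\<lambda>x. lac b s a x - bessel_pot s g x)) * norm h powr s \<le> \<epsilon> * norm h powr s"
        by (intro mult_right_mono) auto
      then show ?thesis using Lambda_sdiff_le(1)[OF D h, of x] by linarith
    qed
    have "real J \<le> 8 * N" for J :: nat
    proof -
      \<comment> \<open>With \<open>c = 1 / 2\<close> each frequency contributes at least 1/8 on the
        left and 1/16 on the right, so \<open>J\<close> would stay bounded.\<close>
      have "(\<Sum>j<J. 1 / 8) \<le> (\<Sum>j<J. (1 / 2) * ((1 + (freq j)\<^sup>2) powr (s / 2) * (a j * freq j powr (- s) / 2 - \<epsilon> * (pi / freq j) powr s)))"
      proof (intro sum_mono)
        fix j
        have "(pi / freq j) powr s = pi powr s * freq j powr (- s)" using freq_pos[of j] by (simp add: powr_divide powr_minus_divide)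
        then have "\<epsilon> * (pi / freq j) powr s = freq j powr (- s) / 4" using e(2) by simp
        then have eq: "(1 + (freq j)\<^sup>2) powr (s / 2) * (a j * freq j powr (- s) / 2 - \<epsilon> * (pi / freq j) powr s) = ((1 + (freq j)\<^sup>2) powr (s / 2) * freq j powr (- s)) / 4"
          by (simp add: a_def field_simps)
        show "1 / 8 \<le> (1 / 2) * ((1 + (freq j)\<^sup>2) powr (s / 2) * (a j * freq j powr (- s) / 2 - \<epsilon> * (pi / freq j) powr s))"
          unfolding eq using bessel_symbol_ge[OF s, of j] by linarith
      qed
      also have "\<dots> \<le> N / 2 + (\<Sum>j<J. (1 / 2)\<^sup>2) / 4"
        by (rule lacunary_coefficients_bound[OF s b a1 _ eps]) auto
      finally show ?thesis by (simp add: power2_eq_square)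
    qed
    then show False using reals_Archimedean2[of "8 * N"] by (meson not_le)
  qed
  with L show "Lambda_closure s (J_bmo s) \<noteq> (Lambda s :: ('a \<Rightarrow> real) set)" by blast
qed

theorem mainTheorem12:
  fixes s :: real
  assumes "0 < s"
  shows "(J_bmo s :: ('a::euclidean_space \<Rightarrow> real) set) \<subset> Lambda_closure s (J_bmo s)
         \<and> Lambda_closure s (J_bmo s) \<subset> (Lambda s :: ('a \<Rightarrow> real) set)"
  using J_bmo_strict_subset_closure[OF assms] closure_strict_subset_Lambda[OF assms] by blast

end
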